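(* Let $S$ be a semigroup (under composition) of complex polynomials in one variable containing at least one non-special polynomial of degree greater than one. Then the following conditions are equivalent: 1) $S$ is left reversible. 2) $S$ is left amenable. 3) $S$ is amenable. 4) $S$ is a subsemigroup of $S_{\Gamma,R}$ for some non-special polynomial $R$ of degree at least two and some group $\Gamma\subseteq G(R)$ such that $\gamma_R(\Gamma)=\Gamma$. 5) $S$ is a subsemigroup of $C(P)$ for some non-special polynomial $P$ of degree at least two. Furthermore, if $S$ contains only polynomials of degree at least two, then each of conditions 1), 2), 3), 4), 5) is equivalent to the condition that for all $A,B\in S$ there exist $k,l\geq 1$ such that $A^{\circ k}=B^{\circ l}$.
   Context: Rational functions are elements of $\mathbb{C}(z)$, and a semigroup of polynomials (or rational functions) is a nonempty set of nonconstant polynomials (rational functions) closed under composition. $A^{\circ k}$ is the $k$-th iterate. A polynomial of degree at least two is special if it is conjugate (by a degree-one polynomial) to $z^n$, $n\ge 2$, or to $\pm T_n$, $n\geq 2$, where $T_n$ is the $n$-th Chebyshev polynomial ($T_n(\cos\theta)=\cos n\theta$). A semigroup $S$ is left reversible if for all $a,b\in S$ there exist $x,y\in S$ with $ax=by$. $S$ is left amenable if there is a finitely additive probability measure $\mu$ defined on all subsets of $S$ such that $\mu(a^{-1}T)=\mu(T)$ for all $a\in S$, $T\subseteq S$, where $a^{-1}T=\{s\in S: as\in T\}$. Right amenable is defined symmetrically, with $\{s\in S: sa\in T\}$ in place of $a^{-1}T$. $S$ is amenable if it is both left and right amenable. For a rational function $R$ of degree at least two, $C(R)$ is the semigroup of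 all rational functions (including those of degree one) commuting with $R$ under composition. $G(R)$ is the group of all Möbius transformations $\sigma$ such that $R\circ\sigma=\nu\circ R$ for some Möbius transformation $\nu$; this $\nu=\nu_\sigma$ is unique and $\gamma_R:\sigma\mapsto\nu_\sigma$ is a homomorphism from $G(R)$ to $\mathrm{Aut}(\mathbb{CP}^1)$. For a subgroup $\Gamma$ of $G(R)$ with $\gamma_R(\Gamma)\subseteq\Gamma$, $S_{\Gamma,R}$ is the semigroup generated under composition by $\Gamma$ and $R$. *)

theory Defs
  imports
    "HOL-Analysis.Measure_Space"
    "HOL-Computational_Algebra.Polynomial_Factorial"
    "HOL-Computational_Algebra.Field_as_Ring"
    "HOL-Computational_Algebra.Fundamental_Theorem_Algebra"
    "HOL-Algebra.Group"
begin

section \<open>Reversible and amenable semigroups\<close>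

text \<open>A semigroup is given by a carrier \<open>S\<close> and a multiplication \<open>m\<close>.\<close>

definition left_reversible :: "('a \<Rightarrow> 'a \<Rightarrow> 'a) \<Rightarrow> 'a set \<Rightarrow> bool" where
  "left_reversible m S \<longleftrightarrow> (\<forall>a\<in>S. \<forall>b\<in>S. \<exists>x\<in>S. \<exists>y\<in>S. m a x = m b y)"

text \<open>The value of \<open>\<mu>\<close> outside \<open>Pow S\<close> is irrelevant.\<close>

definition fin_additive_prob :: "'a set \<Rightarrow> ('a set \<Rightarrow> real) \<Rightarrow> bool" where
  "fin_additive_prob S \<mu> \<longleftrightarrow>
     (\<forall>T. T \<subseteq> S \<longrightarrow> 0 \<le> \<mu> T) \<and> \<mu> S = 1 \<and> Measure_Space.additive (Pow S) \<mu>"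

definition left_amenable :: "('a \<Rightarrow> 'a \<Rightarrow> 'a) \<Rightarrow> 'a set \<Rightarrow> bool" where
  "left_amenable m S \<longleftrightarrow>
     (\<exists>\<mu>. fin_additive_prob S \<mu> \<and> (\<forall>a\<in>S. \<forall>T. T \<subseteq> S \<longrightarrow> \<mu> {s \<in> S. m a s \<in> T} = \<mu> T))"

definition right_amenable :: "('a \<Rightarrow> 'a \<Rightarrow> 'a) \<Rightarrow> 'a set \<Rightarrow> bool" where
  "right_amenable m S \<longleftrightarrow>
     (\<exists>\<mu>. fin_additive_prob S \<mu> \<and> (\<forall>a\<in>S. \<forall>T. T \<subseteq> S \<longrightarrow> \<mu> {s \<in> S. m s a \<in> T} = \<mu> T))"

definition amenable :: "('a \<Rightarrow> 'a \<Rightarrow> 'a) \<Rightarrow> 'a set \<Rightarrow> bool" where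
  "amenable m S \<longleftrightarrow> left_amenable m S \<and> right_amenable m S"

inductive_set semigroup_gen :: "('a \<Rightarrow> 'a \<Rightarrow> 'a) \<Rightarrow> 'a set \<Rightarrow> 'a set"
  for m :: "'a \<Rightarrow> 'a \<Rightarrow> 'a" and A :: "'a set" where
  base: "a \<in> A \<Longrightarrow> a \<in> semigroup_gen m A"
| mult: "a \<in> semigroup_gen m A \<Longrightarrow> b \<in> semigroup_gen m A \<Longrightarrow> m a b \<in> semigroup_gen m A"


section \<open>Polynomials\<close>

definition poly_semigroup :: "complex poly set \<Rightarrow> bool" where
  "poly_semigroup S \<longleftrightarrow>
     S \<noteq> {} \<and> (\<forall>A\<in>S. 0 < degree A) \<and> (\<forall>A\<in>S. \<forall>B\<in>S. pcompose A B \<in> S)"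

definition poly_iter :: "complex poly \<Rightarrow> nat \<Rightarrow> complex poly" where
  "poly_iter A k = (pcompose A ^^ k) [:0, 1:]"

definition chebyshev :: "nat \<Rightarrow> complex poly" where
  "chebyshev n = (THE T. \<forall>\<theta>. poly T (cos \<theta>) = cos (of_nat n * \<theta>))"

lemma chebyshev_ex: "\<exists>T :: complex poly. \<forall>\<theta>. poly T (cos \<theta>) = cos (of_nat n * \<theta>)"
proof (induction n rule: less_induct)
  case (less n)
  consider "n = 0" | "n = 1" | k where "n = Suc (Suc k)"
    by (metis One_nat_def not0_implies_Suc)
  then show ?case
  proof cases
    case 1
    then show ?thesis by (intro exI[of _ 1]) simp
  next
    case 2
    then show ?thesis by (intro exI[of _ "[:0, 1:]"]) simp
  next
    case 3
    obtain T U :: "complex poly"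
      where TU: "\<And>\<theta>. poly T (cos \<theta>) = cos (of_nat k * \<theta>)"
        "\<And>\<theta>. poly U (cos \<theta>) = cos (of_nat (Suc k) * \<theta>)"
      using less[of k] less[of "Suc k"] 3 by auto
    have "cos (of_nat n * \<theta>) = 2 * cos \<theta> * cos (of_nat (Suc k) * \<theta>) - cos (of_nat k * \<theta>)"
      for \<theta> :: complex
    proof -
      have "of_nat n * \<theta> = of_nat (Suc k) * \<theta> + \<theta>" "of_nat k * \<theta> = of_nat (Suc k) * \<theta> - \<theta>"
        using 3 by (simp_all add: algebra_simps)
      then show ?thesis by (simp only: cos_add cos_diff) (simp add: algebra_simps)
    qed
    then show ?thesis
      by (intro exI[of _ "[:0, 2:] * U - T"]) (simp add: TU)
  qed
qed

lemma chebyshev_unique: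
  fixes T U :: "complex poly"
  assumes "\<And>\<theta>. poly T (cos \<theta>) = poly U (cos \<theta>)"
  shows "T = U"
proof (rule ccontr)
  assume "T \<noteq> U"
  then have "finite {z. poly (T - U) z = 0}" by (intro poly_roots_finite) simp
  moreover have "complex_of_real ` {0..1} \<subseteq> {z. poly (T - U) z = 0}"
  proof
    fix z assume "z \<in> complex_of_real ` {0..1}"
    then obtain x where x: "z = of_real x" "0 \<le> x" "x \<le> 1" by auto
    then have "z = cos (of_real (arccos x))" by (simp add: cos_of_real)
    then show "z \<in> {z. poly (T - U) z = 0}" using assms by simp
  qed
  ultimately have "finite (complex_of_real ` {0..1})" by (rule rev_finite_subset)
  then have "finite {0..1::real}" by (rule finite_imageD) (simp add: inj_on_def)
  then show False using infinite_Icc[of "0::real" 1] by simp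
qed

lemma poly_chebyshev_cos: "poly (chebyshev n) (cos \<theta>) = cos (of_nat n * \<theta>)"
proof -
  have "\<exists>!T :: complex poly. \<forall>\<theta>. poly T (cos \<theta>) = cos (of_nat n * \<theta>)"
    using chebyshev_ex[of n] by (auto intro: chebyshev_unique)
  from theI'[OF this] show ?thesis unfolding chebyshev_def by blast
qed

definition poly_conjugate :: "complex poly \<Rightarrow> complex poly \<Rightarrow> bool" where
  "poly_conjugate P Q \<longleftrightarrow> (\<exists>l. degree l = 1 \<and> pcompose l P = pcompose Q l)"

definition special :: "complex poly \<Rightarrow> bool" where
  "special P \<longleftrightarrow>
     (\<exists>n\<ge>2. poly_conjugate P (monom 1 n) \<or> poly_conjugate P (chebyshev n)
           \<or> poly_conjugate P (- chebyshev n))"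


section \<open>Rational functions\<close>

type_synonym ratfun = "complex poly fract"

definition rat_const :: "complex \<Rightarrow> ratfun" where
  "rat_const c = to_fract [:c:]"

text \<open>Substitution of \<open>g\<close> into \<open>f\<close>. The denominator does not vanish when \<open>g\<close> is not constant
  (lemma \<open>subst_eq_0_iff\<close> below); only such \<open>g\<close> are used.\<close>

definition rat_comp :: "ratfun \<Rightarrow> ratfun \<Rightarrow> ratfun" (infixl \<open>\<circ>\<^sub>r\<close> 71) where
  "f \<circ>\<^sub>r g = (case quot_of_fract f of (p, q) \<Rightarrow>
     poly (map_poly rat_const p) g / poly (map_poly rat_const q) g)"

definition rat_nonconst :: "ratfun \<Rightarrow> bool" where
  "rat_nonconst f \<longleftrightarrow> f \<notin> range rat_const"

definition moebius :: "ratfun \<Rightarrow> bool" where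
  "moebius \<sigma> \<longleftrightarrow>
     (\<exists>a b c d. a * d - b * c \<noteq> 0 \<and> \<sigma> = to_fract [:b, a:] / to_fract [:d, c:])"

definition rat_centralizer :: "ratfun \<Rightarrow> ratfun set" where
  "rat_centralizer R = {F. rat_nonconst F \<and> F \<circ>\<^sub>r R = R \<circ>\<^sub>r F}"

definition G_group :: "ratfun \<Rightarrow> ratfun monoid" where
  "G_group R =
     \<lparr>carrier = {\<sigma>. moebius \<sigma> \<and> (\<exists>\<nu>. moebius \<nu> \<and> R \<circ>\<^sub>r \<sigma> = \<nu> \<circ>\<^sub>r R)},
      mult = (\<circ>\<^sub>r), one = to_fract [:0, 1:]\<rparr>"

definition gamma :: "ratfun \<Rightarrow> ratfun \<Rightarrow> ratfun" where
  "gamma R \<sigma> = (THE \<nu>. moebius \<nu> \<and> R \<circ>\<^sub>r \<sigma> = \<nu> \<circ>\<^sub>r R)"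

definition S_semigroup :: "ratfun set \<Rightarrow> ratfun \<Rightarrow> ratfun set" where
  "S_semigroup \<Gamma> R = semigroup_gen (\<circ>\<^sub>r) (insert R \<Gamma>)"

subsection \<open>Composition is well behaved on nonconstant rational functions\<close>

lemma rat_const_simps [simp]:
  "rat_const 0 = 0" "rat_const 1 = 1"
  "rat_const (a + b) = rat_const a + rat_const b"
  "rat_const (a * b) = rat_const a * rat_const b"
  "rat_const (- a) = - rat_const a"
proof -
  show "rat_const (a * b) = rat_const a * rat_const b"
    unfolding rat_const_def to_fract_mult[symmetric] by simp
  show "rat_const (a + b) = rat_const a + rat_const b"
    unfolding rat_const_def to_fract_add[symmetric] by simp
  show "rat_const (- a) = - rat_const a"
    unfolding rat_const_def to_fract_uminus[symmetric] by simp
qed (simp_all add: rat_const_def flip: one_pCons)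

abbreviation subst :: "complex poly \<Rightarrow> ratfun \<Rightarrow> ratfun" where
  "subst p g \<equiv> poly (map_poly rat_const p) g"

lemma subst_pCons: "subst (pCons a p) g = rat_const a + g * subst p g"
  by (simp add: map_poly_pCons)

lemma subst_add: "subst (p + q) g = subst p g + subst q g"
proof -
  have "map_poly rat_const (p + q) = map_poly rat_const p + map_poly rat_const q"
    by (rule poly_eqI) (simp add: coeff_map_poly)
  then show ?thesis by simp
qed

lemma subst_smult: "subst (smult a p) g = rat_const a * subst p g"
proof -
  have "map_poly rat_const (smult a p) = smult (rat_const a) (map_poly rat_const p)"
    by (rule poly_eqI) (simp add: coeff_map_poly)
  then show ?thesis by simp
qed

lemma subst_mult: "subst (p * q) g = subst p g * subst q g"
  by (induction p) (simp_all add: subst_add subst_smult subst_pCons algebra_simps)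

lemma subst_to_fract: "subst p (to_fract q) = to_fract (pcompose p q)"
proof (induction p)
  case (pCons a p)
  then show ?case
    by (simp only: subst_pCons pcompose_pCons to_fract_add to_fract_mult rat_const_def[of a])
qed simp

lemma subst_eq_0_iff:
  assumes "rat_nonconst g"
  shows "subst p g = 0 \<longleftrightarrow> p = 0"
proof
  show "p = 0" if "subst p g = 0" using that
  proof (induction "degree p" arbitrary: p rule: less_induct)
    case less
    show ?case
    proof (cases "degree p = 0")
      case True
      then obtain a where a: "p = [:a:]" by (rule degree_eq_zeroE)
      with less.prems have "rat_const a = 0" by (simp add: subst_pCons)
      with a show ?thesis by (simp add: rat_const_def)
    next
      case False
      then obtain z where "poly p z = 0"
        using fundamental_theorem_of_algebra[of p] constant_degree[of p] by auto
      then obtain q where q: "p = [:- z, 1:] * q" by (auto simp: poly_eq_0_iff_dvd)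
      have "g - rat_const z \<noteq> 0" using assms by (auto simp: rat_nonconst_def)
      moreover have "(g - rat_const z) * subst q g = 0"
        using less.prems unfolding q subst_mult by (simp add: subst_pCons)
      ultimately have 0: "subst q g = 0" by simp
      have "q \<noteq> 0" using False q by auto
      then have "degree q < degree p" unfolding q by (subst degree_mult_eq) auto
      from less.hyps[OF this 0] q show ?thesis by simp
    qed
  qed
qed simp

lemma rat_comp_quot:
  assumes "rat_nonconst g" "q \<noteq> 0"
  shows "(to_fract p / to_fract q) \<circ>\<^sub>r g = subst p g / subst q g"
proof -
  obtain a b where ab: "quot_of_fract (to_fract p / to_fract q) = (a, b)" by fastforce
  have b: "b \<noteq> 0" using ab snd_quot_of_fract_nonzero by (metis snd_conv)
  have "to_fract p / to_fract q = to_fract a / to_fract b"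
    using ab b quot_to_fract_quot_of_fract[of "to_fract p / to_fract q"]
    by (simp add: quot_to_fract_def Fract_conv_to_fract)
  then have "p * b = a * q" using b assms
    by (simp add: frac_eq_eq flip: to_fract_mult)
  then have "subst p g * subst b g = subst a g * subst q g"
    by (simp flip: subst_mult)
  then show ?thesis using b assms
    by (simp add: rat_comp_def ab frac_eq_eq subst_eq_0_iff)
qed

lemma rat_comp_to_fract:
  assumes "0 < degree q"
  shows "to_fract p \<circ>\<^sub>r to_fract q = to_fract (pcompose p q)"
proof -
  have "rat_nonconst (to_fract q)"
    using assms by (auto simp: rat_nonconst_def rat_const_def)
  from rat_comp_quot[OF this, of 1 p] show ?thesis
    by (simp add: subst_to_fract)
qed

lemma ratfunE:
  obtains p q where "f = to_fract p / to_fract q" "q \<noteq> (0 :: complex poly)"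
  by (metis Fract_cases Fract_conv_to_fract)

lemma rat_comp_inject:
  assumes "rat_nonconst g"
  shows "f \<circ>\<^sub>r g = f' \<circ>\<^sub>r g \<longleftrightarrow> f = f'"
proof
  assume eq: "f \<circ>\<^sub>r g = f' \<circ>\<^sub>r g"
  obtain p q p' q' where f: "f = to_fract p / to_fract q" "q \<noteq> 0"
    "f' = to_fract p' / to_fract q'" "q' \<noteq> 0" by (metis ratfunE)
  with eq assms have "subst p g * subst q' g = subst p' g * subst q g"
    by (simp add: rat_comp_quot frac_eq_eq subst_eq_0_iff)
  then have "subst (p * q' + - (p' * q)) g = 0"
    using subst_smult[of "-1" "p' * q" g] by (simp only: subst_add subst_mult) (simp add: subst_mult)
  with assms have "p * q' = p' * q" by (simp add: subst_eq_0_iff)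
  with f show "f = f'" by (simp add: frac_eq_eq flip: to_fract_mult)
qed simp

lemma gamma_eqI:
  assumes "rat_nonconst R" "moebius \<nu>" "R \<circ>\<^sub>r \<sigma> = \<nu> \<circ>\<^sub>r R"
  shows "gamma R \<sigma> = \<nu>"
  unfolding gamma_def using assms by (intro the_equality) (auto simp: rat_comp_inject)

end

theory Submission
  imports Defs
    "HOL-Computational_Algebra.Formal_Laurent_Series"
    "HOL-Analysis.Kronecker_Approximation_Theorem"
begin

text \<open>
  Comparing degrees at infinity, \<open>A \<circ> X = B \<circ> Y\<close> with \<open>degree A = degree B\<close> forces \<open>B = A \<circ> W\<close> with \<open>W\<close> affine. In a
  left reversible semigroup this gives \<open>A \<circ> P\<^sup>k = P\<^sup>k \<circ> A \<circ> W\<close> for all iterates \<open>P\<^sup>k\<close> of a non-special \<open>P\<close>. The twists \<open>W\<close>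
  come from the finitely many affine symmetries of \<open>P\<close>, hence vanish for a suitable \<open>k\<close> that does not depend on \<open>A\<close>, and the
  whole semigroup commutes with \<open>P\<^sup>k\<close>.

  Commuting polynomials \<open>A\<close>, \<open>P\<close> with \<open>P\<close> non-special have a common iterate (Ritt). If their degrees were multiplicatively
  independent, products of iterates would give commuting \<open>B\<close>, \<open>C\<close> of almost equal degree. For an iterate \<open>p\<close> of \<open>P\<close> of large
  degree, the Laurent series \<open>h = degree p * p / p'\<close> at infinity satisfies \<open>X' h = degree X * (h \<circ> X)\<close> up to an error
  of high order for \<open>X \<in> {B \<circ> B, B \<circ> C, C \<circ> C}\<close>. Each pair of these yields a linear equation in \<open>h\<^sup>2\<close> and its first two
  derivatives; solving the system by Cramer's rule approximates \<open>h\<^sup>2\<close> by a rational function of small degree, which then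
  is exactly a solution \<open>y\<close> of \<open>P'\<^sup>2 y = (degree P)\<^sup>2 (y \<circ> P)\<close>. Such a \<open>y\<close> is a quadratic polynomial, and the equation
  characterizes powers and Chebyshev polynomials up to conjugation.

  Consequently a semigroup inside a centralizer is cancellative, has boundedly many elements of each degree, and its degrees
  are determined by the multiplicity of one prime; the balls for this length function form a two-sided Folner sequence, so the
  semigroup is amenable. Finally, the centralizer of \<open>P\<close> is generated by its affine elements and an element \<open>R\<close> of minimal
  degree \<open>\<ge> 2\<close>.
\<close>

section \<open>Decompositions with a common left degree\<close>

text \<open>The series \<open>h\<close> imitates the field \<phi> / \<phi>' of a Boettcher
  coordinate \<phi> at infinity, in which every commuting \<open>X\<close> is a constant times a
  power. Truncating at an iterate \<open>p\<close> keeps all compositions between polynomials; the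
  price is that identities hold only up to orders that must be tracked. The unknown is
  \<open>h\<^sup>2\<close> rather than \<open>h\<close> because for Chebyshev polynomials only the
  square is rational. The equations are linear for this reason: if \<rho> is the quotient of two
  commuting polynomials and has degree \<open>k\<close>, then \<open>h * ddz\<close> nearly
  multiplies \<rho> by \<open>k\<close>, so \<open>\<rho> - 1 / \<rho>\<close> is nearly an
  eigenvector of the squared operator; up to a constant this difference is a weighted Wronskian of
  the two polynomials times \<open>h\<close>. The constant is the coefficient of
  \<open>1 / z\<close> in \<open>h - z\<close>, whence the effort to prove it nonzero. Special
  polynomials enter only through \<open>quadratic_ode\<close>, which passes easily between a
  polynomial, its iterates and its conjugates.\<close>

lemma pcompose_right_cancel:
  fixes p q r :: "complex poly"
  assumes "p \<circ>\<^sub>p r = q \<circ>\<^sub>p r" "0 < degree r"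
  shows "p = q"
proof -
  have "(p - q) \<circ>\<^sub>p r = 0" using assms by (simp add: pcompose_diff)
  then show ?thesis using assms(2) pcompose_eq_0 by fastforce
qed

lemma pcompose_power: "(p ^ n) \<circ>\<^sub>p q = (p \<circ>\<^sub>p q) ^ n" for p q :: "complex poly"
  by (induction n) (simp_all add: pcompose_mult pcompose_1)

lemma degree_1_E:
  fixes l :: "complex poly"
  assumes "degree l = 1"
  obtains a b where "l = [:b, a:]" "a \<noteq> 0"
proof -
  obtain b p where l: "l = pCons b p" by (cases l)
  with assms have "degree p = 0" by (metis degree_pCons_eq_if diff_Suc_1 One_nat_def degree_0)
  then obtain a where "p = [:a:]" by (rule degree_eq_zeroE)
  with l assms that show thesis by (cases "a = 0") auto
qed

lemma pcompose_linear_inverse: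
  fixes a b :: complex
  assumes "a \<noteq> 0"
  shows "[:b, a:] \<circ>\<^sub>p [:-b/a, 1/a:] = [:0, 1:]" "[:-b/a, 1/a:] \<circ>\<^sub>p [:b, a:] = [:0, 1:]"
  using assms by (simp_all add: pcompose_pCons field_simps)

lemma coeff_mult_top:
  fixes p q :: "'a::comm_semiring_0 poly"
  assumes "degree p \<le> a" "degree q \<le> b"
  shows "coeff (p * q) (a + b) = coeff p a * coeff q b"
proof -
  have "coeff (p * q) (a + b) = (\<Sum>i\<le>a + b. coeff p i * coeff q (a + b - i))"
    by (simp add: coeff_mult)
  also have "\<dots> = (\<Sum>i\<in>{a}. coeff p i * coeff q (a + b - i))"
  proof (rule sum.mono_neutral_right)
    show "\<forall>i\<in>{..a + b} - {a}. coeff p i * coeff q (a + b - i) = 0"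
    proof
      fix i assume i: "i \<in> {..a + b} - {a}"
      then consider "i > a" | "i < a" by fastforce
      then show "coeff p i * coeff q (a + b - i) = 0"
      proof cases
        case 1 then show ?thesis using assms by (simp add: coeff_eq_0)
      next
        case 2
        then have "degree q < a + b - i" using assms by linarith
        then show ?thesis by (simp add: coeff_eq_0)
      qed
    qed
  qed auto
  finally show ?thesis by simp
qed

lemma degree_power_le': "degree p \<le> a \<Longrightarrow> degree (p ^ i) \<le> a * i" for p :: "complex poly"
  by (meson degree_power_le le_trans mult_le_mono1)

lemma coeff_power_top:
  fixes p :: "complex poly"
  assumes "degree p \<le> a"
  shows "coeff (p ^ i) (a * i) = coeff p a ^ i"
proof (induction i)
  case (Suc i)
  have "coeff (p * p ^ i) (a + a * i) = coeff p a * coeff (p ^ i) (a * i)"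
    by (rule coeff_mult_top) (use assms degree_power_le' in auto)
  with Suc show ?case by simp
qed simp

text \<open>\<open>S\<close> is the cofactor in \<open>V ^ n - W ^ n = (V - W) * S\<close>. Its top
  coefficient adds up \<open>n\<close> equal terms, so nothing cancels, and the size of a difference
  of \<open>n\<close>-th powers controls the size of \<open>V - W\<close>.\<close>

lemma geometric_sum_top:
  fixes V W :: "complex poly" and n :: nat
  assumes "degree V \<le> k" "degree W \<le> k" "coeff V k = w" "coeff W k = w"
  defines "S \<equiv> (\<Sum>i<n. W ^ (n - Suc i) * V ^ i)"
  shows "degree S \<le> k * (n - 1)" "coeff S (k * (n - 1)) = of_nat n * w ^ (n - 1)"
proof -
  have eq: "k * (n - 1) = k * (n - Suc i) + k * i" if "i < n" for i
    using that by (auto simp flip: distrib_left)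
  have "degree (W ^ (n - Suc i) * V ^ i) \<le> k * (n - 1)" if "i < n" for i
    unfolding eq[OF that] using assms
    by (intro order.trans[OF degree_mult_le] add_mono degree_power_le')
  then show "degree S \<le> k * (n - 1)"
    unfolding S_def by (intro degree_sum_le) auto
  have "coeff (W ^ (n - Suc i) * V ^ i) (k * (n - 1)) = w ^ (n - 1)" if "i < n" for i
  proof -
    have "coeff (W ^ (n - Suc i) * V ^ i) (k * (n - 1)) = w ^ (n - Suc i) * w ^ i"
      unfolding eq[OF that] using assms
      by (subst coeff_mult_top) (auto simp: coeff_power_top intro: degree_power_le')
    then show ?thesis using that by (auto simp flip: power_add)
  qed
  then show "coeff S (k * (n - 1)) = of_nat n * w ^ (n - 1)"
    unfolding S_def by (simp add: coeff_sum)
qed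

text \<open>\<open>W\<close> is the polynomial part of the \<open>n\<close>-th root of \<open>B\<close> at infinity.\<close>

lemma approximate_root:
  fixes B :: "complex poly"
  assumes n: "0 < n" and B: "degree B = k * n" and k: "0 < k"
  shows "\<exists>W. degree W = k \<and> lead_coeff W ^ n = lead_coeff B \<and>
           (\<forall>i\<ge>k * (n - 1). coeff (B - W ^ n) i = 0)"
proof -
  from B n k have B0: "B \<noteq> 0" by auto
  obtain w where w: "w ^ n = lead_coeff B"
    using nth_root_exists[of n "lead_coeff B"] n by auto
  with B0 n have w0: "w \<noteq> 0" by (metis leading_coeff_0_iff zero_power)
  \<comment> \<open>The lower coefficients are found one at a time; each of the \<open>k\<close>
    steps pushes the first error one degree down, from \<open>k * n\<close> to
    \<open>k * (n - 1)\<close>.\<close>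
  have "\<exists>W. degree W = k \<and> lead_coeff W = w \<and> (\<forall>i\<ge>k * n - j. coeff (B - W ^ n) i = 0)"
    if "j \<le> k" for j
    using that
  proof (induction j)
    case 0
    have "coeff (B - monom w k ^ n) i = 0" if "i \<ge> k * n" for i
      using that B w by (cases "i = k * n") (auto simp: monom_power coeff_monom coeff_eq_0)
    then show ?case using w0 by (intro exI[of _ "monom w k"]) (simp add: degree_monom_eq)
  next
    case (Suc j)
    then obtain W where W: "degree W = k" "lead_coeff W = w"
      "\<And>i. i \<ge> k * n - j \<Longrightarrow> coeff (B - W ^ n) i = 0" by auto
    define e where "e = k - Suc j"
    \<comment> \<open>Adding \<open>monom c e\<close> changes \<open>W ^ n\<close> at this degree by
      \<open>c * n * w ^ (n - 1)\<close>, which dictates \<open>c\<close>.\<close>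
    define c where "c = coeff (B - W ^ n) (e + k * (n - 1)) / (of_nat n * w ^ (n - 1))"
    define V where "V = W + monom c e"
    have "k * n = k * (n - 1) + k" using n by (cases n) simp_all
    then have e: "e < k" "e + k * (n - 1) = k * n - Suc j"
      using Suc.prems by (auto simp: e_def)
    have degm: "degree (monom c e) < k" using e(1) degree_monom_le[of c e] by linarith
    have V: "degree V = k" "coeff V k = w"
      unfolding V_def using degm W(1,2) by (simp add: degree_add_eq_left) (use degm W(2) e(1) in \<open>simp add: W(1) coeff_eq_0\<close>)
    define S where "S = (\<Sum>i<n. W ^ (n - Suc i) * V ^ i)"
    have S: "degree S \<le> k * (n - 1)" "coeff S (k * (n - 1)) = of_nat n * w ^ (n - 1)"
      unfolding S_def using geometric_sum_top[of V k W w n] V W by auto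
    have VW: "V ^ n - W ^ n = monom c e * S"
      unfolding S_def using power_diff_sumr2[of V n W] by (simp add: V_def)
    have "coeff (B - V ^ n) i = 0" if "i \<ge> k * n - Suc j" for i
    proof -
      have 1: "B - V ^ n = B - W ^ n - monom c e * S" using VW by (simp add: algebra_simps)
      have ei: "e \<le> i" using that e by linarith
      have 2: "coeff (monom c e * S) i = c * coeff S (i - e)"
        using ei by (simp add: coeff_monom_mult)
      show ?thesis
      proof (cases "i = k * n - Suc j")
        case True
        then have "i = e + k * (n - 1)" using e by simp
        then show ?thesis unfolding 1 using 2 S(2) w0 n by (simp add: c_def)
      next
        case False
        with that have i: "i \<ge> k * n - j" "i - e > k * (n - 1)" using e by linarith+
        then have "coeff S (i - e) = 0" using S(1) by (intro coeff_eq_0) linarith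
        then show ?thesis unfolding 1 using 2 W(3)[OF i(1)] by simp
      qed
    qed
    with V show ?case by (intro exI[of _ V]) auto
  qed
  from this[of k] w show ?thesis by (auto simp: diff_mult_distrib2)
qed

lemma small_degree_pcompose:
  fixes p q :: "complex poly"
  assumes "\<forall>i\<ge>a. coeff p i = 0" "0 < degree q"
  shows "p \<circ>\<^sub>p q = 0 \<or> degree (p \<circ>\<^sub>p q) < a * degree q"
proof (cases "p = 0")
  case False
  then have "degree p < a" using assms(1) by (metis leading_coeff_0_iff not_le)
  then show ?thesis using assms(2) by (simp add: degree_pcompose)
qed simp

lemma degree_diff_less_or_0:
  "p = 0 \<or> degree p < n \<Longrightarrow> q = 0 \<or> degree q < n \<Longrightarrow> p - q = 0 \<or> degree (p - q) < n"
  for p q :: "complex poly"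
  by (auto intro: degree_diff_less)

text \<open>With approximate \<open>n\<close>-th roots \<open>L\<close> of \<open>A\<close> (affine)
  and \<open>R\<close> of \<open>B\<close>, both \<open>L \<circ>\<^sub>p X\<close> and
  \<open>R \<circ>\<^sub>p Y\<close> are approximate \<open>n\<close>-th roots of one polynomial, so
  they agree up to a root of unity. Inverting \<open>L\<close> then exhibits \<open>X\<close> as a
  polynomial in \<open>Y\<close>.\<close>

proposition left_divisor_of_decomposition:
  fixes A B X Y :: "complex poly"
  assumes eq: "A \<circ>\<^sub>p X = B \<circ>\<^sub>p Y" and "0 < degree A" "0 < degree X" "0 < degree Y"
    and dvd: "degree A dvd degree B"
  shows "\<exists>W. X = W \<circ>\<^sub>p Y \<and> B = A \<circ>\<^sub>p W"
proof -
  define n where "n = degree A"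
  define m where "m = degree Y"
  obtain k where B: "degree B = k * n" using dvd by (metis n_def dvd_def mult.commute)
  have n: "0 < n" and m: "0 < m" using assms by (auto simp: n_def m_def)
  have "n * degree X = k * n * m"
    using arg_cong[OF eq, of degree] B by (simp add: degree_pcompose n_def m_def)
  then have X: "degree X = k * m" using n by simp
  with assms have k: "0 < k" by auto
  have "\<exists>L. degree L = 1 \<and> lead_coeff L ^ n = lead_coeff A \<and>
      (\<forall>i\<ge>1 * (n - 1). coeff (A - L ^ n) i = 0)"
    by (rule approximate_root) (use n in \<open>simp_all add: n_def\<close>)
  then obtain L where L: "degree L = 1" "lead_coeff L ^ n = lead_coeff A"
    "\<forall>i\<ge>n - 1. coeff (A - L ^ n) i = 0"
    unfolding mult_1 by blast
  obtain R where R: "degree R = k" "lead_coeff R ^ n = lead_coeff B"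
    "\<forall>i\<ge>k * (n - 1). coeff (B - R ^ n) i = 0"
    using approximate_root[OF n B k] by blast
  define U where "U = L \<circ>\<^sub>p X"
  define V where "V = R \<circ>\<^sub>p Y"
  have dU: "degree U = k * m" and dV: "degree V = k * m"
    by (simp_all add: U_def V_def degree_pcompose L R X m_def)
  have "lead_coeff U ^ n = lead_coeff (A \<circ>\<^sub>p X)"
    unfolding U_def lead_coeff_comp[OF assms(3)] power_mult_distrib L(2)
    unfolding L(1) n_def by simp
  also have "\<dots> = lead_coeff (B \<circ>\<^sub>p Y)" by (simp add: eq)
  also have "\<dots> = lead_coeff V ^ n"
    unfolding V_def lead_coeff_comp[OF assms(4)] power_mult_distrib R(2)
    unfolding R(1) B power_mult ..
  finally have lc: "lead_coeff U ^ n = lead_coeff V ^ n" .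
  have U0: "U \<noteq> 0" "V \<noteq> 0" using dU dV k m by auto
  \<comment> \<open>\<zeta> makes the leading coefficients of the two roots equal; otherwise the
    cofactor \<open>S\<close> could lose its top coefficient.\<close>
  define \<zeta> where "\<zeta> = lead_coeff U / lead_coeff V"
  have \<zeta>: "\<zeta> ^ n = 1" "\<zeta> \<noteq> 0" using lc U0 by (auto simp: \<zeta>_def power_divide)
  define V' where "V' = smult \<zeta> V"
  have V': "degree V' = k * m" "lead_coeff V' = lead_coeff U" "V' ^ n = V ^ n"
  proof -
    show "degree V' = k * m" using \<zeta> dV by (simp add: V'_def)
    show "lead_coeff V' = lead_coeff U" using U0 by (simp add: V'_def \<zeta>_def)
    show "V' ^ n = V ^ n" using \<zeta>(1) by (simp add: V'_def smult_power)
  qed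
  define S where "S = (\<Sum>i<n. V' ^ (n - Suc i) * U ^ i)"
  have S: "degree S \<le> k * m * (n - 1)" "coeff S (k * m * (n - 1)) \<noteq> 0"
  proof -
    have *: "degree U \<le> k * m" "degree V' \<le> k * m" "coeff U (k * m) = lead_coeff U"
      "coeff V' (k * m) = lead_coeff U" using dU V'(1,2) by (simp_all only: order_refl)
    show "degree S \<le> k * m * (n - 1)" unfolding S_def by (rule geometric_sum_top[OF *])
    have "coeff S (k * m * (n - 1)) = of_nat n * lead_coeff U ^ (n - 1)"
      unfolding S_def by (rule geometric_sum_top[OF *])
    then show "coeff S (k * m * (n - 1)) \<noteq> 0" using U0 n by simp
  qed
  have "(U - V') * S = U ^ n - V' ^ n" unfolding S_def by (rule power_diff_sumr2[symmetric])
  also have "\<dots> = L ^ n \<circ>\<^sub>p X - R ^ n \<circ>\<^sub>p Y" by (simp add: V' U_def V_def pcompose_power)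
  also have "\<dots> = (B - R ^ n) \<circ>\<^sub>p Y - (A - L ^ n) \<circ>\<^sub>p X" by (simp add: pcompose_diff eq)
  finally have *: "(U - V') * S = (B - R ^ n) \<circ>\<^sub>p Y - (A - L ^ n) \<circ>\<^sub>p X" .
  have 1: "(B - R ^ n) \<circ>\<^sub>p Y = 0 \<or> degree ((B - R ^ n) \<circ>\<^sub>p Y) < k * m * (n - 1)"
    using small_degree_pcompose[OF R(3) assms(4)] by (simp only: m_def mult_ac)
  have 2: "(A - L ^ n) \<circ>\<^sub>p X = 0 \<or> degree ((A - L ^ n) \<circ>\<^sub>p X) < k * m * (n - 1)"
    using small_degree_pcompose[OF L(3) assms(3)] by (simp only: X mult_ac)
  have "U = V'"
  proof (rule ccontr)
    assume "U \<noteq> V'"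
    moreover have "S \<noteq> 0" using S(2) by auto
    ultimately have nz: "(U - V') * S \<noteq> 0" by simp
    have "k * m * (n - 1) \<le> degree S" using S(2) by (rule le_degree)
    also have "\<dots> \<le> degree ((U - V') * S)"
      using \<open>U \<noteq> V'\<close> \<open>S \<noteq> 0\<close> by (simp add: degree_mult_eq)
    finally have "\<not> degree ((U - V') * S) < k * m * (n - 1)" by simp
    moreover have "degree ((U - V') * S) < k * m * (n - 1)"
      using degree_diff_less_or_0[OF 1 2] nz unfolding * by blast
    ultimately show False by blast
  qed
  obtain a b where ab: "L = [:b, a:]" "a \<noteq> 0" using L(1) by (rule degree_1_E)
  define W where "W = [:-b/a, 1/a:] \<circ>\<^sub>p smult \<zeta> R"
  have "W \<circ>\<^sub>p Y = [:-b/a, 1/a:] \<circ>\<^sub>p V'"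
    by (simp add: W_def V'_def V_def pcompose_smult flip: pcompose_assoc)
  also have "\<dots> = ([:-b/a, 1/a:] \<circ>\<^sub>p L) \<circ>\<^sub>p X"
    by (simp add: U_def pcompose_assoc flip: \<open>U = V'\<close>)
  also have "\<dots> = X" using pcompose_linear_inverse[of a b] ab by (simp add: pcompose_pCons)
  finally have X': "X = W \<circ>\<^sub>p Y" by simp
  with eq have "(A \<circ>\<^sub>p W) \<circ>\<^sub>p Y = B \<circ>\<^sub>p Y" by (simp add: pcompose_assoc)
  then have "A \<circ>\<^sub>p W = B" using assms(4) by (rule pcompose_right_cancel)
  with X' show ?thesis by blast
qed

corollary equal_degree_decomposition:
  fixes A B X Y :: "complex poly"
  assumes eq: "A \<circ>\<^sub>p X = B \<circ>\<^sub>p Y" and "0 < degree A" "0 < degree X" "0 < degree Y"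
    and "degree A = degree B"
  obtains W where "degree W = 1" "X = W \<circ>\<^sub>p Y" "B = A \<circ>\<^sub>p W"
proof -
  obtain W where W: "X = W \<circ>\<^sub>p Y" "B = A \<circ>\<^sub>p W"
    using left_divisor_of_decomposition[OF assms(1-4)] assms(5) by auto
  from arg_cong[OF W(2), of degree] assms have "degree W = 1" by (simp add: degree_pcompose)
  with W that show thesis by blast
qed

section \<open>Iterates and centered polynomials\<close>

lemma poly_iter_0 [simp]: "poly_iter A 0 = [:0, 1:]"
  by (simp add: poly_iter_def)

lemma poly_iter_Suc: "poly_iter A (Suc k) = A \<circ>\<^sub>p poly_iter A k"
  by (simp add: poly_iter_def)

lemma pcompose_idL [simp]: "[:0, 1:] \<circ>\<^sub>p p = p" for p :: "complex poly"
  by (simp add: pcompose_pCons)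

lemma poly_iter_1 [simp]: "poly_iter A 1 = A" "poly_iter A (Suc 0) = A"
  by (simp_all add: poly_iter_Suc)

lemma poly_iter_add: "poly_iter A (i + j) = poly_iter A i \<circ>\<^sub>p poly_iter A j"
  by (induction i) (simp_all add: poly_iter_Suc pcompose_assoc)

lemma poly_iter_Suc2: "poly_iter A (Suc k) = poly_iter A k \<circ>\<^sub>p A"
  using poly_iter_add[of A k 1] by simp

lemma poly_iter_mult: "poly_iter A (i * j) = poly_iter (poly_iter A i) j"
  by (induction j) (simp_all add: poly_iter_Suc poly_iter_add)

lemma degree_poly_iter: "degree (poly_iter A k) = degree A ^ k"
  by (induction k) (simp_all add: poly_iter_Suc degree_pcompose)

lemma commute_poly_iter:
  assumes "A \<circ>\<^sub>p B = B \<circ>\<^sub>p A"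
  shows "A \<circ>\<^sub>p poly_iter B k = poly_iter B k \<circ>\<^sub>p A"
proof (induction k)
  case (Suc k)
  have "A \<circ>\<^sub>p poly_iter B (Suc k) = (A \<circ>\<^sub>p B) \<circ>\<^sub>p poly_iter B k"
    by (simp add: poly_iter_Suc pcompose_assoc)
  also have "\<dots> = B \<circ>\<^sub>p (A \<circ>\<^sub>p poly_iter B k)" by (simp add: assms pcompose_assoc)
  also have "\<dots> = poly_iter B (Suc k) \<circ>\<^sub>p A" by (simp add: Suc poly_iter_Suc pcompose_assoc)
  finally show ?case .
qed simp

lemma poly_iter_commute: "A \<circ>\<^sub>p poly_iter A k = poly_iter A k \<circ>\<^sub>p A"
  by (rule commute_poly_iter) simp

lemma lead_coeff_poly_iter:
  assumes "0 < degree A"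
  shows "lead_coeff (poly_iter A k) = lead_coeff A ^ (\<Sum>i<k. degree A ^ i)"
proof (induction k)
  case (Suc k)
  have "lead_coeff (poly_iter A (Suc k)) = lead_coeff (poly_iter A k) * lead_coeff A ^ (degree A ^ k)"
    using assms by (simp only: poly_iter_Suc2 lead_coeff_comp degree_poly_iter)
  then show ?case by (simp add: Suc power_add)
qed simp

text \<open>For a nonzero \<open>D = A - A'\<close>, of degree below \<open>a = degree A\<close>,
  expansion at infinity gives \<open>P \<circ>\<^sub>p A - P \<circ>\<^sub>p A'\<close> the degree
  \<open>degree D + a * (degree P - 1)\<close>, whereas commutation turns it into
  \<open>D \<circ>\<^sub>p P\<close>. Comparing degrees forces \<open>degree D = a\<close>.\<close>

lemma commute_unique:
  fixes A A' P :: "complex poly"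
  assumes comm: "A \<circ>\<^sub>p P = P \<circ>\<^sub>p A" "A' \<circ>\<^sub>p P = P \<circ>\<^sub>p A'"
    and deg: "degree A = degree A'" "0 < degree A" "2 \<le> degree P"
    and lead: "lead_coeff A = lead_coeff A'"
  shows "A = A'"
proof (rule ccontr)
  assume "A \<noteq> A'"
  define n where "n = degree P"
  define a where "a = degree A"
  define D where "D = A - A'"
  have D0: "D \<noteq> 0" using \<open>A \<noteq> A'\<close> by (simp add: D_def)
  have Da: "degree D < a"
  proof -
    have "degree D \<le> a" unfolding D_def a_def using deg by (intro degree_diff_le) auto
    moreover have "coeff D a = 0" using lead deg by (simp add: D_def a_def)
    ultimately show ?thesis using D0 by (metis leading_coeff_0_iff le_neq_implies_less)
  qed
  have n2: "2 \<le> n" using deg by (simp add: n_def)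
  have "\<exists>L. degree L = 1 \<and> lead_coeff L ^ n = lead_coeff P \<and>
      (\<forall>i\<ge>1 * (n - 1). coeff (P - L ^ n) i = 0)"
    by (rule approximate_root) (use n2 in \<open>simp_all add: n_def\<close>)
  then obtain L where L: "degree L = 1" "\<forall>i\<ge>n - 1. coeff (P - L ^ n) i = 0"
    unfolding mult_1 by blast
  from L(1) obtain l b where Lbl: "L = [:b, l:]" "l \<noteq> 0" by (rule degree_1_E)
  define U where "U = L \<circ>\<^sub>p A"
  define U' where "U' = L \<circ>\<^sub>p A'"
  define S where "S = (\<Sum>i<n. U' ^ (n - Suc i) * U ^ i)"
  define u where "u = l * lead_coeff A"
  have "A \<noteq> 0" using deg(2) by auto
  then have u0: "u \<noteq> 0" using Lbl by (simp add: u_def)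
  have U: "degree U \<le> a" "degree U' \<le> a" "coeff U a = u" "coeff U' a = u"
    using deg lead by (auto simp: U_def U'_def degree_pcompose L a_def Lbl u_def pcompose_pCons
        degree_pCons_eq_if coeff_pCons split: nat.splits intro!: degree_add_le)
  have "coeff S (a * (n - 1)) = of_nat n * u ^ (n - 1)"
    unfolding S_def by (rule geometric_sum_top[OF U])
  then have "coeff S (a * (n - 1)) \<noteq> 0" using u0 n2 by simp
  moreover have "degree S \<le> a * (n - 1)" unfolding S_def by (rule geometric_sum_top[OF U])
  ultimately have S: "degree S = a * (n - 1)" "S \<noteq> 0" by (auto intro: antisym le_degree)
  have UU: "U - U' = smult l D" by (simp add: U_def U'_def Lbl D_def pcompose_pCons smult_diff_right)
  have E: "P \<circ>\<^sub>p A - P \<circ>\<^sub>p A' = smult l D * S + ((P - L ^ n) \<circ>\<^sub>p A - (P - L ^ n) \<circ>\<^sub>p A')"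
    unfolding S_def UU[symmetric] power_diff_sumr2[symmetric]
    by (simp add: pcompose_diff pcompose_power U_def U'_def)
  have 1: "(P - L ^ n) \<circ>\<^sub>p A = 0 \<or> degree ((P - L ^ n) \<circ>\<^sub>p A) < a * (n - 1)"
    using small_degree_pcompose[OF L(2) deg(2)] by (simp only: a_def mult_ac)
  have "0 < degree A'" using deg by simp
  have 2: "(P - L ^ n) \<circ>\<^sub>p A' = 0 \<or> degree ((P - L ^ n) \<circ>\<^sub>p A') < a * (n - 1)"
    using small_degree_pcompose[OF L(2) \<open>0 < degree A'\<close>] deg(1) by (simp only: a_def mult_ac)
  have dDS: "degree (smult l D * S) = degree D + a * (n - 1)"
    using D0 S Lbl by (simp add: degree_mult_eq)
  have "degree (P \<circ>\<^sub>p A - P \<circ>\<^sub>p A') = degree D + a * (n - 1)"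
  proof (cases "(P - L ^ n) \<circ>\<^sub>p A - (P - L ^ n) \<circ>\<^sub>p A' = 0")
    case True
    then show ?thesis unfolding E dDS[symmetric] by simp
  next
    case False
    then have "degree ((P - L ^ n) \<circ>\<^sub>p A - (P - L ^ n) \<circ>\<^sub>p A') < degree (smult l D * S)"
      using degree_diff_less_or_0[OF 1 2] dDS by linarith
    then show ?thesis unfolding E dDS[symmetric] by (rule degree_add_eq_left)
  qed
  moreover have "P \<circ>\<^sub>p A - P \<circ>\<^sub>p A' = D \<circ>\<^sub>p P" unfolding comm[symmetric] D_def by (simp add: pcompose_diff)
  ultimately have "degree D * n = degree D + a * (n - 1)" by (simp add: degree_pcompose n_def)
  then have "degree D * (n - 1) = a * (n - 1)" using n2 by (cases n) simp_all
  then show False using n2 Da by simp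
qed

lemma commute_lead_coeff:
  fixes A P :: "complex poly"
  assumes comm: "A \<circ>\<^sub>p P = P \<circ>\<^sub>p A" and deg: "0 < degree A" "0 < degree P"
  shows "lead_coeff A ^ (degree P - 1) = lead_coeff P ^ (degree A - 1)"
proof -
  obtain n a where na: "degree P = Suc n" "degree A = Suc a" using deg by (auto dest!: gr0_implies_Suc)
  have "lead_coeff A * lead_coeff P ^ Suc a = lead_coeff P * lead_coeff A ^ Suc n"
    using arg_cong[OF comm, of lead_coeff] unfolding lead_coeff_comp[OF deg(1)] lead_coeff_comp[OF deg(2)]
    by (simp only: na)
  moreover have "lead_coeff A \<noteq> 0" "lead_coeff P \<noteq> 0" using deg by auto
  ultimately show ?thesis by (simp add: na)
qed

section \<open>Conjugation by translations and centered polynomials\<close>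

definition shift_conj :: "complex \<Rightarrow> complex poly \<Rightarrow> complex poly" where
  "shift_conj s A = [:- s, 1:] \<circ>\<^sub>p A \<circ>\<^sub>p [:s, 1:]"

lemma shift_inverse [simp]:
  fixes s :: complex
  shows "[:s, 1:] \<circ>\<^sub>p [:- s, 1:] = [:0, 1:]" "[:- s, 1:] \<circ>\<^sub>p [:s, 1:] = [:0, 1:]"
  by (simp_all add: pcompose_pCons)

lemma shift_conj_pcompose: "shift_conj s (A \<circ>\<^sub>p B) = shift_conj s A \<circ>\<^sub>p shift_conj s B"
proof -
  have "shift_conj s A \<circ>\<^sub>p shift_conj s B
      = [:- s, 1:] \<circ>\<^sub>p A \<circ>\<^sub>p ([:s, 1:] \<circ>\<^sub>p [:- s, 1:]) \<circ>\<^sub>p B \<circ>\<^sub>p [:s, 1:]"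
    unfolding shift_conj_def by (simp only: pcompose_assoc)
  then show ?thesis by (simp add: shift_conj_def pcompose_assoc)
qed

lemma degree_shift_conj [simp]: "degree (shift_conj s A) = degree A"
  by (simp add: shift_conj_def degree_pcompose)

lemma shift_conj_inverse [simp]: "shift_conj (- s) (shift_conj s A) = A" "shift_conj s (shift_conj (- s) A) = A"
proof -
  have "shift_conj (- s) (shift_conj s A) = ([:s, 1:] \<circ>\<^sub>p [:- s, 1:]) \<circ>\<^sub>p A \<circ>\<^sub>p ([:s, 1:] \<circ>\<^sub>p [:- s, 1:])" for s
    unfolding shift_conj_def by (simp only: pcompose_assoc minus_minus)
  note * = this
  show "shift_conj (- s) (shift_conj s A) = A" unfolding * by simp
  show "shift_conj s (shift_conj (- s) A) = A" using *[of "- s"] by simp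
qed

lemma shift_conj_id [simp]: "shift_conj s [:0, 1:] = [:0, 1:]"
  by (simp add: shift_conj_def)

lemma shift_conj_inject: "shift_conj s A = shift_conj s B \<longleftrightarrow> A = B"
  by (metis shift_conj_inverse(1))

lemma shift_conj_poly_iter: "shift_conj s (poly_iter A k) = poly_iter (shift_conj s A) k"
  by (induction k) (simp_all add: poly_iter_Suc shift_conj_pcompose)

text \<open>The normalization that reduces affine symmetries to rotations: from degree one on it
  puts the center of gravity of the roots at 0.\<close>

definition centered :: "complex poly \<Rightarrow> bool" where
  "centered A \<longleftrightarrow> coeff A (degree A - 1) = 0"

lemma coeff_mult_subtop:
  fixes p q :: "complex poly"
  assumes "degree p \<le> Suc a" "degree q \<le> Suc b"
  shows "coeff (p * q) (Suc (a + b)) = coeff p (Suc a) * coeff q b + coeff p a * coeff q (Suc b)"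
proof -
  define p' where "p' = p - monom (coeff p (Suc a)) (Suc a)"
  define q' where "q' = q - monom (coeff q (Suc b)) (Suc b)"
  have p': "degree p' \<le> a" "coeff p' a = coeff p a"
  proof (intro degree_le allI impI)
    show "coeff p' i = 0" if "a < i" for i
      using that assms by (cases "i = Suc a") (auto simp: p'_def coeff_eq_0)
  qed (simp add: p'_def)
  have q': "degree q' \<le> b" "coeff q' b = coeff q b"
  proof (intro degree_le allI impI)
    show "coeff q' i = 0" if "b < i" for i
      using that assms by (cases "i = Suc b") (auto simp: q'_def coeff_eq_0)
  qed (simp add: q'_def)
  have "p * q = p' * q' + monom (coeff p (Suc a)) (Suc a) * q' + p' * monom (coeff q (Suc b)) (Suc b)
     + monom (coeff p (Suc a)) (Suc a) * monom (coeff q (Suc b)) (Suc b)"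
    by (simp add: p'_def q'_def algebra_simps)
  moreover have "coeff (p' * q') (Suc (a + b)) = 0"
    by (rule coeff_eq_0) (use degree_mult_le[of p' q'] p' q' in linarith)
  moreover have "coeff (monom (coeff p (Suc a)) (Suc a) * q') (Suc (a + b)) = coeff p (Suc a) * coeff q b"
    by (simp add: coeff_monom_mult q')
  moreover have "coeff (p' * monom (coeff q (Suc b)) (Suc b)) (Suc (a + b)) = coeff p a * coeff q (Suc b)"
    by (simp add: coeff_monom_mult p' mult.commute[of p'])
  moreover have "coeff (monom (coeff p (Suc a)) (Suc a) * monom (coeff q (Suc b)) (Suc b)) (Suc (a + b)) = 0"
    by (simp add: mult_monom)
  ultimately show ?thesis by simp
qed

lemma coeff_power_subtop:
  fixes p :: "complex poly"
  assumes "degree p \<le> Suc a"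
  shows "coeff (p ^ Suc i) (a + Suc a * i) = of_nat (Suc i) * coeff p (Suc a) ^ i * coeff p a"
proof (induction i)
  case (Suc i)
  have d: "degree (p ^ Suc i) \<le> Suc (a + Suc a * i)"
    using degree_power_le'[OF assms, of "Suc i"] by (simp add: algebra_simps)
  have top: "coeff (p ^ Suc i) (Suc (a + Suc a * i)) = coeff p (Suc a) ^ Suc i"
    using coeff_power_top[OF assms, of "Suc i"] by (simp add: algebra_simps)
  have "a + Suc a * Suc i = Suc (a + (a + Suc a * i))" by simp
  then have "coeff (p ^ Suc (Suc i)) (a + Suc a * Suc i) = coeff (p * p ^ Suc i) (Suc (a + (a + Suc a * i)))"
    by (simp only: power_Suc)
  also have "\<dots> = coeff p (Suc a) * coeff (p ^ Suc i) (a + Suc a * i) + coeff p a * coeff p (Suc a) ^ Suc i"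
    unfolding coeff_mult_subtop[OF assms d] top ..
  finally show ?case unfolding Suc by (simp add: algebra_simps)
qed simp

text \<open>\<open>A\<close> differs from the power of its affine approximate root
  \<open>[:b, l:]\<close> by a polynomial of degree at most \<open>degree A - 2\<close>, invisible
  at this coefficient. The constant \<open>b\<close> matters only for \<open>degree X = 1\<close>,
  the case that locates the center of \<open>A\<close>.\<close>

lemma subtop_coeff_pcompose:
  fixes A :: "complex poly"
  assumes A: "2 \<le> degree A"
  obtains b l where "l \<noteq> 0"
    "\<And>X. 0 < degree X \<Longrightarrow> coeff (A \<circ>\<^sub>p X) (degree A * degree X - 1)
       = of_nat (degree A) * (l * lead_coeff X) ^ (degree A - 1) * coeff ([:b, l:] \<circ>\<^sub>p X) (degree X - 1)"
proof -
  obtain n where n: "degree A = Suc (Suc n)"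
    using A by (metis One_nat_def Suc_1 Suc_le_D Suc_le_mono)
  have "\<exists>L. degree L = 1 \<and> lead_coeff L ^ Suc (Suc n) = lead_coeff A \<and>
      (\<forall>i\<ge>1 * (Suc (Suc n) - 1). coeff (A - L ^ Suc (Suc n)) i = 0)"
    by (rule approximate_root) (simp_all add: n)
  then obtain L where L: "degree L = 1" "\<forall>i\<ge>Suc n. coeff (A - L ^ Suc (Suc n)) i = 0"
    unfolding mult_1 diff_Suc_1 by blast
  obtain l b where Lbl: "L = [:b, l:]" "l \<noteq> 0" using L(1) by (rule degree_1_E)
  have *: "coeff (A \<circ>\<^sub>p X) (degree A * degree X - 1)
       = of_nat (degree A) * (l * lead_coeff X) ^ (degree A - 1) * coeff ([:b, l:] \<circ>\<^sub>p X) (degree X - 1)"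
    if X: "0 < degree X" for X
  proof -
    define U where "U = L \<circ>\<^sub>p X"
    obtain d where d: "degree X = Suc d" using X by (auto dest!: gr0_implies_Suc)
    have dU: "degree U \<le> Suc d" by (simp add: U_def degree_pcompose L d)
    have cU: "coeff U (Suc d) = l * lead_coeff X"
      using d by (simp add: U_def Lbl pcompose_pCons)
    have "A \<circ>\<^sub>p X = U ^ Suc (Suc n) + (A - L ^ Suc (Suc n)) \<circ>\<^sub>p X"
      by (simp add: U_def pcompose_diff pcompose_power pcompose_mult)
    moreover have "coeff ((A - L ^ Suc (Suc n)) \<circ>\<^sub>p X) (d + Suc d * Suc n) = 0"
    proof -
      have "(A - L ^ Suc (Suc n)) \<circ>\<^sub>p X = 0 \<or> degree ((A - L ^ Suc (Suc n)) \<circ>\<^sub>p X) < Suc n * Suc d"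
        using small_degree_pcompose[OF L(2) X] by (simp only: d)
      then show ?thesis
      proof
        assume "degree ((A - L ^ Suc (Suc n)) \<circ>\<^sub>p X) < Suc n * Suc d"
        then show ?thesis by (intro coeff_eq_0) (simp add: algebra_simps)
      qed simp
    qed
    moreover have "coeff (U ^ Suc (Suc n)) (d + Suc d * Suc n)
        = of_nat (Suc (Suc n)) * (l * lead_coeff X) ^ Suc n * coeff U d"
      unfolding coeff_power_subtop[OF dU] cU ..
    ultimately have "coeff (A \<circ>\<^sub>p X) (d + Suc d * Suc n) = of_nat (Suc (Suc n)) * (l * lead_coeff X) ^ Suc n * coeff U d"
      by (simp only: coeff_add add_0_right)
    moreover have "degree A * degree X - 1 = d + Suc d * Suc n" by (simp add: n d)
    ultimately show ?thesis by (simp only: n d diff_Suc_1 U_def Lbl)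
  qed
  show thesis by (rule that[OF Lbl(2) *])
qed

lemma centered_pcompose:
  assumes "0 < degree A" "2 \<le> degree X"
  shows "centered (A \<circ>\<^sub>p X) \<longleftrightarrow> centered X"
proof (cases "2 \<le> degree A")
  case True
  then obtain b l where l: "l \<noteq> 0" "\<And>X. 0 < degree X \<Longrightarrow> coeff (A \<circ>\<^sub>p X) (degree A * degree X - 1)
       = of_nat (degree A) * (l * lead_coeff X) ^ (degree A - 1) * coeff ([:b, l:] \<circ>\<^sub>p X) (degree X - 1)"
    by (rule subtop_coeff_pcompose) blast
  obtain d where d: "degree X = Suc (Suc d)" using assms(2)
    by (metis One_nat_def Suc_1 Suc_le_D Suc_le_mono)
  have "coeff ([:b, l:] \<circ>\<^sub>p X) (degree X - 1) = l * coeff X (degree X - 1)"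
    by (simp add: pcompose_pCons d)
  moreover have "X \<noteq> 0" using assms by auto
  ultimately show ?thesis using l(2)[of X] l(1) assms by (simp add: centered_def degree_pcompose)
next
  case False
  with assms have "degree A = 1" by linarith
  then obtain a b where A: "A = [:b, a:]" "a \<noteq> 0" by (rule degree_1_E)
  obtain d where d: "degree X = Suc (Suc d)" using assms(2)
    by (metis One_nat_def Suc_1 Suc_le_D Suc_le_mono)
  have "degree (A \<circ>\<^sub>p X) = degree X" using A by (simp add: degree_pcompose)
  then show ?thesis using A d by (simp add: centered_def pcompose_pCons)
qed

lemma ex_shift_centered:
  assumes "2 \<le> degree A"
  obtains s where "\<And>t w. w \<noteq> 0 \<Longrightarrow> centered (A \<circ>\<^sub>p [:t, w:]) \<longleftrightarrow> t = s"
proof -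
  obtain b l where l: "l \<noteq> 0" "\<And>X. 0 < degree X \<Longrightarrow> coeff (A \<circ>\<^sub>p X) (degree A * degree X - 1)
       = of_nat (degree A) * (l * lead_coeff X) ^ (degree A - 1) * coeff ([:b, l:] \<circ>\<^sub>p X) (degree X - 1)"
    using assms by (rule subtop_coeff_pcompose) blast
  have "centered (A \<circ>\<^sub>p [:t, w:]) \<longleftrightarrow> t = - b / l" if "w \<noteq> 0" for t w
  proof -
    have "centered (A \<circ>\<^sub>p [:t, w:]) \<longleftrightarrow> b + l * t = 0"
      using l(2)[of "[:t, w:]"] that l(1) assms
      by (auto simp: centered_def degree_pcompose pcompose_pCons mult.commute)
    also have "\<dots> \<longleftrightarrow> l * t = - b" by (metis add.commute eq_neg_iff_add_eq_0)
    also have "\<dots> \<longleftrightarrow> t = - b / l" unfolding nonzero_eq_divide_eq[OF l(1)] by (simp only: mult.commute)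
    finally show ?thesis .
  qed
  then show thesis using that by blast
qed

lemma centered_pcompose_linear:
  assumes "2 \<le> degree A" "centered A" "w \<noteq> 0"
  shows "centered (A \<circ>\<^sub>p [:t, w:]) \<longleftrightarrow> t = 0"
proof -
  obtain s where s: "\<And>t w. w \<noteq> 0 \<Longrightarrow> centered (A \<circ>\<^sub>p [:t, w:]) \<longleftrightarrow> t = s"
    using ex_shift_centered[OF assms(1)] by blast
  from s[of 1 0] assms have "s = 0" by simp
  with s assms show ?thesis by simp
qed

lemma centered_pcompose_rotation:
  assumes "2 \<le> degree A" "w \<noteq> 0"
  shows "centered (A \<circ>\<^sub>p [:0, w:]) \<longleftrightarrow> centered A"
  using assms by (simp add: centered_def degree_pcompose coeff_pcompose_linear)

lemma ex_centered_conj: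
  assumes "2 \<le> degree A"
  obtains s where "centered (shift_conj s A)"
proof -
  obtain s where s: "\<And>t w. w \<noteq> 0 \<Longrightarrow> centered (A \<circ>\<^sub>p [:t, w:]) \<longleftrightarrow> t = s"
    using ex_shift_centered[OF assms(1)] by blast
  from s[of 1 s] have "centered (A \<circ>\<^sub>p [:s, 1:])" by simp
  then have "centered ([:-s, 1:] \<circ>\<^sub>p (A \<circ>\<^sub>p [:s, 1:]))"
    using assms by (subst centered_pcompose) (auto simp: degree_pcompose)
  then show thesis using that by (simp add: shift_conj_def pcompose_assoc)
qed

lemma commute_centered:
  assumes "A \<circ>\<^sub>p P = P \<circ>\<^sub>p A" "2 \<le> degree P" "centered P" "2 \<le> degree A"
  shows "centered A"
  using assms centered_pcompose[of A P] centered_pcompose[of P A] by simp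

lemma centered_poly_iter:
  assumes "2 \<le> degree P" "centered P" "1 \<le> k"
  shows "centered (poly_iter P k)"
proof -
  obtain j where "k = Suc j" using assms by (auto dest: Suc_le_D)
  then show ?thesis using assms by (simp add: poly_iter_Suc2 centered_pcompose degree_poly_iter)
qed

section \<open>Special polynomials and quadratic differentials\<close>

text \<open>\<open>P\<close> rescales by \<open>(degree P)\<^sup>2\<close> the quadratic differential \<open>dz\<^sup>2 / y\<close> with \<open>y\<close> of degree two. Powers and
  Chebyshev polynomials do so with \<open>y = z\<^sup>2\<close> and \<open>y = z\<^sup>2 - 1\<close>.\<close>

definition quadratic_ode :: "complex poly \<Rightarrow> bool" where
  "quadratic_ode P \<longleftrightarrow>
     (\<exists>y. degree y = 2 \<and> (pderiv P)\<^sup>2 * y = smult ((of_nat (degree P))\<^sup>2) (y \<circ>\<^sub>p P))"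

lemma smult_left_cancel: "c \<noteq> 0 \<Longrightarrow> smult c p = smult c q \<longleftrightarrow> p = q" for p q :: "complex poly"
  by (metis smult_eq_0_iff smult_diff_right right_minus_eq)

lemma pcompose_monom: "monom 1 k \<circ>\<^sub>p p = p ^ k" for p :: "complex poly"
  by (simp add: monom_altdef pcompose_power pcompose_pCons)

lemma pcompose_square_minus_1: "[:-1, 0, 1:] \<circ>\<^sub>p p = p\<^sup>2 - 1" for p :: "complex poly"
proof -
  have "[:-1:] = - (1 :: complex poly)" by (simp add: one_pCons)
  then show ?thesis by (simp add: pcompose_pCons power2_eq_square)
qed

lemma coprime_pcompose:
  fixes x v q :: "complex poly"
  assumes "coprime x v"
  shows "coprime (x \<circ>\<^sub>p q) (v \<circ>\<^sub>p q)"
proof -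
  obtain a b where "a * x + b * v = 1"
    using assms bezout_coefficients_fst_snd[of x v] by (metis coprime_imp_gcd_eq_1)
  then have "(a \<circ>\<^sub>p q) * (x \<circ>\<^sub>p q) + (b \<circ>\<^sub>p q) * (v \<circ>\<^sub>p q) = 1"
    by (metis pcompose_1 pcompose_add pcompose_mult)
  then show ?thesis
    by (metis coprimeI dvd_add dvd_mult)
qed

text \<open>A rational solution \<open>x / v\<close> has no poles: \<open>v \<circ> Q\<close> would have to divide \<open>v\<close>.\<close>

lemma rational_solution:
  fixes x v Q :: "complex poly"
  assumes cop: "coprime x v" and nz: "x \<noteq> 0" "v \<noteq> 0" and n: "2 \<le> degree Q"
    and eq: "(pderiv Q)\<^sup>2 * x * (v \<circ>\<^sub>p Q) = smult ((of_nat (degree Q))\<^sup>2) ((x \<circ>\<^sub>p Q) * v)"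
  shows "degree v = 0" "degree x = 2"
proof -
  have "v \<circ>\<^sub>p Q dvd smult ((of_nat (degree Q))\<^sup>2) ((x \<circ>\<^sub>p Q) * v)"
    unfolding eq[symmetric] by simp
  moreover have "(of_nat (degree Q))\<^sup>2 \<noteq> (0::complex)" using n by simp
  ultimately have "v \<circ>\<^sub>p Q dvd (x \<circ>\<^sub>p Q) * v" by (simp add: dvd_smult_iff)
  moreover have "coprime (v \<circ>\<^sub>p Q) (x \<circ>\<^sub>p Q)" using coprime_pcompose[OF cop] by (simp add: coprime_commute)
  ultimately have "v \<circ>\<^sub>p Q dvd v" by (simp add: coprime_dvd_mult_right_iff)
  then have "degree v * degree Q \<le> degree v" using nz dvd_imp_degree_le degree_pcompose by metis
  moreover have "degree v * 2 \<le> degree v * degree Q" using n by simp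
  ultimately show v: "degree v = 0" by linarith
  have Q': "pderiv Q \<noteq> 0" using n by (simp add: pderiv_eq_0_iff)
  have vQ: "v \<circ>\<^sub>p Q \<noteq> 0" "x \<circ>\<^sub>p Q \<noteq> 0" using nz n by (auto simp: pcompose_eq_0_iff)
  have "degree ((pderiv Q)\<^sup>2 * x * (v \<circ>\<^sub>p Q)) = 2 * (degree Q - 1) + degree x"
    using Q' nz vQ v by (simp add: degree_mult_eq degree_power_eq degree_pderiv degree_pcompose)
  moreover have "degree (smult ((of_nat (degree Q))\<^sup>2) ((x \<circ>\<^sub>p Q) * v)) = degree x * degree Q"
    using nz vQ v n by (simp add: degree_mult_eq degree_pcompose)
  ultimately have "2 * (degree Q - 1) + degree x = degree x * degree Q" using eq by simp
  then have "2 * (degree Q - 1) = degree x * (degree Q - 1)" using n by (simp add: diff_mult_distrib2)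
  then show "degree x = 2" using n by simp
qed

text \<open>For solutions known only as a quotient \<open>x / v\<close>, possibly with common
  factors: after division by the gcd, \<open>rational_solution\<close> leaves a constant
  denominator.\<close>

lemma quadratic_ode_of_rational:
  fixes x v Q :: "complex poly"
  assumes nz: "x \<noteq> 0" "v \<noteq> 0" and n: "2 \<le> degree Q"
    and eq: "(pderiv Q)\<^sup>2 * x * (v \<circ>\<^sub>p Q) = smult ((of_nat (degree Q))\<^sup>2) ((x \<circ>\<^sub>p Q) * v)"
  obtains R where "degree R = 2" "x = R * v" "(pderiv Q)\<^sup>2 * R = smult ((of_nat (degree Q))\<^sup>2) (R \<circ>\<^sub>p Q)"
proof -
  define g where "g = gcd x v"
  obtain x1 v1 where xv: "x = x1 * g" "v = v1 * g" "coprime x1 v1"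
    using gcd_coprime_exists[of x v] nz unfolding g_def by auto
  have g: "g \<noteq> 0" "g \<circ>\<^sub>p Q \<noteq> 0" using nz n by (auto simp: g_def pcompose_eq_0_iff)
  have "((pderiv Q)\<^sup>2 * x1 * (v1 \<circ>\<^sub>p Q)) * (g * (g \<circ>\<^sub>p Q))
      = smult ((of_nat (degree Q))\<^sup>2) ((x1 \<circ>\<^sub>p Q) * v1) * (g * (g \<circ>\<^sub>p Q))"
    using eq unfolding xv pcompose_mult by (simp add: algebra_simps)
  moreover have "g * (g \<circ>\<^sub>p Q) \<noteq> 0" using g by simp
  ultimately have eq1: "(pderiv Q)\<^sup>2 * x1 * (v1 \<circ>\<^sub>p Q) = smult ((of_nat (degree Q))\<^sup>2) ((x1 \<circ>\<^sub>p Q) * v1)"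
    by (metis mult_right_cancel)
  have "degree v1 = 0" and dx1: "degree x1 = 2"
    using rational_solution[OF xv(3) _ _ n eq1] nz xv by auto
  then obtain c where c: "v1 = [:c:]" by (auto elim: degree_eq_zeroE)
  with nz xv have c0: "c \<noteq> 0" by auto
  define R where "R = smult (1 / c) x1"
  show thesis
  proof (rule that[of R])
    show "degree R = 2" using c0 dx1 by (simp add: R_def)
    show "x = R * v" using c0 by (simp add: R_def xv c)
    have "smult c ((pderiv Q)\<^sup>2 * x1) = smult c (smult ((of_nat (degree Q))\<^sup>2) (x1 \<circ>\<^sub>p Q))"
      using eq1 by (simp add: c algebra_simps)
    then have "(pderiv Q)\<^sup>2 * x1 = smult ((of_nat (degree Q))\<^sup>2) (x1 \<circ>\<^sub>p Q)"
      unfolding smult_left_cancel[OF c0] .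
    then show "(pderiv Q)\<^sup>2 * R = smult ((of_nat (degree Q))\<^sup>2) (R \<circ>\<^sub>p Q)"
      by (simp add: R_def pcompose_smult)
  qed
qed

lemma quadratic_ode_poly_iter:
  assumes "(pderiv P)\<^sup>2 * y = smult ((of_nat (degree P))\<^sup>2) (y \<circ>\<^sub>p P)"
  shows "(pderiv (poly_iter P k))\<^sup>2 * y = smult ((of_nat (degree (poly_iter P k)))\<^sup>2) (y \<circ>\<^sub>p poly_iter P k)"
proof (induction k)
  case 0
  have "pderiv [:0, 1 :: complex:] = 1" by (simp add: pderiv_pCons one_pCons)
  then show ?case by simp
next
  case (Suc k)
  define I where "I = poly_iter P k"
  have "(pderiv (P \<circ>\<^sub>p I))\<^sup>2 * y = (pderiv P \<circ>\<^sub>p I)\<^sup>2 * ((pderiv I)\<^sup>2 * y)"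
    by (simp add: pderiv_pcompose power_mult_distrib)
  also have "\<dots> = smult ((of_nat (degree I))\<^sup>2) (((pderiv P)\<^sup>2 * y) \<circ>\<^sub>p I)"
    using Suc by (simp add: I_def pcompose_mult pcompose_power)
  also have "\<dots> = smult ((of_nat (degree (P \<circ>\<^sub>p I)))\<^sup>2) (y \<circ>\<^sub>p (P \<circ>\<^sub>p I))"
    by (simp add: assms pcompose_smult pcompose_assoc degree_pcompose power_mult_distrib) (simp add: mult.commute)
  finally show ?case by (simp add: I_def poly_iter_Suc)
qed

lemma quadratic_ode_imp_poly_iter: "quadratic_ode P \<Longrightarrow> quadratic_ode (poly_iter P k)"
  unfolding quadratic_ode_def using quadratic_ode_poly_iter by blast

text \<open>If \<open>dz\<^sup>2 / y\<close> is rescaled by an iterate of \<open>P\<close>, so is its pullback under \<open>P\<close>;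
  by uniqueness the two are proportional.\<close>

lemma quadratic_ode_of_poly_iter:
  assumes ode: "quadratic_ode (poly_iter P k)" and k: "1 \<le> k" and n: "2 \<le> degree P"
  shows "quadratic_ode P"
proof -
  define Q where "Q = poly_iter P k"
  define N where "N = ((of_nat (degree Q))\<^sup>2 :: complex)"
  define m where "m = ((of_nat (degree P))\<^sup>2 :: complex)"
  obtain y where y: "degree y = 2" "(pderiv Q)\<^sup>2 * y = smult N (y \<circ>\<^sub>p Q)"
    using ode by (auto simp: quadratic_ode_def Q_def N_def)
  have Q2: "2 \<le> degree Q" using k n self_le_power[of "degree P" k] by (simp add: Q_def degree_poly_iter)
  have PQ: "P \<circ>\<^sub>p Q = Q \<circ>\<^sub>p P" unfolding Q_def by (rule poly_iter_commute)
  have y0: "y \<noteq> 0" using y by auto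
  have m0: "m \<noteq> 0" using n by (simp add: m_def)
  have P'0: "pderiv P \<noteq> 0" using n by (simp add: pderiv_eq_0_iff)
  \<comment> \<open>\<open>x / v\<close> is the pullback of \<open>y\<close> under \<open>P\<close>;
    differentiating \<open>P \<circ>\<^sub>p Q = Q \<circ>\<^sub>p P\<close> shows that
    \<open>Q\<close> rescales it as well.\<close>
  define x where "x = smult m (y \<circ>\<^sub>p P)"
  define v where "v = (pderiv P)\<^sup>2"
  have nz: "x \<noteq> 0" "v \<noteq> 0" using y0 m0 P'0 n by (auto simp: x_def v_def pcompose_eq_0_iff)
  have dPQ: "(pderiv P \<circ>\<^sub>p Q) * pderiv Q = (pderiv Q \<circ>\<^sub>p P) * pderiv P"
    using arg_cong[OF PQ, of pderiv] by (simp add: pderiv_pcompose)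
  have yPQ: "smult N ((y \<circ>\<^sub>p P) \<circ>\<^sub>p Q) = (pderiv Q \<circ>\<^sub>p P)\<^sup>2 * (y \<circ>\<^sub>p P)"
    using arg_cong[OF y(2), of "\<lambda>q. q \<circ>\<^sub>p P"]
    by (simp add: pcompose_mult pcompose_power pcompose_smult PQ flip: pcompose_assoc)
  have "(pderiv Q)\<^sup>2 * x * (v \<circ>\<^sub>p Q) = smult m (((pderiv P \<circ>\<^sub>p Q) * pderiv Q)\<^sup>2 * (y \<circ>\<^sub>p P))"
    by (simp add: x_def v_def pcompose_power power_mult_distrib algebra_simps)
  also have "\<dots> = smult m (smult N ((y \<circ>\<^sub>p P) \<circ>\<^sub>p Q) * (pderiv P)\<^sup>2)"
    unfolding dPQ yPQ by (simp add: power_mult_distrib algebra_simps)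
  also have "\<dots> = smult N ((x \<circ>\<^sub>p Q) * v)"
    by (simp add: x_def v_def pcompose_smult mult.commute)
  finally have "(pderiv Q)\<^sup>2 * x * (v \<circ>\<^sub>p Q) = smult ((of_nat (degree Q))\<^sup>2) ((x \<circ>\<^sub>p Q) * v)"
    unfolding N_def .
  from quadratic_ode_of_rational[OF nz Q2 this] obtain R where R: "degree R = 2" "x = R * v"
    "(pderiv Q)\<^sup>2 * R = smult N (R \<circ>\<^sub>p Q)" unfolding N_def by metis
  have "lead_coeff x = m * (lead_coeff y * (lead_coeff P)\<^sup>2)"
    using n y(1) by (simp only: x_def lead_coeff_smult lead_coeff_comp)
  moreover have "lead_coeff x = lead_coeff R * (m * (lead_coeff P)\<^sup>2)"
  proof -
    have "lead_coeff (pderiv P) = of_nat (degree P) * lead_coeff P"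
      using n by (simp add: degree_pderiv coeff_pderiv)
    then show ?thesis by (simp add: R(2) v_def lead_coeff_mult lead_coeff_power m_def power_mult_distrib)
  qed
  moreover have "lead_coeff P \<noteq> 0" using n by auto
  ultimately have lead: "lead_coeff y = lead_coeff R" using m0 by simp
  \<comment> \<open>Two solutions with equal leading coefficient differ by a solution of degree
    below 2, but a nonzero solution has degree exactly 2.\<close>
  have "y = R"
  proof (rule ccontr)
    assume "y \<noteq> R"
    define D where "D = y - R"
    have D0: "D \<noteq> 0" using \<open>y \<noteq> R\<close> by (simp add: D_def)
    have "degree D \<le> 2" unfolding D_def using y R by (intro degree_diff_le) auto
    moreover have "coeff D 2 = 0" using lead y R by (simp add: D_def)
    ultimately have D2: "degree D < 2" using D0 by (metis leading_coeff_0_iff le_neq_implies_less)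
    have Q'0: "pderiv Q \<noteq> 0" using Q2 by (simp add: pderiv_eq_0_iff)
    have N0: "N \<noteq> 0" using Q2 by (simp add: N_def)
    have "(pderiv Q)\<^sup>2 * D = smult N (D \<circ>\<^sub>p Q)"
      using y R by (simp add: D_def pcompose_diff algebra_simps smult_diff_right)
    from arg_cong[OF this, of degree] have "2 * (degree Q - 1) + degree D = degree D * degree Q"
      using D0 Q'0 N0 by (simp add: degree_mult_eq degree_power_eq degree_pderiv degree_pcompose)
    then have "2 * (degree Q - 1) = degree D * (degree Q - 1)" using Q2 by (simp add: diff_mult_distrib2)
    then show False using Q2 D2 by simp
  qed
  then show ?thesis using y R unfolding quadratic_ode_def x_def v_def m_def
    by (metis mult.commute)
qed

lemma quadratic_ode_conj:
  assumes l: "degree l = 1" and eq: "l \<circ>\<^sub>p P = Q \<circ>\<^sub>p l" and ode: "quadratic_ode Q"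
  shows "quadratic_ode P"
proof -
  obtain a b where ab: "l = [:b, a:]" "a \<noteq> 0" using l by (rule degree_1_E)
  obtain y where y: "degree y = 2" "(pderiv Q)\<^sup>2 * y = smult ((of_nat (degree Q))\<^sup>2) (y \<circ>\<^sub>p Q)"
    using ode by (auto simp: quadratic_ode_def)
  have dPQ: "degree P = degree Q" using arg_cong[OF eq, of degree] l by (simp add: degree_pcompose)
  have "pderiv (l \<circ>\<^sub>p P) = pderiv (Q \<circ>\<^sub>p l)" by (simp add: eq)
  then have "smult a (pderiv P) = smult a (pderiv Q \<circ>\<^sub>p l)" unfolding pderiv_pcompose
    by (simp add: ab(1) pderiv_pCons pcompose_pCons mult.commute)
  then have P': "pderiv P = pderiv Q \<circ>\<^sub>p l" unfolding smult_left_cancel[OF ab(2)] .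
  have "(pderiv P)\<^sup>2 * (y \<circ>\<^sub>p l) = ((pderiv Q)\<^sup>2 * y) \<circ>\<^sub>p l"
    by (simp add: P' pcompose_mult pcompose_power)
  also have "\<dots> = smult ((of_nat (degree P))\<^sup>2) ((y \<circ>\<^sub>p l) \<circ>\<^sub>p P)"
    by (simp add: y(2) pcompose_smult dPQ eq flip: pcompose_assoc)
  finally show ?thesis unfolding quadratic_ode_def
    using y(1) l by (intro exI[of _ "y \<circ>\<^sub>p l"]) (simp add: degree_pcompose)
qed

section \<open>Powers and Chebyshev polynomials as the only solutions\<close>

lemma chebyshev_0: "chebyshev 0 = 1"
  by (rule chebyshev_unique) (simp add: poly_chebyshev_cos)

lemma chebyshev_1: "chebyshev (Suc 0) = [:0, 1:]"
  by (rule chebyshev_unique) (simp add: poly_chebyshev_cos)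

lemma chebyshev_rec: "chebyshev (Suc (Suc k)) = [:0, 2:] * chebyshev (Suc k) - chebyshev k"
proof (rule chebyshev_unique)
  fix \<theta> :: complex
  have "of_nat (Suc (Suc k)) * \<theta> = of_nat (Suc k) * \<theta> + \<theta>" "of_nat k * \<theta> = of_nat (Suc k) * \<theta> - \<theta>"
    by (simp_all add: algebra_simps)
  then have "cos (of_nat (Suc (Suc k)) * \<theta>) = 2 * cos \<theta> * cos (of_nat (Suc k) * \<theta>) - cos (of_nat k * \<theta>)"
    by (simp only: cos_add cos_diff) (simp add: algebra_simps)
  then show "poly (chebyshev (Suc (Suc k))) (cos \<theta>) = poly ([:0, 2:] * chebyshev (Suc k) - chebyshev k) (cos \<theta>)"
    by (simp only: poly_chebyshev_cos poly_diff poly_mult) (simp add: poly_chebyshev_cos)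
qed

lemma degree_chebyshev: "degree (chebyshev n) = n"
proof -
  have "degree (chebyshev n) = n \<and> degree (chebyshev (Suc n)) = Suc n"
  proof (induction n)
    case 0
    show ?case by (simp add: chebyshev_0 chebyshev_1)
  next
    case (Suc k)
    then have "chebyshev (Suc k) \<noteq> 0" by auto
    then have "degree ([:0, 2:] * chebyshev (Suc k)) = Suc (Suc k)"
      using Suc by (subst degree_mult_eq) auto
    then have "degree (chebyshev (Suc (Suc k))) = Suc (Suc k)"
      unfolding chebyshev_rec using Suc by (subst diff_conv_add_uminus, subst degree_add_eq_left) auto
    with Suc show ?case by simp
  qed
  then show ?thesis ..
qed

lemma pderiv_chebyshev:
  "(pderiv (chebyshev n))\<^sup>2 * [:-1, 0, 1:] = smult ((of_nat n)\<^sup>2) ((chebyshev n)\<^sup>2 - 1)"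
proof (rule chebyshev_unique)
  fix \<theta> :: complex
  have "((\<lambda>t. poly (chebyshev n) (cos t)) has_field_derivative poly (pderiv (chebyshev n)) (cos \<theta>) * - sin \<theta>) (at \<theta>)"
    by (auto intro!: derivative_eq_intros poly_DERIV[THEN DERIV_chain2])
  moreover have "((\<lambda>t. cos (of_nat n * t)) has_field_derivative - sin (of_nat n * \<theta>) * of_nat n) (at \<theta>)"
    by (auto intro!: derivative_eq_intros)
  ultimately have "poly (pderiv (chebyshev n)) (cos \<theta>) * - sin \<theta> = - sin (of_nat n * \<theta>) * of_nat n"
    unfolding poly_chebyshev_cos by (rule DERIV_unique)
  then have "(poly (pderiv (chebyshev n)) (cos \<theta>))\<^sup>2 * (sin \<theta>)\<^sup>2 = (sin (of_nat n * \<theta>))\<^sup>2 * (of_nat n)\<^sup>2"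
    by (metis minus_mult_commute minus_mult_left mult_minus_right power2_minus power_mult_distrib)
  then have "(poly (pderiv (chebyshev n)) (cos \<theta>))\<^sup>2 * (1 - (cos \<theta>)\<^sup>2)
      = (1 - (cos (of_nat n * \<theta>))\<^sup>2) * (of_nat n)\<^sup>2"
    unfolding sin_squared_eq .
  then have "(poly (pderiv (chebyshev n)) (cos \<theta>))\<^sup>2 * ((cos \<theta>)\<^sup>2 - 1)
      = (of_nat n)\<^sup>2 * ((cos (of_nat n * \<theta>))\<^sup>2 - 1)" by algebra
  then show "poly ((pderiv (chebyshev n))\<^sup>2 * [:-1, 0, 1:]) (cos \<theta>)
      = poly (smult ((of_nat n)\<^sup>2) ((chebyshev n)\<^sup>2 - 1)) (cos \<theta>)"
    by (simp add: poly_chebyshev_cos power2_eq_square del: mult_pCons_left mult_pCons_right)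
qed

lemma special_imp_quadratic_ode:
  assumes "special P"
  shows "quadratic_ode P"
proof -
  obtain n l where n: "2 \<le> n" and l: "degree l = 1" and
    "l \<circ>\<^sub>p P = monom 1 n \<circ>\<^sub>p l \<or> l \<circ>\<^sub>p P = chebyshev n \<circ>\<^sub>p l \<or> l \<circ>\<^sub>p P = (- chebyshev n) \<circ>\<^sub>p l"
    using assms by (auto simp: special_def poly_conjugate_def)
  moreover have "quadratic_ode (monom 1 n)"
    unfolding quadratic_ode_def
  proof (intro exI[of _ "monom 1 2"] conjI)
    obtain k where k: "n = Suc k" using n by (cases n) auto
    have "(pderiv (monom (1::complex) n))\<^sup>2 * monom 1 2 = monom ((of_nat n)\<^sup>2) (n + n)"
      by (simp add: k pderiv_monom power2_eq_square mult_monom)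
    then show "(pderiv (monom (1::complex) n))\<^sup>2 * monom 1 2
        = smult ((of_nat (degree (monom (1::complex) n)))\<^sup>2) (monom 1 2 \<circ>\<^sub>p monom 1 n)"
      by (simp add: degree_monom_eq pcompose_monom smult_monom monom_power mult_2_right)
  qed (simp add: degree_monom_eq)
  moreover have "quadratic_ode (chebyshev n)" "quadratic_ode (- chebyshev n)"
    unfolding quadratic_ode_def using pderiv_chebyshev[of n]
    by (auto intro!: exI[of _ "[:-1, 0, 1:]"] simp: degree_chebyshev pcompose_square_minus_1 pderiv_minus
        simp del: mult_pCons_left mult_pCons_right)
  ultimately show ?thesis using quadratic_ode_conj[OF l] by blast
qed

text \<open>After moving \<open>u\<close> to 0 the hypothesis is Euler's equation
  \<open>z * H' = m * H\<close>, whose polynomial solutions are the multiples of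
  \<open>z ^ m\<close>; a dilation removes the coefficient.\<close>

lemma special_of_power:
  fixes P :: "complex poly"
  assumes n: "2 \<le> degree P" and eq: "pderiv P * [:- u, 1:] = smult (of_nat (degree P)) (P - [:u:])"
  shows "special P"
proof -
  define m where "m = degree P"
  define H where "H = (P - [:u:]) \<circ>\<^sub>p [:u, 1:]"
  have dH: "degree H = m"
    unfolding H_def m_def degree_pcompose using n by (subst diff_conv_add_uminus, subst degree_add_eq_left) auto
  have "pderiv H * [:0, 1:] = smult (of_nat m) H"
  proof -
    have "pderiv H = pderiv P \<circ>\<^sub>p [:u, 1:]" unfolding H_def pderiv_pcompose
      by (simp add: pderiv_diff pderiv_pCons one_pCons[symmetric])
    then have "pderiv H * [:0, 1:] = (pderiv P * [:- u, 1:]) \<circ>\<^sub>p [:u, 1:]"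
      by (simp add: pcompose_mult del: mult_pCons_left mult_pCons_right)
    then show ?thesis unfolding eq by (simp add: H_def pcompose_smult m_def)
  qed
  then have "coeff (pderiv H * [:0, 1:]) i = of_nat m * coeff H i" for i by simp
  moreover have "coeff (pderiv H * [:0, 1:]) i = of_nat i * coeff H i" for i
    by (cases i) (simp_all add: coeff_pderiv)
  ultimately have coeffs: "of_nat i * coeff H i = of_nat m * coeff H i" for i by metis
  define p where "p = lead_coeff H"
  have H: "H = monom p m"
  proof (rule poly_eqI)
    show "coeff H i = coeff (monom p m) i" for i
      using coeffs[of i] by (cases "i = m") (auto simp: p_def dH)
  qed
  have "H \<noteq> 0" using n dH by (auto simp: m_def)
  then have p0: "p \<noteq> 0" by (simp add: p_def)
  \<comment> \<open>Conjugation by the dilation with factor \<open>c\<close> turns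
    \<open>p * z ^ m\<close> into \<open>z ^ m\<close> exactly when
    \<open>c ^ m = c * p\<close>.\<close>
  obtain c where c: "c ^ (m - 1) = p" using nth_root_exists[of "m - 1" p] n by (auto simp: m_def)
  with p0 n have c0: "c \<noteq> 0" by (auto simp: m_def)
  have cm: "c ^ m = c * p" using c n by (metis Suc_1 Suc_le_eq m_def not_less_zero power_eq_if)
  have "P - [:u:] = H \<circ>\<^sub>p [:- u, 1:]"
    by (simp add: H_def flip: pcompose_assoc)
  then have PH: "P - [:u:] = smult p ([:- u, 1:] ^ m)"
    by (simp add: H monom_altdef pcompose_smult pcompose_power pcompose_mult)
  have "poly_conjugate P (monom 1 m)"
    unfolding poly_conjugate_def
  proof (intro exI[of _ "[:- c * u, c:]"] conjI)
    show "degree [:- c * u, c:] = 1" using c0 by simp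
    have "[:- c * u, c:] \<circ>\<^sub>p P = smult c (P - [:u:])" by (simp add: pcompose_pCons smult_diff_right)
    also have "\<dots> = smult (c ^ m) ([:- u, 1:] ^ m)" by (simp add: PH cm)
    also have "\<dots> = smult c [:- u, 1:] ^ m" by (simp only: smult_power)
    also have "\<dots> = monom 1 m \<circ>\<^sub>p [:- c * u, c:]"
      by (simp add: monom_altdef pcompose_power pcompose_smult)
    finally show "[:- c * u, c:] \<circ>\<^sub>p P = monom 1 m \<circ>\<^sub>p [:- c * u, c:]" .
  qed
  then show ?thesis using n by (auto simp: special_def m_def)
qed

text \<open>Differentiating and cancelling \<open>2 * pderiv T\<close> yields a linear equation, so
  that solutions can be subtracted.\<close>

lemma second_order_ode:
  fixes T :: "complex poly"
  assumes "(pderiv T)\<^sup>2 * [:-1, 0, 1:] = smult c (T\<^sup>2 - 1)" "pderiv T \<noteq> 0"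
  shows "pderiv (pderiv T) * [:-1, 0, 1:] + pderiv T * [:0, 1:] = smult c T"
proof -
  have "[:0, 2 :: complex:] = 2 * [:0, 1:]" by (simp add: numeral_poly)
  then have "pderiv [:-1, 0, 1:] = 2 * [:0, 1 :: complex:]" by (simp add: pderiv_pCons)
  then have "2 * (pderiv T * (pderiv (pderiv T) * [:-1, 0, 1:] + pderiv T * [:0, 1:]))
      = pderiv ((pderiv T)\<^sup>2 * [:-1, 0, 1:])"
    by (simp add: pderiv_mult power2_eq_square algebra_simps del: mult_pCons_left mult_pCons_right)
  also have "\<dots> = pderiv (smult c (T\<^sup>2 - 1))" using assms by simp
  also have "\<dots> = 2 * (pderiv T * smult c T)"
    by (simp add: pderiv_smult pderiv_diff pderiv_mult power2_eq_square mult.commute)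
  finally have "pderiv T * (pderiv (pderiv T) * [:-1, 0, 1:] + pderiv T * [:0, 1:]) = pderiv T * smult c T"
    unfolding mult_left_cancel[OF zero_neq_numeral[symmetric]] .
  then show ?thesis unfolding mult_left_cancel[OF assms(2)] .
qed

text \<open>In the linear second order equation the top coefficient forces
  \<open>e\<^sup>2 = m\<^sup>2\<close> for the degree \<open>e\<close> of a solution. A combination
  \<open>D\<close> of \<open>T\<close> and the Chebyshev polynomial with cancelled top terms is
  therefore 0, and the inhomogeneous term \<open>- 1\<close> of the first order equation fixes the
  scale up to sign.\<close>

lemma chebyshev_of_ode:
  assumes n: "2 \<le> degree T"
    and eq: "(pderiv T)\<^sup>2 * [:-1, 0, 1:] = smult ((of_nat (degree T))\<^sup>2) (T\<^sup>2 - 1)"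
  shows "T = chebyshev (degree T) \<or> T = - chebyshev (degree T)"
proof -
  define m where "m = degree T"
  define C where "C = chebyshev m"
  have dC: "degree C = m" by (simp add: C_def degree_chebyshev)
  have T': "pderiv T \<noteq> 0" "pderiv C \<noteq> 0" using n dC by (auto simp: pderiv_eq_0_iff m_def)
  have 1: "pderiv (pderiv T) * [:-1, 0, 1:] + pderiv T * [:0, 1:] = smult ((of_nat m)\<^sup>2) T"
    using second_order_ode[OF eq T'(1)] by (simp add: m_def)
  have 2: "pderiv (pderiv C) * [:-1, 0, 1:] + pderiv C * [:0, 1:] = smult ((of_nat m)\<^sup>2) C"
    using second_order_ode[OF pderiv_chebyshev[of m, folded C_def] T'(2)] .
  define D where "D = smult (lead_coeff C) T - smult (lead_coeff T) C"
  have D: "pderiv (pderiv D) * [:-1, 0, 1:] + pderiv D * [:0, 1:] = smult ((of_nat m)\<^sup>2) D"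
  proof -
    have "pderiv (pderiv D) * [:-1, 0, 1:] + pderiv D * [:0, 1:]
      = smult (lead_coeff C) (pderiv (pderiv T) * [:-1, 0, 1:] + pderiv T * [:0, 1:])
       - smult (lead_coeff T) (pderiv (pderiv C) * [:-1, 0, 1:] + pderiv C * [:0, 1:])"
      unfolding D_def by (simp only: pderiv_diff pderiv_smult smult_add_right mult_smult_left left_diff_distrib) simp
    then show ?thesis unfolding 1 2 by (simp add: D_def smult_diff_right mult.commute)
  qed
  have "D = 0"
  proof (rule ccontr)
    assume D0: "D \<noteq> 0"
    have "degree D \<le> m" unfolding D_def using dC by (intro degree_diff_le) (auto simp: m_def)
    moreover have "coeff D m = 0" using dC by (simp add: D_def m_def)
    ultimately have Dm: "degree D < m" using D0 by (metis leading_coeff_0_iff le_neq_implies_less)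
    have c: "coeff (p * [:-1, 0, 1:]) i = (if 2 \<le> i then coeff p (i - 2) else 0) - coeff p i"
      for p :: "complex poly" and i
      by (cases i; cases "i - 1") (auto simp: mult.commute[of p] coeff_pCons split: nat.splits)
    have c': "coeff (p * [:0, 1:]) i = (if 1 \<le> i then coeff p (i - 1) else 0)"
      for p :: "complex poly" and i
      by (cases i) (auto simp: mult.commute[of p])
    define e where "e = degree D"
    have top: "coeff D (Suc e) = 0" "coeff D (Suc (Suc e)) = 0" by (simp_all add: e_def coeff_eq_0)
    have "coeff (pderiv (pderiv D) * [:-1, 0, 1:] + pderiv D * [:0, 1:]) e = (of_nat e)\<^sup>2 * coeff D e"
    proof (cases "2 \<le> e")
      case True
      then obtain f where "e = Suc (Suc f)" by (metis One_nat_def Suc_1 Suc_le_D Suc_le_mono)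
      then show ?thesis using top by (simp add: c c' coeff_pderiv algebra_simps power2_eq_square)
    next
      case False
      then have "e = 0 \<or> e = 1" by linarith
      then show ?thesis using top by (auto simp: c c' coeff_pderiv numeral_2_eq_2)
    qed
    then have "(of_nat e)\<^sup>2 * coeff D e = (of_nat m)\<^sup>2 * coeff D e" unfolding D coeff_smult by (rule sym)
    moreover have "coeff D e \<noteq> 0" using D0 by (simp add: e_def)
    ultimately have "(of_nat e :: complex)\<^sup>2 = (of_nat m)\<^sup>2" by (metis mult_right_cancel)
    then have "e\<^sup>2 = m\<^sup>2" by (metis of_nat_eq_iff of_nat_power)
    then show False using Dm by (simp add: e_def)
  qed
  define k where "k = lead_coeff T / lead_coeff C"
  have "C \<noteq> 0" using n dC by (auto simp: m_def)
  then have C0: "lead_coeff C \<noteq> 0" by simp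
  have "smult (lead_coeff C) T = smult (lead_coeff C) (smult k C)"
    using \<open>D = 0\<close> C0 by (simp add: D_def k_def)
  then have T: "T = smult k C" unfolding smult_left_cancel[OF C0] .
  have "smult (k\<^sup>2) ((pderiv C)\<^sup>2 * [:-1, 0, 1:]) = (pderiv T)\<^sup>2 * [:-1, 0, 1:]"
    by (simp add: T pderiv_smult smult_power del: mult_pCons_left mult_pCons_right)
  also have "\<dots> = smult ((of_nat m)\<^sup>2) (smult (k\<^sup>2) (C\<^sup>2) - 1)"
    unfolding eq m_def[symmetric] by (simp add: T smult_power)
  finally have "smult ((of_nat m)\<^sup>2) (smult (k\<^sup>2) (C\<^sup>2 - 1)) = smult ((of_nat m)\<^sup>2) (smult (k\<^sup>2) (C\<^sup>2) - 1)"
    unfolding pderiv_chebyshev[of m, folded C_def] by (simp add: mult.commute)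
  moreover have m0: "(of_nat m)\<^sup>2 \<noteq> (0 :: complex)" using n by (simp add: m_def)
  ultimately have "smult (k\<^sup>2) (C\<^sup>2 - 1) = smult (k\<^sup>2) (C\<^sup>2) - 1"
    unfolding smult_left_cancel[OF m0] by simp
  moreover have "[:k\<^sup>2:] = smult (k\<^sup>2) (C\<^sup>2) - smult (k\<^sup>2) (C\<^sup>2 - 1)"
    by (simp add: smult_diff_right)
  ultimately have "[:k\<^sup>2:] = 1" by simp
  then have "k\<^sup>2 = 1" by (simp add: one_pCons)
  then have "k = 1 \<or> k = -1" by (simp add: power2_eq_1_iff)
  then show ?thesis using T by (auto simp: C_def m_def)
qed

text \<open>The zeros of \<open>y\<close> decide: a double zero gives a power, while two distinct
  zeros are moved to 1 and -1 and give a Chebyshev polynomial or its negative.\<close>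

lemma quadratic_ode_imp_special:
  assumes ode: "quadratic_ode P" and n: "2 \<le> degree P"
  shows "special P"
proof -
  obtain y where y: "degree y = 2" "(pderiv P)\<^sup>2 * y = smult ((of_nat (degree P))\<^sup>2) (y \<circ>\<^sub>p P)"
    using ode by (auto simp: quadratic_ode_def)
  have "\<not> constant (poly y)" using y(1) by (simp add: constant_degree)
  then obtain u where "poly y u = 0" using fundamental_theorem_of_algebra by blast
  then obtain q where q: "y = [:- u, 1:] * q" by (auto simp: poly_eq_0_iff_dvd)
  have "q \<noteq> 0" using y q by auto
  then have "degree q = 1" using y(1) unfolding q by (simp add: degree_mult_eq del: mult_pCons_left)
  then obtain k b where kb: "q = [:b, k:]" "k \<noteq> 0" by (rule degree_1_E)
  define v where "v = - b / k"
  have yuv: "y = smult k ([:- u, 1:] * [:- v, 1:])" using kb(2) by (simp add: q kb(1) v_def right_diff_distrib)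
  show ?thesis
  proof (cases "u = v")
    case True
    have "(pderiv P * [:- u, 1:])\<^sup>2 = (smult (of_nat (degree P)) (P - [:u:]))\<^sup>2"
    proof -
      have yu: "y = smult k ([:- u, 1:]\<^sup>2)" by (simp add: yuv True power2_eq_square)
      have "smult k ((pderiv P * [:- u, 1:])\<^sup>2) = (pderiv P)\<^sup>2 * y"
        by (simp only: yu power_mult_distrib mult_smult_right)
      also have "[:- u, 1:] \<circ>\<^sub>p P = P - [:u:]" by (simp add: pcompose_pCons)
      then have "(pderiv P)\<^sup>2 * y = smult k ((smult (of_nat (degree P)) (P - [:u:]))\<^sup>2)"
        unfolding y(2) unfolding yu pcompose_smult pcompose_power smult_power by (simp add: mult.commute)
      finally show ?thesis unfolding smult_left_cancel[OF kb(2)] .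
    qed
    then consider "pderiv P * [:- u, 1:] = smult (of_nat (degree P)) (P - [:u:])"
      | "pderiv P * [:- u, 1:] = - smult (of_nat (degree P)) (P - [:u:])"
      unfolding power2_eq_iff by blast
    then show ?thesis
    proof cases
      case 1
      then show ?thesis by (rule special_of_power[OF n])
    next
      \<comment> \<open>Leading coefficients rule out the minus sign of the square root.\<close>
      case 2
      have "coeff (pderiv P * [:- u, 1:]) (degree P) = of_nat (degree P) * lead_coeff P"
        using n by (cases "degree P") (auto simp: mult.commute[of "pderiv P"] coeff_pderiv coeff_eq_0)
      moreover have "coeff (- smult (of_nat (degree P)) (P - [:u:])) (degree P) = - of_nat (degree P) * lead_coeff P"
        using n by (cases "degree P") (auto simp: algebra_simps)
      ultimately have "of_nat (degree P) * lead_coeff P = - of_nat (degree P) * lead_coeff P"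
        using 2 by metis
      then have "of_nat (degree P) * lead_coeff P = 0" by simp
      then have "degree P = 0" by auto
      then show ?thesis using n by auto
    qed
  next
    case False
    \<comment> \<open>\<open>l\<close> sends \<open>u\<close> and \<open>v\<close> to 1 and -1, and
      \<open>l'\<close> is its inverse.\<close>
    define a where "a = 2 / (u - v)"
    define l where "l = [:- (u + v) / (u - v), a:]"
    define l' where "l' = [:(u + v) / 2, (u - v) / 2:]"
    have uv: "u - v \<noteq> 0" using False by simp
    have ll: "l \<circ>\<^sub>p l' = [:0, 1:]" "l' \<circ>\<^sub>p l = [:0, 1:]" "degree l = 1" "degree l' = 1"
      using uv by (simp_all add: l_def l'_def a_def pcompose_pCons field_simps)
    define T where "T = l \<circ>\<^sub>p P \<circ>\<^sub>p l'"
    have lP: "l \<circ>\<^sub>p P = T \<circ>\<^sub>p l" by (simp add: T_def ll flip: pcompose_assoc)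
    have dT: "degree T = degree P" by (simp add: T_def degree_pcompose ll)
    define k' where "k' = k * ((u - v) / 2)\<^sup>2"
    have k'0: "k' \<noteq> 0" using kb uv by (simp add: k'_def)
    have yl: "y \<circ>\<^sub>p l' = smult k' [:-1, 0, 1:]"
      by (simp add: yuv l'_def pcompose_smult pcompose_mult pcompose_pCons k'_def power2_eq_square field_simps)
    have l': "pderiv l = [:a:]" "pderiv l' = [:(u - v) / 2:]" by (simp_all add: l_def l'_def pderiv_pCons)
    have T': "pderiv T = pderiv P \<circ>\<^sub>p l'"
      unfolding T_def pderiv_pcompose l' using uv
      by (simp add: a_def pcompose_smult)
    have "smult k' ((pderiv T)\<^sup>2 * [:-1, 0, 1:]) = ((pderiv P)\<^sup>2 * y) \<circ>\<^sub>p l'"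
      by (simp only: pcompose_mult pcompose_power yl T' mult_smult_right)
    also have "\<dots> = smult ((of_nat (degree P))\<^sup>2) (y \<circ>\<^sub>p (l' \<circ>\<^sub>p l) \<circ>\<^sub>p P \<circ>\<^sub>p l')"
      unfolding y(2) ll by (simp add: pcompose_smult)
    also have "\<dots> = smult ((of_nat (degree P))\<^sup>2) ((y \<circ>\<^sub>p l') \<circ>\<^sub>p T)"
      by (simp add: T_def pcompose_assoc)
    also have "\<dots> = smult k' (smult ((of_nat (degree T))\<^sup>2) (T\<^sup>2 - 1))"
      unfolding yl dT pcompose_smult pcompose_square_minus_1 by (simp add: mult.commute)
    finally have "(pderiv T)\<^sup>2 * [:-1, 0, 1:] = smult ((of_nat (degree T))\<^sup>2) (T\<^sup>2 - 1)"
      unfolding smult_left_cancel[OF k'0] .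
    from chebyshev_of_ode[OF _ this] n dT
    have "T = chebyshev (degree P) \<or> T = - chebyshev (degree P)" by simp
    with lP ll(3) n show ?thesis
      unfolding special_def poly_conjugate_def by metis
  qed
qed

section \<open>Laurent series at infinity\<close>

unbundle fps_syntax

definition laurent :: "complex poly \<Rightarrow> complex fls" where
  "laurent p = poly (map_poly fls_const p) fls_X_inv"

lemma laurent_pCons: "laurent (pCons a p) = fls_const a + fls_X_inv * laurent p"
  by (simp add: laurent_def map_poly_pCons)

lemma laurent_0 [simp]: "laurent 0 = 0"
  by (simp add: laurent_def)

lemma laurent_const [simp]: "laurent [:a:] = fls_const a"
  by (simp add: laurent_pCons)

lemma laurent_add: "laurent (p + q) = laurent p + laurent q"
proof -
  have "map_poly fls_const (p + q) = map_poly fls_const p + map_poly fls_const q"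
    by (rule poly_eqI) (simp add: coeff_map_poly fls_plus_const)
  then show ?thesis by (simp add: laurent_def)
qed

lemma laurent_smult: "laurent (smult a p) = fls_const a * laurent p"
proof -
  have "map_poly fls_const (smult a p) = smult (fls_const a) (map_poly fls_const p)"
    by (rule poly_eqI) (simp add: coeff_map_poly fls_const_mult_const)
  then show ?thesis by (simp add: laurent_def)
qed

lemma laurent_mult: "laurent (p * q) = laurent p * laurent q"
  by (induction p) (simp_all add: laurent_add laurent_smult laurent_pCons algebra_simps)

lemma laurent_diff: "laurent (p - q) = laurent p - laurent q"
  using laurent_add[of "p - q" q] by simp

lemma laurent_power: "laurent (p ^ n) = laurent p ^ n"
  by (induction n) (simp_all add: laurent_mult one_pCons)

text \<open>Differentiation with respect to \<open>z\<close>, the variable of the series being \<open>1 / z\<close>.\<close>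

definition ddz :: "complex fls \<Rightarrow> complex fls" where
  "ddz f = - (fls_X\<^sup>2 * fls_deriv f)"

lemma ddz_add: "ddz (f + g) = ddz f + ddz g"
  by (simp add: ddz_def algebra_simps)

lemma ddz_diff: "ddz (f - g) = ddz f - ddz g"
  by (simp add: ddz_def algebra_simps)

lemma ddz_mult: "ddz (f * g) = ddz f * g + f * ddz g"
  by (simp add: ddz_def algebra_simps)

lemma ddz_const [simp]: "ddz (fls_const a) = 0"
  by (simp add: ddz_def)

lemma ddz_const_mult: "ddz (fls_const a * f) = fls_const a * ddz f"
  by (simp add: ddz_mult)

lemma ddz_divide:
  assumes "g \<noteq> 0"
  shows "ddz (f / g) = (ddz f * g - f * ddz g) / g\<^sup>2"
proof -
  have "ddz f = ddz (f / g) * g + f / g * ddz g"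
    using assms by (subst ddz_mult[symmetric]) simp
  then show ?thesis using assms by (simp add: field_simps power2_eq_square)
qed

lemma ddz_laurent: "ddz (laurent p) = laurent (pderiv p)"
proof (induction p)
  case 0
  then show ?case by (simp add: ddz_def)
next
  case (pCons a p)
  have "ddz fls_X_inv = 1"
  proof -
    have "(fls_X * fls_X_inv :: complex fls) = 1"
      by (metis fls_inverse_X fls_X_nonzero right_inverse)
    then show ?thesis by (simp add: ddz_def power2_eq_square) (metis mult.assoc mult.commute mult_1)
  qed
  then show ?case by (simp add: laurent_pCons ddz_add ddz_mult pCons pderiv_pCons laurent_add)
qed

text \<open>An upper bound on the degree in \<open>z\<close>, possibly negative. The zero series
  satisfies it for every \<open>k\<close>, so error terms need no case distinction, unlike with
  \<open>ldeg\<close>.\<close>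

definition deg_le :: "complex fls \<Rightarrow> int \<Rightarrow> bool" where
  "deg_le f k \<longleftrightarrow> (\<forall>i < - k. f $$ i = 0)"

abbreviation ldeg :: "complex fls \<Rightarrow> int" where
  "ldeg f \<equiv> - fls_subdegree f"

lemma deg_le_iff: "f \<noteq> 0 \<Longrightarrow> deg_le f k \<longleftrightarrow> ldeg f \<le> k"
  unfolding deg_le_def
  by (metis fls_eq0_below_subdegree fls_subdegree_geI minus_le_iff order_less_le_trans)

lemma deg_le_0 [simp]: "deg_le 0 k"
  by (simp add: deg_le_def)

lemma deg_le_mono: "deg_le f k \<Longrightarrow> k \<le> l \<Longrightarrow> deg_le f l"
  by (simp add: deg_le_def)

lemma deg_le_add: "deg_le f k \<Longrightarrow> deg_le g k \<Longrightarrow> deg_le (f + g) k"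
  by (simp add: deg_le_def)

lemma deg_le_diff: "deg_le f k \<Longrightarrow> deg_le g k \<Longrightarrow> deg_le (f - g) k"
  by (simp add: deg_le_def)

lemma deg_le_mult: "deg_le f k \<Longrightarrow> deg_le g l \<Longrightarrow> deg_le (f * g) (k + l)"
  by (cases "f = 0 \<or> g = 0") (auto simp: deg_le_iff)

lemma deg_le_mult': "deg_le f k \<Longrightarrow> deg_le g l \<Longrightarrow> k + l \<le> m \<Longrightarrow> deg_le (f * g) m"
  using deg_le_mult deg_le_mono by blast

lemma ldeg_divide: "f \<noteq> 0 \<Longrightarrow> g \<noteq> 0 \<Longrightarrow> ldeg (f / g) = ldeg f - ldeg g"
proof -
  assume fg: "f \<noteq> 0" "g \<noteq> 0"
  then have "f = f / g * g" "f / g \<noteq> 0" by simp_all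
  then have "fls_subdegree f = fls_subdegree (f / g) + fls_subdegree g"
    using fg by (metis fls_subdegree_mult)
  then show ?thesis by simp
qed

lemma deg_le_divide: "deg_le f k \<Longrightarrow> g \<noteq> 0 \<Longrightarrow> k - ldeg g \<le> m \<Longrightarrow> deg_le (f / g) m"
  by (cases "f = 0") (auto simp: deg_le_iff ldeg_divide)

lemma deg_le_ddz: "deg_le f k \<Longrightarrow> deg_le (ddz f) (k - 1)"
proof -
  assume f: "deg_le f k"
  have "deg_le (fls_deriv f) (k + 1)" using f by (simp add: deg_le_def)
  moreover have "deg_le (fls_X\<^sup>2) (- 2)" by (simp add: deg_le_iff)
  ultimately have "deg_le (fls_X\<^sup>2 * fls_deriv f) (- 2 + (k + 1))" by (intro deg_le_mult)
  then show ?thesis by (simp add: ddz_def deg_le_def)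
qed

lemma deg_le_const [simp]: "deg_le (fls_const a) 0"
  by (simp add: deg_le_def)

lemma deg_le_const_mult: "deg_le f k \<Longrightarrow> deg_le (fls_const a * f) k"
  using deg_le_mult[of "fls_const a" 0 f k] by simp

lemma ldeg_add:
  assumes "f \<noteq> 0" "deg_le g k" "k < ldeg f"
  shows "f + g \<noteq> 0" "ldeg (f + g) = ldeg f"
proof -
  define s where "s = fls_subdegree f"
  have g: "g $$ i = 0" if "i \<le> s" for i using assms that by (simp add: deg_le_def s_def)
  have "(f + g) $$ s \<noteq> 0" using assms g by (simp add: s_def nth_fls_subdegree_nonzero)
  moreover have "(f + g) $$ i = 0" if "i < s" for i using that g by (simp add: s_def)
  ultimately have "fls_subdegree (f + g) = s" by (intro fls_subdegree_eqI)
  then show "ldeg (f + g) = ldeg f" by (simp add: s_def)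
  show "f + g \<noteq> 0" using \<open>(f + g) $$ s \<noteq> 0\<close> by (metis fls_zero_nth)
qed

lemma laurent_degree:
  assumes "p \<noteq> 0"
  shows "laurent p \<noteq> 0 \<and> ldeg (laurent p) = int (degree p)"
  using assms
proof (induction p)
  case (pCons a p)
  show ?case
  proof (cases "p = 0")
    case True
    with pCons show ?thesis by (simp add: fls_const_nonzero)
  next
    case False
    with pCons have p: "laurent p \<noteq> 0" "ldeg (laurent p) = int (degree p)" by auto
    have X: "(fls_X_inv :: complex fls) \<noteq> 0" by simp
    have *: "fls_X_inv * laurent p \<noteq> 0" "ldeg (fls_X_inv * laurent p) = int (degree p) + 1"
      using p X by (simp_all add: fls_subdegree_mult)
    have "deg_le (fls_const a) 0" by simp
    from ldeg_add[OF *(1) this] *(2) False show ?thesis by (simp add: laurent_pCons add.commute)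
  qed
qed simp

lemma laurent_eq_0_iff [simp]: "laurent p = 0 \<longleftrightarrow> p = 0"
  using laurent_degree by fastforce

lemma ldeg_laurent: "p \<noteq> 0 \<Longrightarrow> ldeg (laurent p) = int (degree p)"
  using laurent_degree by blast

lemma deg_le_laurent: "int (degree p) \<le> k \<Longrightarrow> deg_le (laurent p) k"
  using laurent_degree[of p] by (cases "p = 0") (auto simp: deg_le_iff)

lemma deg_le_laurent_iff: "p \<noteq> 0 \<Longrightarrow> deg_le (laurent p) k \<longleftrightarrow> int (degree p) \<le> k"
  using laurent_degree[of p] by (auto simp: deg_le_iff)

text \<open>The passage from approximate to exact identities: an error that is a polynomial and
  decays at infinity is zero.\<close>

lemma poly_eq_0_of_deg_le: "deg_le (laurent p) k \<Longrightarrow> k < 0 \<Longrightarrow> p = 0"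
  by (metis deg_le_laurent_iff of_nat_0_le_iff order.trans linorder_not_le)

lemma fls_const_of_nat [simp]: "fls_const (of_nat n) = (of_nat n :: complex fls)"
  by (simp add: fls_of_nat)

lemma deg_le_of_nat_mult: "deg_le f k \<Longrightarrow> deg_le (of_nat n * f) k"
  using deg_le_const_mult[of f k "of_nat n"] by simp

section \<open>Commuting polynomials\<close>

text \<open>Measures the failure of Euler's identity \<open>z * Y' = degree Y * Y\<close>; it
  vanishes exactly on multiples of monomials. For nonconstant \<open>Y\<close> its quotient by
  \<open>pderiv Y\<close> is \<open>vfield Y - z\<close>.\<close>

definition euler_defect :: "complex poly \<Rightarrow> complex poly" where
  "euler_defect Y = smult (of_nat (degree Y)) Y - [:0, 1:] * pderiv Y"

lemma coeff_euler_defect: "coeff (euler_defect Y) i = (of_nat (degree Y) - of_nat i) * coeff Y i"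
  by (cases i) (simp_all add: euler_defect_def coeff_pderiv algebra_simps)

lemma coeff_euler_defect_centered:
  assumes "centered Y" "degree Y - 1 \<le> i"
  shows "coeff (euler_defect Y) i = 0"
proof -
  consider "i = degree Y" | "i = degree Y - 1" | "degree Y < i" using assms(2) by linarith
  then show ?thesis
    using assms(1) by cases (auto simp: coeff_euler_defect centered_def coeff_eq_0)
qed

lemma degree_euler_defect:
  assumes "centered Y" "2 \<le> degree Y"
  shows "degree (euler_defect Y) \<le> degree Y - 2"
  by (intro degree_le allI impI coeff_euler_defect_centered assms(1)) linarith

text \<open>The logarithmic derivative \<open>h\<close> of a polynomial \<open>p\<close> of large degree is almost invariant under every \<open>X\<close>
  that commutes with \<open>p\<close>, since \<open>p' \<circ> X * X' = (X' \<circ> p) * p'\<close>.\<close>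

definition vfield :: "complex poly \<Rightarrow> complex fls" where
  "vfield p = of_nat (degree p) * laurent p / laurent (pderiv p)"

text \<open>As \<open>X' * vfield p / degree X\<close> is nearly \<open>vfield p\<close> composed
  with \<open>X\<close>, this is nearly \<open>vfield p - z\<close> composed with
  \<open>X\<close>.\<close>

definition defect :: "complex poly \<Rightarrow> complex poly \<Rightarrow> complex fls" where
  "defect p X = laurent (pderiv X) * vfield p / of_nat (degree X) - laurent X"

text \<open>The first quotient is exactly \<open>vfield p - z\<close> composed with
  \<open>X\<close>, written through composed polynomials so that no series is ever substituted; the
  second is the error. Both come from the chain rule for
  \<open>X \<circ>\<^sub>p p = p \<circ>\<^sub>p X\<close>.\<close>

lemma defect_eq:
  assumes comm: "X \<circ>\<^sub>p p = p \<circ>\<^sub>p X" and X: "0 < degree X" and p: "0 < degree p"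
  shows "defect p X = laurent (euler_defect p \<circ>\<^sub>p X) / laurent (pderiv p \<circ>\<^sub>p X)
     - of_nat (degree p) / of_nat (degree X) * laurent (euler_defect X \<circ>\<^sub>p p) / laurent (pderiv p \<circ>\<^sub>p X)"
proof -
  define d m :: "complex fls" where "d = of_nat (degree X)" and "m = of_nat (degree p)"
  define P P' X' PX p'X X'p where "P = laurent p" and "P' = laurent (pderiv p)" and "X' = laurent (pderiv X)"
    and "PX = laurent (p \<circ>\<^sub>p X)" and "p'X = laurent (pderiv p \<circ>\<^sub>p X)" and "X'p = laurent (pderiv X \<circ>\<^sub>p p)"
  have nz: "d \<noteq> 0" "P' \<noteq> 0" "p'X \<noteq> 0"
    using X p by (auto simp: d_def P'_def p'X_def pderiv_eq_0_iff pcompose_eq_0_iff)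
  have ch: "p'X * X' = X'p * P'"
    using arg_cong[OF comm, of "\<lambda>q. laurent (pderiv q)"]
    by (simp add: p'X_def X'_def X'p_def P'_def pderiv_pcompose laurent_mult)
  have 1: "laurent (euler_defect p \<circ>\<^sub>p X) = m * PX - laurent X * p'X"
    by (simp add: euler_defect_def pcompose_diff pcompose_smult pcompose_pCons laurent_diff laurent_smult
        laurent_mult m_def PX_def p'X_def pcompose_mult del: mult_pCons_left)
  have 2: "laurent (euler_defect X \<circ>\<^sub>p p) = d * PX - P * X'p"
    by (simp add: euler_defect_def pcompose_diff pcompose_smult pcompose_pCons laurent_diff laurent_smult
        laurent_mult d_def PX_def X'p_def P_def comm pcompose_mult del: mult_pCons_left)
  have "laurent (euler_defect p \<circ>\<^sub>p X) / p'X - m / d * laurent (euler_defect X \<circ>\<^sub>p p) / p'X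
     = (m * P * X'p / d) / p'X - laurent X"
    unfolding 1 2 using nz by (simp add: field_simps)
  also have "m * P * X'p / d / p'X = X' * (m * P / P') / d"
    using nz ch by (simp add: field_simps)
  finally show ?thesis
    by (simp add: defect_def vfield_def d_def m_def P_def P'_def X'_def p'X_def)
qed

lemma ldeg_pderiv_pcompose:
  assumes "0 < degree p" "0 < degree X"
  shows "laurent (pderiv p \<circ>\<^sub>p X) \<noteq> 0" "ldeg (laurent (pderiv p \<circ>\<^sub>p X)) = (int (degree p) - 1) * int (degree X)"
proof -
  have *: "pderiv p \<circ>\<^sub>p X \<noteq> 0" using assms by (auto simp: pderiv_eq_0_iff pcompose_eq_0_iff)
  then show "laurent (pderiv p \<circ>\<^sub>p X) \<noteq> 0" by simp
  show "ldeg (laurent (pderiv p \<circ>\<^sub>p X)) = (int (degree p) - 1) * int (degree X)"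
    using assms by (simp add: ldeg_laurent[OF *] degree_pcompose degree_pderiv of_nat_diff)
qed

text \<open>Centering removes the coefficient of degree \<open>degree X - 1\<close> from
  \<open>euler_defect X\<close>, which improves the order of the error by a further
  \<open>degree p\<close>.\<close>

lemma deg_le_second_defect:
  assumes X: "centered X" "2 \<le> degree X" and p: "2 \<le> degree p"
  shows "deg_le (of_nat (degree p) / of_nat (degree X) * laurent (euler_defect X \<circ>\<^sub>p p) / laurent (pderiv p \<circ>\<^sub>p X))
     (int (degree X) - 2 * int (degree p))"
proof -
  have p0: "0 < degree p" "0 < degree X" using X p by auto
  have "degree (euler_defect X \<circ>\<^sub>p p) \<le> (degree X - 2) * degree p"
    using degree_euler_defect[OF X] by (simp add: degree_pcompose)
  then have "int (degree (euler_defect X \<circ>\<^sub>p p)) \<le> (int (degree X) - 2) * int (degree p)"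
    using X(2) by (metis of_nat_diff of_nat_le_iff of_nat_mult of_nat_numeral)
  then have 1: "deg_le (laurent (euler_defect X \<circ>\<^sub>p p)) ((int (degree X) - 2) * int (degree p))"
    by (rule deg_le_laurent)
  have "of_nat (degree p) / of_nat (degree X) = fls_const (of_nat (degree p) / of_nat (degree X) :: complex)"
    by (simp add: fls_const_divide_const[symmetric])
  with 1 have "deg_le (of_nat (degree p) / of_nat (degree X) * laurent (euler_defect X \<circ>\<^sub>p p))
     ((int (degree X) - 2) * int (degree p))"
    by (simp only: deg_le_const_mult)
  then show ?thesis using ldeg_pderiv_pcompose[OF p0]
    by (elim deg_le_divide) (simp_all add: algebra_simps)
qed

lemma ldeg_vfield:
  assumes "0 < degree p"
  shows "vfield p \<noteq> 0" "ldeg (vfield p) = 1"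
proof -
  have p: "p \<noteq> 0" "pderiv p \<noteq> 0" "(of_nat (degree p) :: complex fls) \<noteq> 0"
    using assms by (auto simp: pderiv_eq_0_iff)
  then show "vfield p \<noteq> 0" by (simp add: vfield_def)
  have "ldeg (vfield p) = ldeg (of_nat (degree p) * laurent p) - ldeg (laurent (pderiv p))"
    unfolding vfield_def using p by (intro ldeg_divide) auto
  also have "ldeg (of_nat (degree p) * laurent p) = int (degree p)"
    using p ldeg_laurent[OF p(1)] by (subst fls_subdegree_mult) auto
  finally show "ldeg (vfield p) = 1"
    using assms ldeg_laurent[OF p(2)] by (simp add: degree_pderiv of_nat_diff)
qed

lemma vfield_minus_z:
  assumes "0 < degree p"
  shows "vfield p - laurent [:0, 1:] = laurent (euler_defect p) / laurent (pderiv p)"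
proof -
  have "laurent (pderiv p) \<noteq> 0" using assms by (auto simp: pderiv_eq_0_iff)
  moreover have "laurent (euler_defect p) = of_nat (degree p) * laurent p - laurent [:0, 1:] * laurent (pderiv p)"
    by (simp only: euler_defect_def laurent_diff laurent_smult laurent_mult fls_const_of_nat)
  ultimately show ?thesis by (simp add: vfield_def field_simps)
qed

lemma ddz_half: "ddz (f / 2) = ddz f / 2"
proof -
  have "ddz (2 * (f / 2)) = 2 * ddz (f / 2)"
    using ddz_const_mult[of 2 "f / 2"] by simp
  then show ?thesis by simp
qed

text \<open>\<open>vfield p\<close> solves a linear second order equation for every pair of polynomials on which the defect of \<open>p\<close>
  is \<open>\<gamma> / X\<close> up to terms of relative order \<open>X\<close> to the power \<open>- 3\<close>.\<close>

lemma pair_equation: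
  fixes h :: "complex fls" and X Y :: "complex poly"
  assumes h: "h \<noteq> 0" "ldeg h = 1" and \<gamma>: "\<gamma> \<noteq> 0"
    and X: "laurent (pderiv X) * h / of_nat (degree X) = laurent X + fls_const \<gamma> / laurent X + E1"
      "deg_le E1 (- 2 * int (degree X))"
    and Y: "laurent (pderiv Y) * h / of_nat (degree Y) = laurent Y + fls_const \<gamma> / laurent Y + E2"
      "deg_le E2 (- 2 * int (degree Y))"
    and deg: "0 < degree X" "degree X < degree Y" "degree Y < 2 * degree X"
  defines "k \<equiv> degree Y - degree X"
  obtains u where "degree u = k - 1" "u \<noteq> 0"
    "deg_le (laurent (pderiv (pderiv u)) * h\<^sup>2 + laurent (pderiv u) * (3 / 2 * ddz (h\<^sup>2))
        + laurent u * (1 / 2 * ddz (ddz (h\<^sup>2))) - of_nat (k\<^sup>2) * laurent u)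
      (int (degree Y) - 2 * int (degree X) - 1)"
proof -
  define a b where "a = laurent X" and "b = laurent Y"
  define a' b' where "a' = ddz a" and "b' = ddz b"
  define c where "c = fls_const \<gamma>"
  define x y :: "complex fls" where "x = of_nat (degree X)" and "y = of_nat (degree Y)"
  define K :: "complex fls" where "K = of_nat k"
  \<comment> \<open>Common order of the error terms \<open>F\<close>, \<open>F2\<close>,
    \<open>F3\<close> below; the bound \<open>degree Y < 2 * degree X\<close> makes it
    negative.\<close>
  define s where "s = int (degree Y) - 2 * int (degree X)"
  have Kxy: "K = y - x" using deg by (simp add: K_def k_def x_def y_def of_nat_diff)
  have XY: "X \<noteq> 0" "Y \<noteq> 0" using deg by auto
  have nz: "a \<noteq> 0" "b \<noteq> 0" "c \<noteq> 0" "x \<noteq> 0" "y \<noteq> 0"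
    using XY deg \<gamma> by (auto simp: a_def b_def c_def x_def y_def)
  have la: "ldeg a = int (degree X)" "ldeg b = int (degree Y)"
    using XY by (auto simp: a_def b_def ldeg_laurent)
  have s: "s < 0" using deg by (simp add: s_def)
  have X': "a' * h = x * (a + c / a + E1)"
    using X(1) nz by (simp add: a_def a'_def ddz_laurent c_def x_def field_simps)
  have Y': "b' * h = y * (b + c / b + E2)"
    using Y(1) nz by (simp add: b_def b'_def ddz_laurent c_def y_def field_simps)
  define \<kappa> where "\<kappa> = 1 / (\<gamma> * of_nat (degree X) * of_nat (degree Y))"
  \<comment> \<open>A weighted Wronskian: after multiplication by \<open>h\<close> the main terms
    \<open>X * Y\<close> cancel, and the \<gamma> terms leave \<open>\<rho> - 1 / \<rho>\<close>,
    normalized by \<kappa>.\<close>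
  define u where "u = smult \<kappa> (smult (of_nat (degree Y)) (Y * pderiv X) - smult (of_nat (degree X)) (X * pderiv Y))"
  have ck: "fls_const \<kappa> = 1 / (c * x * y)"
    by (simp add: \<kappa>_def c_def x_def y_def flip: fls_const_divide_const fls_const_mult_const)
  define \<rho> where "\<rho> = b / a"
  define F where "F = (b * E1 - a * E2) / c"
  define U where "U = laurent u"
  have \<rho>0: "\<rho> \<noteq> 0" using nz by (simp add: \<rho>_def)
  have l\<rho>: "ldeg \<rho> = int k" using nz la deg by (simp add: \<rho>_def ldeg_divide k_def of_nat_diff)
  have Uh: "U * h = \<rho> - 1 / \<rho> + F"
  proof -
    have "U * h = 1 / (c * x * y) * (y * (b * (a' * h)) - x * (a * (b' * h)))"
      by (simp add: U_def u_def laurent_smult laurent_diff laurent_mult ck x_def y_def a'_def b'_def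
          a_def b_def ddz_laurent algebra_simps)
    also have "\<dots> = (b * (c / a + E1) - a * (c / b + E2)) / c"
      unfolding X' Y' using nz by (simp add: field_simps)
    also have "\<dots> = \<rho> - 1 / \<rho> + F" using nz by (simp add: \<rho>_def F_def field_simps)
    finally show ?thesis .
  qed
  have lc: "ldeg c = 0" by (simp add: c_def)
  have F: "deg_le F s"
  proof -
    have "deg_le (b * E1) s"
      using X(2) nz la by (intro deg_le_mult'[of b "int (degree Y)" E1 "- 2 * int (degree X)"])
        (auto simp: deg_le_iff s_def)
    moreover have "deg_le (a * E2) s"
      using Y(2) nz la deg by (intro deg_le_mult'[of a "int (degree X)" E2 "- 2 * int (degree Y)"])
        (auto simp: deg_le_iff s_def)
    ultimately show ?thesis unfolding F_def using nz(3) lc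
      by (intro deg_le_divide[of _ s] deg_le_diff) auto
  qed
  define G where "G = y * (c / b\<^sup>2 + E2 / b) - x * (c / a\<^sup>2 + E1 / a)"
  have G: "deg_le G (- 2 * int (degree X))"
  proof -
    have t: "deg_le (c / b\<^sup>2) (- 2 * int (degree X))" "deg_le (c / a\<^sup>2) (- 2 * int (degree X))"
      "deg_le (E2 / b) (- 2 * int (degree X))" "deg_le (E1 / a) (- 2 * int (degree X))"
      using deg nz la X(2) Y(2)
      by (auto simp: c_def power2_eq_square intro!: deg_le_divide[of "fls_const \<gamma>" 0]
          deg_le_divide[OF Y(2)] deg_le_divide[OF X(2)])
    show ?thesis unfolding G_def x_def y_def
      by (intro deg_le_diff deg_le_of_nat_mult deg_le_add t)
  qed
  \<comment> \<open>Up to \<open>G\<close>, \<rho> is an eigenfunction of \<open>h * ddz\<close>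
    with eigenvalue \<open>K\<close>, like the \<open>k\<close>-th power of a Boettcher coordinate;
    \<open>1 / \<rho>\<close> has eigenvalue \<open>- K\<close>.\<close>
  have h\<rho>: "h * ddz \<rho> = (K + G) * \<rho>"
  proof -
    have "h * ddz \<rho> = ((b' * h) * a - b * (a' * h)) / a\<^sup>2"
      unfolding \<rho>_def ddz_divide[OF nz(1)] by (simp add: a'_def b'_def algebra_simps diff_divide_distrib)
    also have "\<dots> = (y * (b + c / b + E2) * a - b * (x * (a + c / a + E1))) / a\<^sup>2" unfolding X' Y' ..
    also have "\<dots> = (K + G) * \<rho>"
      using nz by (simp add: Kxy G_def \<rho>_def field_simps power2_eq_square)
    finally show ?thesis .
  qed
  have h\<rho>': "h * ddz (1 / \<rho>) = - ((K + G) / \<rho>)"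
  proof -
    have "ddz 1 = 0" using ddz_const[of 1] by simp
    then have "ddz (1 / \<rho>) = - ddz \<rho> / \<rho>\<^sup>2" by (simp add: ddz_divide[OF \<rho>0])
    then have "h * ddz (1 / \<rho>) = - (h * ddz \<rho>) / \<rho>\<^sup>2" by simp
    also have "\<dots> = - ((K + G) / \<rho>)" unfolding h\<rho> using \<rho>0 by (simp add: power2_eq_square)
    finally show ?thesis .
  qed
  have hD: "deg_le (h * ddz f) s" if "deg_le f s" for f
    using deg_le_mult'[of h 1 "ddz f" "s - 1" s] deg_le_ddz[OF that] h by (simp add: deg_le_iff)
  have G\<rho>: "deg_le (G * \<rho>) s" "deg_le (G / \<rho>) s"
  proof -
    have k: "int k = int (degree Y) - int (degree X)" using deg by (simp add: k_def of_nat_diff)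
    show "deg_le (G * \<rho>) s" using G \<rho>0 l\<rho> deg k
      by (intro deg_le_mult'[OF G, of \<rho> "int k"]) (auto simp: deg_le_iff s_def)
    show "deg_le (G / \<rho>) s" using G \<rho>0 l\<rho> deg k
      by (intro deg_le_divide[OF G]) (auto simp: s_def)
  qed
  define F2 where "F2 = G * \<rho> + G / \<rho> + h * ddz F"
  have F2: "deg_le F2 s" unfolding F2_def by (intro deg_le_add G\<rho> hD F)
  have 1: "h * ddz (U * h) = K * (\<rho> + 1 / \<rho>) + F2"
    unfolding Uh ddz_add ddz_diff distrib_left right_diff_distrib h\<rho> h\<rho>'
    by (simp add: F2_def algebra_simps add_divide_distrib)
  define F3 where "F3 = K * (G * \<rho> - G / \<rho>) + h * ddz F2 - K * K * F"
  have F3: "deg_le F3 s" unfolding F3_def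
    by (intro deg_le_add deg_le_diff hD F2)
      (auto simp: K_def mult.assoc intro!: deg_le_of_nat_mult deg_le_diff G\<rho> F)
  have "h * ddz (h * ddz (U * h)) = K * (h * ddz (\<rho> + 1 / \<rho>)) + h * ddz F2"
    unfolding 1 ddz_add using ddz_const_mult[of "of_nat k" "\<rho> + 1 / \<rho>"] by (simp add: K_def algebra_simps ddz_add)
  also have "h * ddz (\<rho> + 1 / \<rho>) = (K + G) * \<rho> - (K + G) / \<rho>"
    unfolding ddz_add distrib_left h\<rho> h\<rho>' by simp
  also have "K * ((K + G) * \<rho> - (K + G) / \<rho>) + h * ddz F2 = K * K * (U * h) + F3"
    unfolding Uh F3_def by (simp add: algebra_simps add_divide_distrib)
  finally have 2: "h * ddz (h * ddz (U * h)) = K * K * (U * h) + F3" .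
  \<comment> \<open>After division by \<open>h\<close>, the operator \<open>h * ddz\<close> applied
    twice to \<open>U * h\<close> involves \<open>h\<close> only through \<open>h\<^sup>2\<close>
    and its derivatives: this makes the equation linear in \<open>h\<^sup>2\<close>.\<close>
  have H: "ddz (h\<^sup>2) = 2 * h * ddz h" by (simp add: power2_eq_square ddz_mult)
  have "h * ddz (U * h) = ddz U * h\<^sup>2 + 1 / 2 * U * ddz (h\<^sup>2)"
    unfolding H by (simp add: ddz_mult power2_eq_square algebra_simps)
  moreover have "ddz (ddz U * h\<^sup>2 + 1 / 2 * U * ddz (h\<^sup>2))
     = ddz (ddz U) * h\<^sup>2 + ddz U * (3 / 2 * ddz (h\<^sup>2)) + U * (1 / 2 * ddz (ddz (h\<^sup>2)))"
  proof -
    have "1 / 2 * U * ddz (h\<^sup>2) = U * ddz (h\<^sup>2) / 2" by simp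
    then show ?thesis by (simp only: ddz_add ddz_mult ddz_half) (simp add: field_simps)
  qed
  ultimately have "ddz (h * ddz (U * h)) - K * K * U
     = ddz (ddz U) * h\<^sup>2 + ddz U * (3 / 2 * ddz (h\<^sup>2)) + U * (1 / 2 * ddz (ddz (h\<^sup>2))) - K * K * U" by simp
  moreover have "ddz (h * ddz (U * h)) - K * K * U = F3 / h"
    using 2 h by (simp add: field_simps)
  moreover have "deg_le (F3 / h) (s - 1)"
    using F3 h by (intro deg_le_divide[OF F3]) auto
  ultimately have goal: "deg_le (laurent (pderiv (pderiv u)) * h\<^sup>2 + laurent (pderiv u) * (3 / 2 * ddz (h\<^sup>2))
        + laurent u * (1 / 2 * ddz (ddz (h\<^sup>2))) - of_nat (k\<^sup>2) * laurent u)
      (int (degree Y) - 2 * int (degree X) - 1)"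
    by (simp add: U_def ddz_laurent K_def s_def power2_eq_square add.assoc)
  have kp: "0 < k" using deg by (simp add: k_def)
  \<comment> \<open>\<rho> dominates \<open>U * h\<close>, which therefore has degree
    \<open>k\<close>; as \<open>h\<close> has degree 1, \<open>u\<close> has degree
    \<open>k - 1\<close>.\<close>
  have "deg_le (F - 1 / \<rho>) (- 1)"
  proof -
    have "deg_le (fls_const 1 / \<rho>) (- 1)"
      by (intro deg_le_divide[OF deg_le_const]) (use \<rho>0 l\<rho> kp in auto)
    then show ?thesis using deg_le_mono[OF F, of "-1"] s by (intro deg_le_diff) auto
  qed
  from ldeg_add[OF \<rho>0 this] l\<rho> have *: "U * h \<noteq> 0" "ldeg (U * h) = int k"
    unfolding Uh by (simp_all add: algebra_simps)
  then have U0: "U \<noteq> 0" "u \<noteq> 0" by (auto simp: U_def)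
  then have "ldeg (U * h) = int (degree u) + 1"
    using h ldeg_laurent[of u] by (simp add: U_def fls_subdegree_mult)
  with * kp have "degree u = k - 1" by simp
  from that[OF this U0(2) goal] show thesis .
qed

text \<open>\<gamma> is the coefficient of \<open>1 / z\<close> in \<open>vfield p - z\<close>,
  hence the same for all \<open>X\<close>. The bound on \<open>degree X\<close> keeps the second
  error of \<open>defect_eq\<close> within order \<open>- 2 * degree X\<close>.\<close>

lemma defect_expansion:
  assumes comm: "X \<circ>\<^sub>p p = p \<circ>\<^sub>p X" and X: "centered X" "2 \<le> degree X" and p: "centered p" "2 \<le> degree p"
    and large: "3 * degree X \<le> 2 * degree p"
  defines "\<gamma> \<equiv> coeff (euler_defect p) (degree p - 2) / (of_nat (degree p) * lead_coeff p)"
  obtains E where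
    "laurent (pderiv X) * vfield p / of_nat (degree X) = laurent X + fls_const \<gamma> / laurent X + E"
    "deg_le E (- 2 * int (degree X))"
proof -
  define m where "m = degree p"
  define d where "d = degree X"
  obtain m' where m': "m = Suc (Suc m')" using p(2) unfolding m_def
    by (metis One_nat_def Suc_1 Suc_le_D Suc_le_mono)
  have p0: "0 < degree p" "0 < degree X" using p X by auto
  have nzp: "of_nat m * lead_coeff p \<noteq> 0" using p by (auto simp: m_def)
  \<comment> \<open>\<gamma> is chosen to cancel the coefficient \<open>m - 1\<close> of
    \<open>q\<close>, leaving degree at most \<open>m - 2\<close>.\<close>
  define q where "q = [:0, 1:] * euler_defect p - smult \<gamma> (pderiv p)"
  have "coeff q i = 0" if mi: "m - 1 \<le> i" for i
  proof -
    obtain j where i: "i = Suc j" using mi m' by (cases i) simp_all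
    show ?thesis
    proof (cases "i = m - 1")
      case True
      then have "coeff q i = coeff (euler_defect p) (m - 2) - \<gamma> * (of_nat m * lead_coeff p)"
        using i m' by (simp add: q_def coeff_pderiv m_def[symmetric])
      then show ?thesis using nzp by (simp add: \<gamma>_def m_def)
    next
      case False
      then have "m \<le> i" "degree p - 1 \<le> j" using mi i by (simp_all add: m_def)
      then show ?thesis using coeff_euler_defect_centered[OF p(1)] i
        by (simp add: q_def coeff_pderiv coeff_eq_0 m_def)
    qed
  qed
  then have "degree q \<le> m'" by (intro degree_le) (simp add: m')
  then have "degree (q \<circ>\<^sub>p X) \<le> m' * d" by (simp add: degree_pcompose d_def)
  then have q: "deg_le (laurent (q \<circ>\<^sub>p X)) (int m' * int d)"
    by (intro deg_le_laurent) (metis of_nat_le_iff of_nat_mult)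
  define T1 where "T1 = laurent (euler_defect p \<circ>\<^sub>p X) / laurent (pderiv p \<circ>\<^sub>p X)"
  define T2 where "T2 = of_nat (degree p) / of_nat (degree X) * laurent (euler_defect X \<circ>\<^sub>p p) / laurent (pderiv p \<circ>\<^sub>p X)"
  define E where "E = T1 - T2 - fls_const \<gamma> / laurent X"
  have X0: "laurent X \<noteq> 0" using X by auto
  note p'X = ldeg_pderiv_pcompose[OF p0]
  have "T1 - fls_const \<gamma> / laurent X = laurent (q \<circ>\<^sub>p X) / (laurent X * laurent (pderiv p \<circ>\<^sub>p X))"
    using X0 p'X(1) by (simp add: T1_def q_def pcompose_diff pcompose_mult pcompose_smult pcompose_pCons
        laurent_diff laurent_mult laurent_smult field_simps del: mult_pCons_left)
  moreover have "deg_le (laurent (q \<circ>\<^sub>p X) / (laurent X * laurent (pderiv p \<circ>\<^sub>p X))) (- 2 * int d)"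
  proof (rule deg_le_divide[OF q])
    show "laurent X * laurent (pderiv p \<circ>\<^sub>p X) \<noteq> 0" using X0 p'X(1) by simp
    have "X \<noteq> 0" using X by auto
    then have "ldeg (laurent X) = int d" by (simp add: ldeg_laurent d_def)
    then have "ldeg (laurent X * laurent (pderiv p \<circ>\<^sub>p X)) = int d + (int m - 1) * int d"
      using X0 p'X by (simp add: fls_subdegree_mult m_def d_def)
    then show "int m' * int d - ldeg (laurent X * laurent (pderiv p \<circ>\<^sub>p X)) \<le> - 2 * int d"
      by (simp add: m' algebra_simps)
  qed
  moreover have "deg_le T2 (- 2 * int d)"
    unfolding T2_def d_def by (rule deg_le_mono[OF deg_le_second_defect[OF X p(2)]]) (use large in linarith)
  ultimately have "deg_le E (- 2 * int (degree X))"
    using deg_le_diff[of "T1 - fls_const \<gamma> / laurent X" "- 2 * int d" T2]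
    by (simp add: E_def d_def algebra_simps)
  moreover have "laurent (pderiv X) * vfield p / of_nat (degree X) = laurent X + fls_const \<gamma> / laurent X + E"
    using defect_eq[OF comm p0(2,1)] unfolding defect_def E_def T1_def T2_def by (simp add: algebra_simps)
  ultimately show thesis using that by blast
qed

section \<open>Elimination: from three approximate equations to an exact solution\<close>

lemma coeff_mult3_top:
  fixes p q r :: "complex poly"
  assumes "degree p \<le> a" "degree q \<le> b" "degree r \<le> c"
  shows "coeff (p * q * r) (a + b + c) = coeff p a * coeff q b * coeff r c"
proof -
  have "degree (p * q) \<le> a + b" using degree_mult_le[of p q] assms by linarith
  then show ?thesis using assms by (simp add: coeff_mult_top)
qed

text \<open>Multiplying derivatives by powers of \<open>z\<close> gives all terms the same formal
  degree; the coefficient there is a Vandermonde product in the three degrees, nonzero because they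
  are distinct.\<close>

lemma wronskian_nonzero:
  fixes u v w :: "complex poly"
  assumes nz: "u \<noteq> 0" "v \<noteq> 0" "w \<noteq> 0"
    and dist: "degree u \<noteq> degree v" "degree u \<noteq> degree w" "degree v \<noteq> degree w"
  shows "pderiv (pderiv u) * (pderiv v * w - v * pderiv w) - pderiv (pderiv v) * (pderiv u * w - u * pderiv w)
    + pderiv (pderiv w) * (pderiv u * v - u * pderiv v) \<noteq> 0" (is "?W \<noteq> 0")
proof
  assume W: "?W = 0"
  define B where "B = (\<lambda>u :: complex poly. monom 1 1 * pderiv u)"
  define A where "A = (\<lambda>u :: complex poly. monom 1 2 * pderiv (pderiv u))"
  have cB: "coeff (B u) i = of_nat i * coeff u i" for u i
    by (cases i) (simp_all add: B_def coeff_monom_mult coeff_pderiv)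
  have cA: "coeff (A u) i = of_nat i * (of_nat i - 1) * coeff u i" for u i
  proof -
    have *: "coeff (A u) i = (if 2 \<le> i then coeff (pderiv (pderiv u)) (i - 2) else 0)"
      by (simp add: A_def coeff_monom_mult)
    show ?thesis
    proof (cases "2 \<le> i")
      case True
      then obtain j where "i = Suc (Suc j)" by (metis One_nat_def Suc_1 Suc_le_D Suc_le_mono)
      then show ?thesis unfolding * by (simp add: coeff_pderiv)
    next
      case False
      then have "i = 0 \<or> i = 1" by linarith
      then show ?thesis unfolding * by auto
    qed
  qed
  have d: "degree (B u) \<le> degree u" "degree (A u) \<le> degree u" for u
    by (auto intro!: degree_le simp: cA cB coeff_eq_0)
  have mm: "monom (1::complex) 2 = monom 1 1 * monom 1 1" by (simp add: mult_monom numeral_2_eq_2)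
  have "A u * (B v * w - v * B w) - A v * (B u * w - u * B w) + A w * (B u * v - u * B v)
     = monom 1 1 * monom 1 1 * monom 1 1 * ?W"
    by (simp add: A_def B_def mm algebra_simps)
  then have 0: "A u * B v * w - A u * B w * v - A v * B u * w + A v * B w * u + A w * B u * v - A w * B v * u = 0"
    unfolding W by (simp add: algebra_simps)
  define i j k where "i = degree u" and "j = degree v" and "k = degree w"
  define a b c :: complex where "a = of_nat i" and "b = of_nat j" and "c = of_nat k"
  have e: "i + k + j = i + j + k" "j + i + k = i + j + k" "j + k + i = i + j + k" "k + i + j = i + j + k" "k + j + i = i + j + k"
    by simp_all
  note top = coeff_mult3_top[OF d(2) d(1) order_refl]
  have "coeff (A u * B v * w) (i + j + k) - coeff (A u * B w * v) (i + k + j) - coeff (A v * B u * w) (j + i + k)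
     + coeff (A v * B w * u) (j + k + i) + coeff (A w * B u * v) (k + i + j) - coeff (A w * B v * u) (k + j + i) = 0"
    unfolding e using arg_cong[OF 0, of "\<lambda>q. coeff q (i + j + k)"] by simp
  then have "(a - b) * (a - c) * (b - c) * (lead_coeff u * lead_coeff v * lead_coeff w) = 0"
    unfolding i_def j_def k_def top cA cB unfolding a_def b_def c_def i_def j_def k_def by algebra
  then show False using nz dist by (simp add: a_def b_def c_def i_def j_def k_def)
qed

text \<open>The cofactors \<open>M\<close> of the column of second derivatives eliminate
  \<open>H1\<close> and \<open>H2\<close>, and \<open>y\<close> is the Wronskian determinant.
  Cofactors have degree at most \<open>2 * K\<close>, whence the loss in precision.\<close>

lemma rational_approximation:
  fixes u v w :: "complex poly" and H H1 H2 :: "complex fls"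
  assumes nz: "u \<noteq> 0" "v \<noteq> 0" "w \<noteq> 0"
    and dist: "degree u \<noteq> degree v" "degree u \<noteq> degree w" "degree v \<noteq> degree w"
    and K: "degree u \<le> K" "degree v \<le> K" "degree w \<le> K"
    and eq: "deg_le (laurent (pderiv (pderiv u)) * H + laurent (pderiv u) * H1 + laurent u * H2 - of_nat k1 * laurent u) s"
      "deg_le (laurent (pderiv (pderiv v)) * H + laurent (pderiv v) * H1 + laurent v * H2 - of_nat k2 * laurent v) s"
      "deg_le (laurent (pderiv (pderiv w)) * H + laurent (pderiv w) * H1 + laurent w * H2 - of_nat k3 * laurent w) s"
  obtains x y where "y \<noteq> 0" "degree y \<le> 3 * K" "deg_le (laurent y * H - laurent x) (2 * int K + s)"
proof -
  define M where "M = (\<lambda>v w :: complex poly. pderiv v * w - v * pderiv w)"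
  have dM: "degree (M v w) \<le> 2 * K" if "degree v \<le> K" "degree w \<le> K" for v w
    unfolding M_def using that degree_mult_le[of "pderiv v" w] degree_mult_le[of v "pderiv w"]
    by (intro degree_diff_le) (auto simp: degree_pderiv)
  define y where "y = pderiv (pderiv u) * M v w - pderiv (pderiv v) * M u w + pderiv (pderiv w) * M u v"
  define x where "x = smult (of_nat k1) (u * M v w) - smult (of_nat k2) (v * M u w) + smult (of_nat k3) (w * M u v)"
  define E where "E = (\<lambda>u k. laurent (pderiv (pderiv u)) * H + laurent (pderiv u) * H1 + laurent u * H2 - of_nat k * laurent u)"
  show thesis
  proof (rule that)
    show "y \<noteq> 0" unfolding y_def M_def by (rule wronskian_nonzero[OF nz dist])
    have t: "degree (pderiv (pderiv u) * M v w) \<le> 3 * K" if "degree u \<le> K" "degree v \<le> K" "degree w \<le> K" for u v w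
      using degree_mult_le[of "pderiv (pderiv u)" "M v w"] dM[OF that(2,3)] that(1) by (simp add: degree_pderiv)
    show "degree y \<le> 3 * K" unfolding y_def by (intro degree_add_le degree_diff_le t K)
    have "laurent y * H - laurent x = laurent (M v w) * E u k1 - laurent (M u w) * E v k2 + laurent (M u v) * E w k3"
      by (simp add: y_def x_def E_def M_def laurent_add laurent_diff laurent_mult laurent_smult algebra_simps)
    moreover have "int (degree (M v w)) \<le> 2 * int K" if "degree v \<le> K" "degree w \<le> K" for v w
      using dM[OF that] by simp
    then have "deg_le (laurent (M v w) * E u k1) (2 * int K + s)" "deg_le (laurent (M u w) * E v k2) (2 * int K + s)"
      "deg_le (laurent (M u v) * E w k3) (2 * int K + s)"
      using eq K by (auto simp: E_def intro!: deg_le_mult deg_le_laurent)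
    ultimately show "deg_le (laurent y * H - laurent x) (2 * int K + s)"
      by (simp add: deg_le_add deg_le_diff)
  qed
qed

text \<open>The square of \<open>h = vfield p\<close> nearly satisfies the equation defining
  \<open>quadratic_ode Q\<close>, hence so does its approximation \<open>x / y\<close>. Cleared of
  denominators, the error is a polynomial, and the lower bound on \<open>c\<close> makes its degree
  negative: \<open>c\<close> outweighs the factors \<open>y\<close>,
  \<open>y \<circ>\<^sub>p Q\<close> and \<open>Q'\<^sup>2\<close>, of degrees at most
  \<open>b\<close>, \<open>b * degree Q\<close> and \<open>2 * degree Q - 2\<close>.\<close>

lemma invariant_rational:
  assumes comm: "p \<circ>\<^sub>p Q = Q \<circ>\<^sub>p p" and Q: "centered Q" "2 \<le> degree Q" and p: "centered p" "2 \<le> degree p"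
    and y: "y \<noteq> 0" "int (degree y) \<le> b" and appr: "deg_le (laurent y * (vfield p)\<^sup>2 - laurent x) (b - c)"
    and c: "b * (int (degree Q) + 1) + 2 * int (degree Q) < c" "c \<le> int (degree p)"
  shows "quadratic_ode Q"
proof -
  define n where "n = degree Q"
  define m where "m = degree p"
  define h where "h = vfield p"
  have n2: "2 \<le> n" and m2: "2 \<le> m" using Q p by (simp_all add: n_def m_def)
  have b0: "0 \<le> b" using y by linarith
  have p0: "0 < degree p" "0 < degree Q" using p Q by auto
  define N Mm :: "complex fls" where "N = of_nat n" and "Mm = of_nat m"
  have N0: "N \<noteq> 0" using n2 by (simp add: N_def)
  define P P' PQ P'Q where "P = laurent p" and "P' = laurent (pderiv p)"
    and "PQ = laurent (p \<circ>\<^sub>p Q)" and "P'Q = laurent (pderiv p \<circ>\<^sub>p Q)"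
  have P'0: "P' \<noteq> 0" "P'Q \<noteq> 0" using p0 by (auto simp: P'_def P'Q_def pderiv_eq_0_iff pcompose_eq_0_iff)
  have lP'Q: "ldeg P'Q = (int m - 1) * int n" using ldeg_pderiv_pcompose[OF p0] by (simp add: P'Q_def m_def n_def)
  have hP: "h = Mm * P / P'" by (simp add: h_def vfield_def Mm_def m_def P_def P'_def)
  have lh: "h \<noteq> 0" "ldeg h = 1" using ldeg_vfield[OF p0(1)] by (simp_all add: h_def)
  define hQ where "hQ = Mm * PQ / P'Q"
  \<comment> \<open>Multiplied by the square of \<open>pderiv p\<close>, the error of the
    approximation becomes a polynomial, which can be composed with \<open>Q\<close>;
    \<open>hQ\<close> stands for \<open>h\<close> composed with \<open>Q\<close>.\<close>
  define Z where "Z = smult ((of_nat m)\<^sup>2) (y * p\<^sup>2) - x * (pderiv p)\<^sup>2"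
  have LZ: "laurent Z = (laurent y * h\<^sup>2 - laurent x) * P'\<^sup>2"
    using P'0 by (simp add: Z_def laurent_diff laurent_smult laurent_mult laurent_power hP Mm_def P_def P'_def
        fls_const_power field_simps)
  have "deg_le (laurent Z) (b - c + 2 * (int m - 1))"
    unfolding LZ
  proof (rule deg_le_mult')
    show "deg_le (laurent y * h\<^sup>2 - laurent x) (b - c)" using appr by (simp add: h_def)
    show "deg_le (P'\<^sup>2) (2 * (int m - 1))"
    proof -
      have "pderiv p \<noteq> 0" using P'0 by (auto simp: P'_def)
      then have "ldeg P' = int m - 1" using m2 by (simp add: P'_def ldeg_laurent degree_pderiv m_def of_nat_diff)
      then show ?thesis using P'0 by (simp add: deg_le_iff fls_subdegree_pow)
    qed
  qed simp
  then have ZQ: "deg_le (laurent (Z \<circ>\<^sub>p Q)) (int n * (b - c + 2 * (int m - 1)))"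
  proof (cases "Z = 0")
    case False
    assume "deg_le (laurent Z) (b - c + 2 * (int m - 1))"
    with False have "int (degree Z) \<le> b - c + 2 * (int m - 1)" by (simp add: deg_le_laurent_iff)
    then have "int n * int (degree Z) \<le> int n * (b - c + 2 * (int m - 1))" by (intro mult_left_mono) auto
    then show ?thesis by (intro deg_le_laurent) (simp add: degree_pcompose n_def mult.commute)
  qed simp
  define yQ xQ Q' where "yQ = laurent (y \<circ>\<^sub>p Q)" and "xQ = laurent (x \<circ>\<^sub>p Q)" and "Q' = laurent (pderiv Q)"
  have "laurent (Z \<circ>\<^sub>p Q) = (yQ * hQ\<^sup>2 - xQ) * P'Q\<^sup>2"
    using P'0 by (simp add: Z_def pcompose_diff pcompose_smult pcompose_mult pcompose_power laurent_diff laurent_smult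
        laurent_mult laurent_power hQ_def Mm_def PQ_def P'Q_def yQ_def xQ_def fls_const_power field_simps)
  then have "yQ * hQ\<^sup>2 - xQ = laurent (Z \<circ>\<^sub>p Q) / P'Q\<^sup>2" using P'0 by simp
  moreover have "deg_le (laurent (Z \<circ>\<^sub>p Q) / P'Q\<^sup>2) (int n * (b - c))"
    using P'0 lP'Q by (intro deg_le_divide[OF ZQ]) (auto simp: fls_subdegree_pow algebra_simps)
  ultimately have e1: "deg_le (yQ * hQ\<^sup>2 - xQ) (int n * (b - c))" by simp
  have e2: "deg_le (hQ - Q' * h / N) (int n - 2 * int m)"
  proof -
    have "laurent (euler_defect p \<circ>\<^sub>p Q) / P'Q = hQ - laurent Q"
      using P'0 by (simp add: euler_defect_def pcompose_diff pcompose_smult pcompose_mult pcompose_pCons laurent_diff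
          laurent_smult laurent_mult hQ_def Mm_def PQ_def P'Q_def m_def field_simps del: mult_pCons_left)
    then have "hQ - Q' * h / N = of_nat (degree p) / of_nat (degree Q) * laurent (euler_defect Q \<circ>\<^sub>p p) / laurent (pderiv p \<circ>\<^sub>p Q)"
      using defect_eq[OF comm[symmetric] p0(2,1)]
      by (simp add: defect_def Q'_def h_def N_def n_def P'Q_def algebra_simps)
    then show ?thesis using deg_le_second_defect[OF Q p(2)] by (simp add: n_def m_def)
  qed
  have "pderiv Q \<noteq> 0" using p0 by (auto simp: pderiv_eq_0_iff)
  then have lQ': "Q' \<noteq> 0" "ldeg Q' = int n - 1"
    using n2 by (auto simp: Q'_def ldeg_laurent degree_pderiv n_def of_nat_diff)
  have ld: "deg_le (Q' * h / N) (int n)"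
    using lh lQ' N0 by (intro deg_le_divide[of _ "int n"]) (auto simp: deg_le_iff fls_subdegree_mult N_def)
  have "deg_le (hQ - Q' * h / N + Q' * h / N) (int n)"
    using e2 m2 ld by (intro deg_le_add deg_le_mono[OF e2]) auto
  then have "deg_le hQ (int n)" by simp
  then have "deg_le ((hQ - Q' * h / N) * (hQ + Q' * h / N)) (2 * int n - 2 * int m)"
    using ld by (intro deg_le_mult'[OF e2, of _ "int n"] deg_le_add) auto
  then have e3: "deg_le (hQ\<^sup>2 - (Q' * h / N)\<^sup>2) (2 * int n - 2 * int m)"
    by (simp add: power2_eq_square algebra_simps)
  \<comment> \<open>The polynomial to be shown zero, split by source of error: the approximation
    composed with \<open>Q\<close>, the failure of \<open>h\<close> to be exactly invariant under
    \<open>Q\<close>, and the approximation itself.\<close>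
  have "laurent (smult ((of_nat n)\<^sup>2) ((x \<circ>\<^sub>p Q) * y) - (pderiv Q)\<^sup>2 * x * (y \<circ>\<^sub>p Q))
     = N\<^sup>2 * laurent y * xQ - Q'\<^sup>2 * laurent x * yQ"
    by (simp add: laurent_diff laurent_smult laurent_mult laurent_power N_def xQ_def yQ_def Q'_def fls_const_power mult_ac)
  also have "\<dots> = - (of_nat (n\<^sup>2) * (laurent y * (yQ * hQ\<^sup>2 - xQ))) + of_nat (n\<^sup>2) * (laurent y * (yQ * (hQ\<^sup>2 - (Q' * h / N)\<^sup>2)))
      + Q'\<^sup>2 * (yQ * (laurent y * h\<^sup>2 - laurent x))"
    using N0 by (simp add: N_def[symmetric] field_simps)
  also have "deg_le \<dots> (- 1)"
  proof -
    have ly: "deg_le (laurent y) b" using y(2) by (rule deg_le_laurent)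
    have "int (degree (y \<circ>\<^sub>p Q)) \<le> b * int n"
      using y(2) by (simp add: degree_pcompose n_def mult_right_mono)
    then have lyQ: "deg_le yQ (b * int n)" unfolding yQ_def by (rule deg_le_laurent)
    have lQ'2: "deg_le (Q'\<^sup>2) (2 * int n - 2)" using lQ' by (simp add: deg_le_iff fls_subdegree_pow)
    have c': "b * int n + b + 2 * int n < c" using c(1) by (simp add: n_def algebra_simps)
    have "0 \<le> b * int n" using b0 by simp
    then have c0: "0 \<le> c" using c' b0 by linarith
    have "2 * c \<le> int n * c" using n2 c0 by (intro mult_right_mono) auto
    moreover have "int n * (b - c) = b * int n - int n * c" by (simp add: algebra_simps)
    ultimately have "b + int n * (b - c) \<le> - 1" using c' c0 b0 n2 by linarith
    then have "deg_le (laurent y * (yQ * hQ\<^sup>2 - xQ)) (- 1)" by (rule deg_le_mult'[OF ly e1])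
    then have 1: "deg_le (- (of_nat (n\<^sup>2) * (laurent y * (yQ * hQ\<^sup>2 - xQ)))) (- 1)"
      using deg_le_diff[OF deg_le_0 deg_le_of_nat_mult, of "laurent y * (yQ * hQ\<^sup>2 - xQ)" "- 1" "n\<^sup>2"] by simp
    have 2: "deg_le (of_nat (n\<^sup>2) * (laurent y * (yQ * (hQ\<^sup>2 - (Q' * h / N)\<^sup>2)))) (- 1)"
      using c' c(2) b0 by (intro deg_le_of_nat_mult deg_le_mult'[OF ly deg_le_mult[OF lyQ e3]]) (simp add: m_def)
    have 3: "deg_le (Q'\<^sup>2 * (yQ * (laurent y * h\<^sup>2 - laurent x))) (- 1)"
      using c' appr by (intro deg_le_mult'[OF lQ'2 deg_le_mult[OF lyQ, of _ "b - c"]]) (auto simp: h_def)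
    show ?thesis by (intro deg_le_add 1 2 3)
  qed
  finally have "smult ((of_nat n)\<^sup>2) ((x \<circ>\<^sub>p Q) * y) - (pderiv Q)\<^sup>2 * x * (y \<circ>\<^sub>p Q) = 0"
    by (rule poly_eq_0_of_deg_le) simp
  then have eq: "(pderiv Q)\<^sup>2 * x * (y \<circ>\<^sub>p Q) = smult ((of_nat (degree Q))\<^sup>2) ((x \<circ>\<^sub>p Q) * y)"
    by (simp add: n_def)
  have "x \<noteq> 0"
  proof
    assume "x = 0"
    then have "deg_le (laurent y * h\<^sup>2) (b - c)" using appr by (simp add: h_def)
    moreover have "laurent y * h\<^sup>2 \<noteq> 0" "ldeg (laurent y * h\<^sup>2) = int (degree y) + 2"
      using y(1) lh ldeg_laurent[OF y(1)] by (auto simp: fls_subdegree_mult fls_subdegree_pow)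
    ultimately have "int (degree y) + 2 \<le> b - c" by (simp add: deg_le_iff)
    moreover have "b \<le> b * (int (degree Q) + 1)" using b0 mult_left_mono[of 1 "int (degree Q) + 1" b] by simp
    ultimately show False using c(1) by linarith
  qed
  from quadratic_ode_of_rational[OF this y(1) Q(2) eq] show ?thesis
    unfolding quadratic_ode_def by metis
qed

text \<open>A Dirichlet approximation of \<open>ln a / ln n\<close> makes \<open>a ^ i\<close> and
  \<open>n ^ j\<close> agree up to a factor \<open>1 + 1 / L\<close>; independence keeps them
  different.\<close>

lemma close_powers:
  fixes n a L :: nat
  assumes n: "2 \<le> n" and a: "2 \<le> a" and L: "0 < L" and ind: "\<And>i j. 1 \<le> i \<Longrightarrow> 1 \<le> j \<Longrightarrow> a ^ i \<noteq> n ^ j"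
  obtains i j where "1 \<le> i" "1 \<le> j"
    "(a ^ i < n ^ j \<and> L * (n ^ j - a ^ i) \<le> a ^ i) \<or> (n ^ j < a ^ i \<and> L * (a ^ i - n ^ j) \<le> n ^ j)"
proof -
  define \<theta> where "\<theta> = ln (real a) / ln (real n)"
  have lnn: "0 < ln (real n)" "0 < ln (real a)" using n a by auto
  then have \<theta>: "0 < \<theta>" by (simp add: \<theta>_def)
  define \<epsilon> where "\<epsilon> = ln (1 + 1 / real L)"
  have L1: "0 < 1 / real L" using L by simp
  then have \<epsilon>: "0 < \<epsilon>" unfolding \<epsilon>_def by (intro ln_gt_zero) linarith
  \<comment> \<open>The bound \<open>1 / \<theta>\<close> forces the numerator \<open>h\<close> to
    be positive, the other one puts \<open>\<bar>d\<bar>\<close> below \<epsilon>.\<close>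
  obtain N where N: "max (1 / \<theta>) (ln (real n) / \<epsilon>) < real N" using reals_Archimedean2 by blast
  then have "0 < real N" using \<theta> by (smt (verit) divide_pos_pos)
  then have N0: "0 < N" by simp
  obtain h k where hk: "0 < k" "k \<le> int N" "\<bar>of_int k * \<theta> - of_int h\<bar> < 1 / N"
    by (rule Dirichlet_approx[OF N0])
  have "1 / real N < \<theta>" using N \<open>0 < real N\<close> \<theta> by (simp add: field_simps)
  moreover have "\<theta> \<le> of_int k * \<theta>" using hk(1) \<theta> by (simp add: mult_le_cancel_right1)
  ultimately have "0 < real_of_int h" using hk(3) by linarith
  then have h0: "0 < h" by simp
  define i where "i = nat k"
  define j where "j = nat h"
  have ij: "1 \<le> i" "1 \<le> j" "real i = of_int k" "real j = of_int h" using hk h0 by (auto simp: i_def j_def)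
  define d where "d = real i * ln (real a) - real j * ln (real n)"
  have "d = ln (real n) * (of_int k * \<theta> - of_int h)"
    using lnn by (simp add: d_def ij \<theta>_def field_simps)
  then have "\<bar>d\<bar> = ln (real n) * \<bar>of_int k * \<theta> - of_int h\<bar>" using lnn by (simp add: abs_mult)
  also have "\<dots> < ln (real n) * (1 / real N)" using lnn hk(3) by (intro mult_strict_left_mono) auto
  also have "\<dots> < \<epsilon>" using N \<open>0 < real N\<close> \<epsilon> by (simp add: field_simps)
  finally have d\<epsilon>: "\<bar>d\<bar> < \<epsilon>" .
  have exp\<epsilon>: "exp \<epsilon> = 1 + 1 / real L" unfolding \<epsilon>_def by (rule exp_ln) (use L1 in linarith)
  have powers: "real (a ^ i) = exp d * real (n ^ j)" "real (n ^ j) = exp (- d) * real (a ^ i)"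
    using n a by (simp_all add: d_def exp_diff exp_minus exp_of_nat_mult field_simps)
  have bound: "L * (y - x) \<le> x" if "real y = exp t * real x" "\<bar>t\<bar> < \<epsilon>" "x < y" for x y t
  proof -
    have "exp t \<le> 1 + 1 / real L" using that(2) unfolding exp\<epsilon>[symmetric] by simp
    then have "real y \<le> (1 + 1 / real L) * real x" unfolding that(1) by (rule mult_right_mono) simp
    then have "real y - real x \<le> real x / real L" by (simp add: distrib_right)
    then have "real L * (real y - real x) \<le> real x" using L by (simp add: pos_le_divide_eq mult.commute)
    then have "real (L * (y - x)) \<le> real x" using that(3) by (simp add: of_nat_diff)
    then show ?thesis by (simp only: of_nat_le_iff)
  qed
  have "a ^ i \<noteq> n ^ j" using ind ij by blast
  then consider "a ^ i < n ^ j" | "n ^ j < a ^ i" by linarith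
  then show thesis
  proof cases
    case 1
    then show ?thesis using that[OF ij(1,2)] bound[OF powers(2)] d\<epsilon> by simp
  next
    case 2
    then show ?thesis using that[OF ij(1,2)] bound[OF powers(1)] d\<epsilon> by simp
  qed
qed

text \<open>If \<open>vfield p - z\<close> decayed faster than \<open>1 / z\<close>, then the Wronskian of two commuting polynomials whose degrees
  differ by a factor less than two would be nonzero of negative degree.\<close>

lemma euler_defect_subleading:
  assumes Q: "centered Q" "2 \<le> degree Q" and def: "euler_defect Q \<noteq> 0" and I: "2 \<le> I"
    and B: "B \<circ>\<^sub>p Q = Q \<circ>\<^sub>p B" and C: "C \<circ>\<^sub>p Q = Q \<circ>\<^sub>p C"
    and deg: "2 \<le> degree B" "degree B < degree C" "degree C < 2 * degree B"
    and large: "degree Q * degree C < 2 * degree (poly_iter Q I)"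
  shows "coeff (euler_defect (poly_iter Q I)) (degree (poly_iter Q I) - 2) \<noteq> 0"
proof -
  define p where "p = poly_iter Q I"
  define s where "s = poly_iter Q (I - 1)"
  define n m m' where "n = degree Q" and "m = degree p" and "m' = degree s"
  have ps: "p = s \<circ>\<^sub>p Q" using I poly_iter_Suc2[of Q "I - 1"] by (simp add: p_def s_def)
  have n2: "2 \<le> n" using Q by (simp add: n_def)
  have m': "2 \<le> m'" using Q I self_le_power[of "degree Q" "I - 1"] by (simp add: m'_def s_def degree_poly_iter)
  have sc: "centered s" unfolding s_def using Q I by (intro centered_poly_iter) auto
  have mm: "m = m' * n" by (simp add: m_def ps degree_pcompose m'_def n_def)
  have m2: "2 \<le> m" using m' n2 by (simp add: mm) (metis le_trans mult_le_mono numeral_le_one_iff nat_mult_1_right one_le_numeral)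
  have pc: "centered p" unfolding p_def using Q I by (intro centered_poly_iter) auto
  have p0: "0 < degree p" "0 < degree Q" "0 < degree s" using m2 n2 m' by (auto simp: m_def n_def m'_def)
  define Q' where "Q' = laurent (pderiv Q)"
  define s'Q where "s'Q = laurent (pderiv s \<circ>\<^sub>p Q)"
  have nz: "Q' \<noteq> 0" "s'Q \<noteq> 0" using p0 by (auto simp: Q'_def s'Q_def pderiv_eq_0_iff pcompose_eq_0_iff)
  have Q'p: "pderiv Q \<noteq> 0" using p0 by (auto simp: pderiv_eq_0_iff)
  have lQ': "ldeg Q' = int n - 1" using Q'p n2 by (simp add: Q'_def ldeg_laurent degree_pderiv n_def of_nat_diff)
  \<comment> \<open>Replacing \<open>Q\<close> by its iterate \<open>p\<close> changes
    \<open>vfield\<close> by \<open>W\<close>, of order at most \<open>1 - 2 * n\<close>. That is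
    too small to affect the leading term of \<open>vfield Q - z\<close>, of order \<open>- t\<close>
    with \<open>t < n\<close>, so \<open>t\<close> does not depend on the iterate.\<close>
  define W where "W = of_nat n * laurent (euler_defect s \<circ>\<^sub>p Q) / (s'Q * Q')"
  have W: "vfield p = vfield Q + W"
  proof -
    have "of_nat m' * laurent p = laurent (euler_defect s \<circ>\<^sub>p Q) + laurent Q * s'Q"
      by (simp add: euler_defect_def pcompose_diff pcompose_smult pcompose_mult pcompose_pCons laurent_diff
          laurent_smult laurent_mult m'_def ps s'Q_def del: mult_pCons_left)
    moreover have "laurent (pderiv p) = s'Q * Q'" by (simp add: ps pderiv_pcompose laurent_mult s'Q_def Q'_def)
    then have "vfield p = of_nat n * (of_nat m' * laurent p) / (s'Q * Q')"
      by (simp add: vfield_def m_def[symmetric] mm mult_ac)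
    ultimately show ?thesis using nz
      by (simp add: W_def vfield_def[of Q] Q'_def[symmetric] n_def[symmetric] field_simps)
  qed
  have Wd: "deg_le W (1 - 2 * int n)"
  proof -
    have "degree (euler_defect s \<circ>\<^sub>p Q) \<le> (m' - 2) * n"
      using degree_euler_defect[OF sc] m' by (simp add: degree_pcompose m'_def n_def)
    then have "int (degree (euler_defect s \<circ>\<^sub>p Q)) \<le> (int m' - 2) * int n"
      using m' by (metis of_nat_diff of_nat_le_iff of_nat_mult of_nat_numeral)
    then have "deg_le (of_nat n * laurent (euler_defect s \<circ>\<^sub>p Q)) ((int m' - 2) * int n)"
      by (intro deg_le_of_nat_mult deg_le_laurent)
    moreover have "ldeg (s'Q * Q') = (int m' - 1) * int n + (int n - 1)"
      using nz lQ' ldeg_pderiv_pcompose(2)[OF p0(3,2)] by (simp add: fls_subdegree_mult s'Q_def m'_def n_def)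
    ultimately show ?thesis unfolding W_def using nz
      by (elim deg_le_divide) (auto simp: algebra_simps)
  qed
  define j where "j = degree (euler_defect Q)"
  have jn: "j \<le> n - 2" unfolding j_def n_def by (rule degree_euler_defect[OF Q])
  define t where "t = int n - 1 - int j"
  have t: "1 \<le> t" "t \<le> int n - 1" using jn n2 by (auto simp: t_def)
  have "laurent (euler_defect Q) / Q' \<noteq> 0" "ldeg (laurent (euler_defect Q) / Q') = - t"
    using def nz lQ' by (auto simp: ldeg_divide ldeg_laurent t_def j_def)
  moreover have "laurent (euler_defect p) / laurent (pderiv p) = laurent (euler_defect Q) / Q' + W"
    using vfield_minus_z[OF p0(1)] vfield_minus_z[OF p0(2)] W by (simp add: Q'_def algebra_simps)
  ultimately have \<Theta>: "laurent (euler_defect p) / laurent (pderiv p) \<noteq> 0"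
    "ldeg (laurent (euler_defect p) / laurent (pderiv p)) = - t"
    using ldeg_add[OF _ Wd, of "laurent (euler_defect Q) / Q'"] t by auto
  then have \<Theta>0: "euler_defect p \<noteq> 0" by auto
  have "pderiv p \<noteq> 0" using p0 by (auto simp: pderiv_eq_0_iff)
  then have "int (degree (euler_defect p)) - (int m - 1) = - t"
    using \<Theta>(2) \<Theta>0 m2 by (simp add: ldeg_divide ldeg_laurent degree_pderiv m_def of_nat_diff)
  then have deg\<Theta>: "int (degree (euler_defect p)) = int m - 1 - t" by simp
  show ?thesis
  \<comment> \<open>\<open>t = 1\<close> is the claim; for larger \<open>t\<close> the Wronskian
    argument gives a contradiction.\<close>
  proof (cases "t = 1")
    case True
    then have "degree (euler_defect p) = m - 2" using deg\<Theta> m2 by linarith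
    then show ?thesis using \<Theta>0 unfolding p_def[symmetric] m_def[symmetric] by (metis leading_coeff_0_iff)
  next
    case False
    then have t2: "2 \<le> t" using t by simp
    have r: "defect p X \<noteq> 0 \<and> ldeg (defect p X) = - t * int (degree X)"
      if X: "X \<circ>\<^sub>p Q = Q \<circ>\<^sub>p X" "2 \<le> degree X" "n * degree X < 2 * m" for X
    proof -
      have Xc: "centered X" using X Q by (intro commute_centered[of X Q]) auto
      have comm: "X \<circ>\<^sub>p p = p \<circ>\<^sub>p X" unfolding p_def using X(1) by (rule commute_poly_iter)
      define T1 where "T1 = laurent (euler_defect p \<circ>\<^sub>p X) / laurent (pderiv p \<circ>\<^sub>p X)"
      define T2 where "T2 = of_nat (degree p) / of_nat (degree X) * laurent (euler_defect X \<circ>\<^sub>p p) / laurent (pderiv p \<circ>\<^sub>p X)"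
      have X0: "0 < degree X" using X by simp
      have \<Theta>X: "euler_defect p \<circ>\<^sub>p X \<noteq> 0" using \<Theta>0 X0 by (simp add: pcompose_eq_0_iff)
      note p'X = ldeg_pderiv_pcompose[OF p0(1) X0]
      have T1: "T1 \<noteq> 0" "ldeg T1 = - t * int (degree X)"
      proof -
        show "T1 \<noteq> 0" using \<Theta>X p'X by (simp add: T1_def)
        have "ldeg T1 = int (degree (euler_defect p)) * int (degree X) - (int m - 1) * int (degree X)"
          unfolding T1_def using \<Theta>X p'X by (simp add: ldeg_divide ldeg_laurent degree_pcompose m_def)
        then show "ldeg T1 = - t * int (degree X)" unfolding deg\<Theta> by (simp add: algebra_simps)
      qed
      have T2: "deg_le T2 (int (degree X) - 2 * int m)"
        unfolding T2_def m_def using m2 by (intro deg_le_second_defect Xc X) (simp add: m_def)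
      have "deg_le (- T2) (int (degree X) - 2 * int m)" using deg_le_diff[OF deg_le_0 T2] by simp
      moreover have "int (degree X) - 2 * int m < ldeg T1"
      proof -
        have "int n * int (degree X) < 2 * int m"
          using X(3) by (metis of_nat_less_iff of_nat_mult of_nat_numeral)
        moreover have "(t + 1) * int (degree X) \<le> int n * int (degree X)" using t by (intro mult_right_mono) auto
        ultimately show ?thesis unfolding T1 by (simp add: algebra_simps)
      qed
      ultimately have "T1 + - T2 \<noteq> 0" "ldeg (T1 + - T2) = ldeg T1" by (rule ldeg_add[OF T1(1)])+
      then show ?thesis using defect_eq[OF comm X0 p0(1)] T1 by (simp add: T1_def T2_def)
    qed
    define d e where "d = degree B" and "e = degree C"
    have de: "d < e" "e < 2 * d" "2 \<le> d" using deg by (simp_all add: d_def e_def)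
    have "degree Q * degree B \<le> degree Q * degree C" using deg by simp
    then have "degree Q * degree B < 2 * degree (poly_iter Q I)" using large by linarith
    then have rB: "defect p B \<noteq> 0" "ldeg (defect p B) = - t * int d" and
      rC: "defect p C \<noteq> 0" "ldeg (defect p C) = - t * int e"
      using r[OF B] r[OF C] deg large by (auto simp: n_def m_def p_def d_def e_def)
    define h where "h = vfield p"
    have h: "h \<noteq> 0" "ldeg h = 1" using ldeg_vfield[OF p0(1)] by (simp_all add: h_def)
    define b c where "b = laurent B" and "c = laurent C"
    have BC: "B \<noteq> 0" "C \<noteq> 0" using deg by auto
    have bc: "b \<noteq> 0" "c \<noteq> 0" "ldeg b = int d" "ldeg c = int e"
      using BC by (auto simp: b_def c_def d_def e_def ldeg_laurent)
    \<comment> \<open>The terms \<open>B * C\<close> cancel in \<open>v * h\<close>, and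
      \<open>C * defect p B\<close> dominates what remains. Thus
      \<open>degree v + 1 = e - t * d\<close>, negative for \<open>t \<ge> 2\<close> because
      \<open>e < 2 * d\<close>.\<close>
    define v where "v = smult (of_nat e) (C * pderiv B) - smult (of_nat d) (B * pderiv C)"
    have de0: "(of_nat d :: complex fls) \<noteq> 0" "(of_nat e :: complex fls) \<noteq> 0" using de by auto
    have "laurent (pderiv B) * h = of_nat d * (b + defect p B)" "laurent (pderiv C) * h = of_nat e * (c + defect p C)"
      using de0 by (simp_all add: defect_def h_def b_def c_def d_def[symmetric] e_def[symmetric])
    then have vh: "laurent v * h = of_nat d * of_nat e * (c * defect p B + - (b * defect p C))"
      unfolding v_def laurent_diff laurent_smult laurent_mult left_diff_distrib
      by (simp add: b_def[symmetric] c_def[symmetric] mult.assoc) (simp add: algebra_simps)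
    have "c * defect p B \<noteq> 0" "ldeg (c * defect p B) = int e - t * int d"
      using bc rB by (auto simp: fls_subdegree_mult)
    moreover have "deg_le (- (b * defect p C)) (int d - t * int e)"
      using bc rC by (simp add: deg_le_iff fls_subdegree_mult)
    moreover have "int d - t * int e < int e - t * int d"
    proof -
      have "(1 + t) * int d < (1 + t) * int e" using de t by (intro mult_strict_left_mono) auto
      then show ?thesis by (simp add: algebra_simps)
    qed
    ultimately have sum: "c * defect p B + - (b * defect p C) \<noteq> 0"
      "ldeg (c * defect p B + - (b * defect p C)) = int e - t * int d"
      using ldeg_add by metis+
    then have "laurent v * h \<noteq> 0" unfolding vh using de0 by simp
    then have v0: "v \<noteq> 0" by auto
    have "ldeg (laurent v * h) = int e - t * int d"
      unfolding vh using sum de0 by (simp add: fls_subdegree_mult)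
    then have "int (degree v) + 1 = int e - t * int d"
      using v0 h by (simp add: fls_subdegree_mult ldeg_laurent flip: ldeg_laurent)
    moreover have "2 * int d \<le> t * int d" using t2 by (intro mult_right_mono) auto
    ultimately show ?thesis using de by linarith
  qed
qed

lemma quadratic_ode_of_euler_defect:
  assumes "euler_defect Q = 0"
  shows "quadratic_ode Q"
proof -
  have "[:0, 1:] * pderiv Q = smult (of_nat (degree Q)) Q" using assms by (simp add: euler_defect_def)
  then have "([:0, 1:] * pderiv Q)\<^sup>2 = (smult (of_nat (degree Q)) Q)\<^sup>2" by (rule arg_cong)
  then have "(pderiv Q)\<^sup>2 * [:0, 1:]\<^sup>2 = smult ((of_nat (degree Q))\<^sup>2) (Q\<^sup>2)"
    unfolding power_mult_distrib smult_power by (simp only: mult.commute)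
  moreover have "[:0, 1:]\<^sup>2 = monom (1::complex) 2" by (simp add: monom_altdef)
  ultimately show ?thesis unfolding quadratic_ode_def
    by (intro exI[of _ "monom 1 2"]) (simp add: degree_monom_eq pcompose_monom)
qed

lemma commuting_independent_degrees_centered:
  assumes comm: "A \<circ>\<^sub>p Q = Q \<circ>\<^sub>p A" and Q: "centered Q" "2 \<le> degree Q" and A: "2 \<le> degree A"
    and ind: "\<And>i j. 1 \<le> i \<Longrightarrow> 1 \<le> j \<Longrightarrow> degree A ^ i \<noteq> degree Q ^ j"
  shows "quadratic_ode Q"
proof (cases "euler_defect Q = 0")
  case False
  define n where "n = degree Q"
  \<comment> \<open>\<open>18 = 3 * 6\<close>: below,
    \<open>\<delta> \<le> 3 * (d * \<kappa>)\<close>, and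
    \<open>6 * (\<delta> * (n + 1)) \<le> d * d\<close> lets the required
    \<open>3 * (\<delta> * (n + 1))\<close> use only half of the precision \<open>d * d\<close>,
    leaving room for \<open>2 * n\<close>.\<close>
  define L where "L = 18 * (n + 1)"
  have n2: "2 \<le> n" using Q by (simp add: n_def)
  obtain i j where "1 \<le> i" "1 \<le> j" and
    close: "(degree A ^ i < n ^ j \<and> L * (n ^ j - degree A ^ i) \<le> degree A ^ i)
      \<or> (n ^ j < degree A ^ i \<and> L * (degree A ^ i - n ^ j) \<le> n ^ j)"
    using close_powers[OF n2 A, of L] ind by (auto simp: n_def L_def)
  have AQ: "poly_iter A i \<circ>\<^sub>p poly_iter Q j = poly_iter Q j \<circ>\<^sub>p poly_iter A i"
    using commute_poly_iter[OF commute_poly_iter[OF comm, of j, symmetric], of i] by simp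
  have Ai: "poly_iter A i \<circ>\<^sub>p Q = Q \<circ>\<^sub>p poly_iter A i" using commute_poly_iter[OF comm[symmetric], of i] by simp
  have Qj: "poly_iter Q j \<circ>\<^sub>p Q = Q \<circ>\<^sub>p poly_iter Q j" using poly_iter_commute[of Q j] by simp
  obtain B C where BQ: "B \<circ>\<^sub>p Q = Q \<circ>\<^sub>p B" and CQ: "C \<circ>\<^sub>p Q = Q \<circ>\<^sub>p C" and "B \<circ>\<^sub>p C = C \<circ>\<^sub>p B"
    and deg: "degree B < degree C" "L * (degree C - degree B) \<le> degree B"
  proof (rule disjE[OF close])
    assume "degree A ^ i < n ^ j \<and> L * (n ^ j - degree A ^ i) \<le> degree A ^ i"
    then show thesis using that[OF Ai Qj AQ] by (simp add: degree_poly_iter n_def)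
  next
    assume "n ^ j < degree A ^ i \<and> L * (degree A ^ i - n ^ j) \<le> n ^ j"
    then show thesis using that[OF Qj Ai AQ[symmetric]] by (simp add: degree_poly_iter n_def)
  qed
  define d where "d = degree B"
  define \<kappa> where "\<kappa> = degree C - degree B"
  have \<kappa>: "0 < \<kappa>" "degree C = d + \<kappa>" "18 * (n + 1) * \<kappa> \<le> d" using deg by (auto simp: \<kappa>_def d_def L_def)
  have dn: "18 * (n + 1) \<le> d"
    using \<kappa>(1) order.trans[OF _ \<kappa>(3), of "18 * (n + 1)"] by simp
  have d54: "54 * \<kappa> \<le> d"
  proof -
    have "54 * \<kappa> \<le> 18 * (n + 1) * \<kappa>" using n2 by (intro mult_le_mono1) simp
    with \<kappa>(3) show ?thesis by linarith
  qed
  define e where "e = d + \<kappa>"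
  \<comment> \<open>Two polynomials yield three pairs of products. The degree gaps
    \<open>d * \<kappa>\<close>, \<open>d * \<kappa> + \<kappa> * \<kappa>\<close> and
    \<open>2 * (d * \<kappa>) + \<kappa> * \<kappa>\<close> are distinct, as the determinant
    requires, but small against \<open>d * d\<close>.\<close>
  define X1 X2 X3 where "X1 = B \<circ>\<^sub>p B" and "X2 = B \<circ>\<^sub>p C" and "X3 = C \<circ>\<^sub>p C"
  have d1: "degree X1 = d * d" "degree X2 = d * e" "degree X3 = e * e"
    using \<kappa> by (simp_all add: X1_def X2_def X3_def degree_pcompose d_def e_def)
  have XQ: "X1 \<circ>\<^sub>p Q = Q \<circ>\<^sub>p X1" "X2 \<circ>\<^sub>p Q = Q \<circ>\<^sub>p X2" "X3 \<circ>\<^sub>p Q = Q \<circ>\<^sub>p X3"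
    unfolding X1_def X2_def X3_def by (metis BQ CQ pcompose_assoc)+
  have d2: "2 \<le> d" using dn by simp
  have k\<kappa>: "54 * (d * \<kappa>) \<le> d * d" "\<kappa> * \<kappa> \<le> d * \<kappa>" "18 * (n + 1) * (d * \<kappa>) \<le> d * d"
    using mult_le_mono2[OF d54, of d] mult_le_mono2[OF \<kappa>(3), of d] d54 by (simp_all add: mult_ac)
  have ee: "e * e = d * d + 2 * (d * \<kappa>) + \<kappa> * \<kappa>" "d * e = d * d + d * \<kappa>"
    by (simp_all add: e_def algebra_simps)
  have d\<kappa>: "0 < d * \<kappa>" "0 < \<kappa> * \<kappa>" using d2 \<kappa> by simp_all
  \<comment> \<open>Large enough that \<open>I < n ^ I = degree p\<close> alone gives all size
    conditions on \<open>p\<close>.\<close>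
  define I where "I = (n + 2) * (e * e) + 2"
  define p where "p = poly_iter Q I"
  define m where "m = degree p"
  have "I < n ^ I" using n2 by (metis less_exp order_less_le_trans power_mono zero_le_numeral le0)
  then have mI: "I < m" by (simp add: m_def p_def degree_poly_iter n_def)
  have le_e: "d * d \<le> e * e" "d * e \<le> e * e" "n * e \<le> n * (e * e)" "e * e \<le> n * (e * e)"
    using n2 by (auto simp: e_def intro!: mult_le_mono)
  have "I = n * (e * e) + 2 * (e * e) + 2" by (simp add: I_def algebra_simps)
  then have m_large: "3 * (e * e) \<le> 2 * m" "n * e < 2 * m" "d * d + 1 \<le> m"
    using mI le_e by linarith+
  have p2: "2 \<le> degree p" using mI by (simp add: m_def I_def)
  have pc: "centered p" unfolding p_def by (intro centered_poly_iter Q) (simp add: I_def)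
  have \<theta>: "coeff (euler_defect p) (degree p - 2) \<noteq> 0"
    unfolding p_def
  proof (rule euler_defect_subleading[OF Q False _ BQ CQ])
    show "degree Q * degree C < 2 * degree (poly_iter Q I)"
      using m_large(2) by (simp add: n_def m_def p_def \<kappa>(2) e_def)
    show "degree C < 2 * degree B" using \<kappa> d54 by (simp add: d_def[symmetric])
  qed (use deg d2 in \<open>auto simp: I_def d_def\<close>)
  define \<gamma> where "\<gamma> = coeff (euler_defect p) (degree p - 2) / (of_nat (degree p) * lead_coeff p)"
  have \<gamma>0: "\<gamma> \<noteq> 0" using \<theta> p2 by (auto simp: \<gamma>_def)
  define h where "h = vfield p"
  have h: "h \<noteq> 0" "ldeg h = 1" using ldeg_vfield[of p] p2 by (simp_all add: h_def)
  have expansion: "\<exists>E. laurent (pderiv X) * h / of_nat (degree X) = laurent X + fls_const \<gamma> / laurent X + E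
      \<and> deg_le E (- 2 * int (degree X))"
    if X: "X \<circ>\<^sub>p Q = Q \<circ>\<^sub>p X" "2 \<le> degree X" "degree X \<le> e * e" for X
  proof -
    have Xc: "centered X" using X Q by (intro commute_centered[of X Q]) auto
    have comm: "X \<circ>\<^sub>p p = p \<circ>\<^sub>p X" unfolding p_def using X(1) by (rule commute_poly_iter)
    have "3 * degree X \<le> 2 * degree p" using X(3) m_large(1) by (simp add: m_def)
    from defect_expansion[OF comm Xc X(2) pc p2 this] show ?thesis unfolding h_def \<gamma>_def by blast
  qed
  have dd2: "2 \<le> d * d" using d2 by (metis le_trans le_square)
  obtain E1 where E1: "laurent (pderiv X1) * h / of_nat (degree X1) = laurent X1 + fls_const \<gamma> / laurent X1 + E1"
      "deg_le E1 (- 2 * int (degree X1))"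
    using expansion[OF XQ(1)] d1 dd2 le_e by auto
  obtain E2 where E2: "laurent (pderiv X2) * h / of_nat (degree X2) = laurent X2 + fls_const \<gamma> / laurent X2 + E2"
      "deg_le E2 (- 2 * int (degree X2))"
    using expansion[OF XQ(2)] d1 dd2 le_e ee by auto
  obtain E3 where E3: "laurent (pderiv X3) * h / of_nat (degree X3) = laurent X3 + fls_const \<gamma> / laurent X3 + E3"
      "deg_le E3 (- 2 * int (degree X3))"
    using expansion[OF XQ(3)] d1 dd2 le_e by auto
  define H H1 H2 where "H = h\<^sup>2" and "H1 = 3 / 2 * ddz H" and "H2 = 1 / 2 * ddz (ddz H)"
  have dX: "0 < degree X1" "0 < degree X2" "degree X1 < degree X2" "degree X2 < degree X3" "degree X1 < degree X3"
    "degree X2 < 2 * degree X1" "degree X3 < 2 * degree X2" "degree X3 < 2 * degree X1"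
  proof -
    define a x z where "a = d * d" and "x = d * \<kappa>" and "z = \<kappa> * \<kappa>"
    note axz = this[symmetric]
    have "54 * x \<le> a" "z \<le> x" "0 < x" "0 < z" "2 \<le> a"
      using k\<kappa>(1,2) d\<kappa> dd2 by (simp_all only: a_def x_def z_def)
    then have *: "0 < a" "0 < a + x" "a < a + x" "a + x < a + 2 * x + z" "a < a + 2 * x + z"
      "a + x < 2 * a" by linarith+
    from \<open>54 * x \<le> a\<close> \<open>z \<le> x\<close> \<open>0 < x\<close> have zx: "2 * x + z < a" by linarith
    show "0 < degree X1" "0 < degree X2" "degree X1 < degree X2" "degree X2 < degree X3" "degree X1 < degree X3"
      "degree X2 < 2 * degree X1" unfolding d1 ee axz by (fact *)+
    from zx have **: "a + 2 * x + z < 2 * (a + x)" "a + 2 * x + z < 2 * a" by simp_all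
    show "degree X3 < 2 * degree X2" "degree X3 < 2 * degree X1"
      unfolding d1 ee axz by (fact **)+
  qed
  have k: "degree X2 - degree X1 = d * \<kappa>" "degree X3 - degree X2 = d * \<kappa> + \<kappa> * \<kappa>"
    "degree X3 - degree X1 = 2 * (d * \<kappa>) + \<kappa> * \<kappa>"
    unfolding d1 ee by simp_all
  \<comment> \<open>The error order of the pair \<open>X1\<close>, \<open>X3\<close>, the worst of
    the three.\<close>
  define s where "s = int (e * e) - 2 * int (d * d) - 1"
  obtain u where u: "degree u = d * \<kappa> - 1" "u \<noteq> 0" "deg_le (laurent (pderiv (pderiv u)) * H + laurent (pderiv u) * H1
      + laurent u * H2 - of_nat ((d * \<kappa>)\<^sup>2) * laurent u) (int (degree X2) - 2 * int (degree X1) - 1)"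
    by (rule pair_equation[OF h \<gamma>0 E1 E2 dX(1,3,6), unfolded k, folded H_def, folded H1_def H2_def])
  obtain v where v: "degree v = d * \<kappa> + \<kappa> * \<kappa> - 1" "v \<noteq> 0" "deg_le (laurent (pderiv (pderiv v)) * H + laurent (pderiv v) * H1
      + laurent v * H2 - of_nat ((d * \<kappa> + \<kappa> * \<kappa>)\<^sup>2) * laurent v) (int (degree X3) - 2 * int (degree X2) - 1)"
    by (rule pair_equation[OF h \<gamma>0 E2 E3 dX(2,4,7), unfolded k, folded H_def, folded H1_def H2_def])
  obtain w where w: "degree w = 2 * (d * \<kappa>) + \<kappa> * \<kappa> - 1" "w \<noteq> 0" "deg_le (laurent (pderiv (pderiv w)) * H + laurent (pderiv w) * H1
      + laurent w * H2 - of_nat ((2 * (d * \<kappa>) + \<kappa> * \<kappa>)\<^sup>2) * laurent w) (int (degree X3) - 2 * int (degree X1) - 1)"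
    by (rule pair_equation[OF h \<gamma>0 E1 E3 dX(1,5,8), unfolded k, folded H_def, folded H1_def H2_def])
  define \<delta> where "\<delta> = 2 * (d * \<kappa>) + \<kappa> * \<kappa>"
  have s: "int (degree X2) - 2 * int (degree X1) - 1 \<le> s" "int (degree X3) - 2 * int (degree X2) - 1 \<le> s"
    "int (degree X3) - 2 * int (degree X1) - 1 \<le> s"
    using dX unfolding s_def d1 by linarith+
  obtain x y where xy: "y \<noteq> 0" "degree y \<le> 3 * \<delta>" "deg_le (laurent y * H - laurent x) (2 * int \<delta> + s)"
  proof (rule rational_approximation[OF u(2) v(2) w(2) _ _ _ _ _ _ deg_le_mono[OF u(3) s(1)]
        deg_le_mono[OF v(3) s(2)] deg_le_mono[OF w(3) s(3)]])
    show "degree u \<noteq> degree v" "degree u \<noteq> degree w" "degree v \<noteq> degree w"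
      "degree u \<le> \<delta>" "degree v \<le> \<delta>" "degree w \<le> \<delta>"
      using d\<kappa> unfolding u(1) v(1) w(1) \<delta>_def by linarith+
  qed (rule that)
  show ?thesis
  proof (rule invariant_rational[OF _ Q pc p2 xy(1), of "3 * int \<delta>" x "int (d * d) + 1"])
    show "p \<circ>\<^sub>p Q = Q \<circ>\<^sub>p p" unfolding p_def using poly_iter_commute[of Q I] by simp
    show "int (degree y) \<le> 3 * int \<delta>" using xy(2) by linarith
    \<comment> \<open>Because \<open>e * e = d * d + \<delta>\<close>; so the precision is
      \<open>d * d + 1\<close> relative to the degree bound \<open>3 * \<delta>\<close> of
      \<open>y\<close>.\<close>
    have "2 * int \<delta> + s = 3 * int \<delta> - (int (d * d) + 1)" by (simp add: s_def ee \<delta>_def)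
    with xy(3) show "deg_le (laurent y * (vfield p)\<^sup>2 - laurent x) (3 * int \<delta> - (int (d * d) + 1))"
      unfolding H_def h_def by metis
    show "int (d * d) + 1 \<le> int (degree p)" using m_large(3) unfolding m_def by linarith
    have "\<delta> \<le> 3 * (d * \<kappa>)" using k\<kappa>(2) by (simp add: \<delta>_def)
    then have "(n + 1) * (6 * \<delta>) \<le> (n + 1) * (18 * (d * \<kappa>))" by (intro mult_le_mono2) linarith
    moreover have "6 * (\<delta> * (n + 1)) = (n + 1) * (6 * \<delta>)" "(n + 1) * (18 * (d * \<kappa>)) = 18 * (n + 1) * (d * \<kappa>)"
      by (simp_all only: mult_ac)
    ultimately have 1: "6 * (\<delta> * (n + 1)) \<le> d * d" using k\<kappa>(3) by (metis order.trans)
    have "18 * (n + 1) * 2 \<le> d * d" using dn d2 by (intro mult_le_mono)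
    then have "36 * n + 36 \<le> d * d" by simp
    then have "3 * t + 2 * n < d * d + 1" if "6 * t \<le> d * d" for t using that by linarith
    from this[OF 1] have "3 * (\<delta> * (n + 1)) + 2 * n < d * d + 1" .
    then have "int (3 * (\<delta> * (n + 1)) + 2 * n) < int (d * d + 1)" by (simp only: of_nat_less_iff)
    then show "3 * int \<delta> * (int (degree Q) + 1) + 2 * int (degree Q) < int (d * d) + 1"
      by (simp add: n_def algebra_simps)
  qed
qed (rule quadratic_ode_of_euler_defect)

theorem commuting_independent_degrees:
  assumes comm: "A \<circ>\<^sub>p Q = Q \<circ>\<^sub>p A" and deg: "2 \<le> degree Q" "2 \<le> degree A"
    and ind: "\<And>i j. 1 \<le> i \<Longrightarrow> 1 \<le> j \<Longrightarrow> degree A ^ i \<noteq> degree Q ^ j"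
  shows "quadratic_ode Q"
proof -
  obtain s where s: "centered (shift_conj s Q)" using ex_centered_conj[OF deg(1)] .
  have "quadratic_ode (shift_conj s Q)"
  proof (rule commuting_independent_degrees_centered[of "shift_conj s A"])
    show "shift_conj s A \<circ>\<^sub>p shift_conj s Q = shift_conj s Q \<circ>\<^sub>p shift_conj s A"
      by (simp add: comm flip: shift_conj_pcompose)
  qed (use s deg ind in auto)
  moreover have "shift_conj s Q \<circ>\<^sub>p [:- s, 1:] = [:- s, 1:] \<circ>\<^sub>p Q \<circ>\<^sub>p ([:s, 1:] \<circ>\<^sub>p [:- s, 1:])"
    unfolding shift_conj_def by (simp only: pcompose_assoc)
  then have "[:- s, 1:] \<circ>\<^sub>p Q = shift_conj s Q \<circ>\<^sub>p [:- s, 1:]" by simp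
  ultimately show ?thesis using quadratic_ode_conj[of "[:- s, 1:]" Q "shift_conj s Q"] by simp
qed

text \<open>Iterates \<open>U\<close>, \<open>V\<close> of equal degree \<open>N\<close> have
  leading coefficients with the same power of exponent \<open>N - 1\<close>. The \<open>k\<close>-th
  iterate raises them to the exponent \<open>1 + N + ... + N ^ (k - 1)\<close>, which
  \<open>N - 1\<close> divides for \<open>k = N - 1\<close>; then leading coefficients agree and
  \<open>commute_unique\<close> applies.\<close>

theorem commuting_common_iterate:
  assumes comm: "A \<circ>\<^sub>p P = P \<circ>\<^sub>p A" and deg: "2 \<le> degree P" "2 \<le> degree A"
    and ns: "\<not> quadratic_ode P"
  obtains i j where "1 \<le> i" "1 \<le> j" "poly_iter A i = poly_iter P j"
proof -
  obtain i j where ij: "1 \<le> i" "1 \<le> j" "degree A ^ i = degree P ^ j"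
    using commuting_independent_degrees[OF comm deg] ns by blast
  define U V where "U = poly_iter A i" and "V = poly_iter P j"
  define N where "N = degree V"
  have UV: "U \<circ>\<^sub>p V = V \<circ>\<^sub>p U" unfolding U_def V_def
    using commute_poly_iter[OF commute_poly_iter[OF comm, of j, symmetric], of i] by simp
  have dUV: "degree U = N" "degree V = N" using ij by (simp_all add: U_def V_def N_def degree_poly_iter)
  have N2: "2 \<le> N" using deg(1) ij(2) self_le_power[of "degree P" j] by (simp add: N_def V_def degree_poly_iter)
  define k where "k = N - 1"
  have k1: "1 \<le> k" using N2 by (simp add: k_def)
  have "poly_iter U k = poly_iter V k"
  proof (rule commute_unique)
    show "poly_iter U k \<circ>\<^sub>p V = V \<circ>\<^sub>p poly_iter U k" using commute_poly_iter[OF UV[symmetric], of k] by simp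
    show "poly_iter V k \<circ>\<^sub>p V = V \<circ>\<^sub>p poly_iter V k" using poly_iter_commute[of V k] by simp
    show "degree (poly_iter U k) = degree (poly_iter V k)" by (simp add: degree_poly_iter dUV)
    show "0 < degree (poly_iter U k)" using N2 by (simp add: degree_poly_iter dUV)
    show "2 \<le> degree V" using N2 dUV by simp
    have "lead_coeff U ^ k = lead_coeff V ^ k"
      using commute_lead_coeff[OF UV] N2 dUV by (simp add: k_def)
    have dvd: "k dvd (\<Sum>i<k. N ^ i)"
    proof -
      have "N mod k = 1 mod k" using N2 by (simp add: k_def le_mod_geq)
      then have "N ^ i mod k = 1 mod k" for i by (metis power_mod power_one)
      then have "(\<Sum>i<k. N ^ i) mod k = (\<Sum>i<k. 1) mod k"
        using mod_sum_eq[of "\<lambda>i. N ^ i" k "{..<k}"] mod_sum_eq[of "\<lambda>i. 1" k "{..<k}"] by simp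
      then show ?thesis by (simp add: mod_eq_0_iff_dvd)
    qed
    then obtain q where q: "(\<Sum>i<k. N ^ i) = k * q" by (auto simp: dvd_def)
    have "lead_coeff U ^ (\<Sum>i<k. N ^ i) = lead_coeff V ^ (\<Sum>i<k. N ^ i)"
      unfolding q power_mult \<open>lead_coeff U ^ k = lead_coeff V ^ k\<close> ..
    moreover have "0 < degree U" "0 < degree V" using N2 dUV by auto
    ultimately show "lead_coeff (poly_iter U k) = lead_coeff (poly_iter V k)"
      by (simp only: lead_coeff_poly_iter dUV)
  qed
  then have "poly_iter A (i * k) = poly_iter P (j * k)" by (simp add: U_def V_def poly_iter_mult)
  then show thesis using that[of "i * k" "j * k"] ij k1 by simp
qed

section \<open>Amenability\<close>

text \<open>A cluster point, in the compact product \<open>[0, 1] ^ Pow S\<close>, of the normalized counting measures on \<open>F 0, F 1, \<dots>\<close>.\<close>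

lemma ex_mean:
  fixes F :: "nat \<Rightarrow> 'a set"
  assumes fin: "\<And>T. finite (F T)" and sub: "\<And>T. F T \<subseteq> S" and inf: "filterlim (\<lambda>T. card (F T)) at_top sequentially"
  obtains \<mu> where "fin_additive_prob S \<mu>"
    "\<forall>E E' c. E \<subseteq> S \<longrightarrow> E' \<subseteq> S \<longrightarrow>
       (\<forall>T. \<bar>real (card (E \<inter> F T)) - real (card (E' \<inter> F T))\<bar> \<le> c) \<longrightarrow> \<mu> E = \<mu> E'"
proof -
  define \<nu> where "\<nu> = (\<lambda>T E. real (card (E \<inter> F T)) / real (card (F T)))"
  define K where "K = (UNIV :: 'a set set) \<rightarrow>\<^sub>E {0..1::real}"
  have "compactin (product_topology (\<lambda>i. euclidean) UNIV) K"
    unfolding K_def compactin_PiE by simp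
  then have K: "compact K" by (simp add: euclidean_product_topology)
  have \<nu>K: "\<nu> T \<in> K" for T
    unfolding K_def \<nu>_def using fin[of T] by (auto simp: card_mono divide_le_eq)
  have "filtermap \<nu> sequentially \<noteq> bot" by (simp add: filtermap_bot_iff)
  moreover have "eventually (\<lambda>x. x \<in> K) (filtermap \<nu> sequentially)" by (simp add: eventually_filtermap \<nu>K)
  ultimately obtain \<mu> where \<mu>: "inf (nhds \<mu>) (filtermap \<nu> sequentially) \<noteq> bot"
    using K unfolding compact_filter by blast
  \<comment> \<open>A filter finer than the image of \<open>sequentially\<close> that converges to
    \<mu>; it takes the place of a convergent subsequence, which need not exist in this
    product.\<close>
  define G where "G = inf (nhds \<mu>) (filtermap \<nu> sequentially)"
  have G: "G \<noteq> bot" "G \<le> nhds \<mu>" "G \<le> filtermap \<nu> sequentially" using \<mu> by (simp_all add: G_def)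
  have lim: "((\<lambda>\<nu>. \<nu> E) \<longlongrightarrow> \<mu> E) G" for E
  proof -
    have "((\<lambda>\<nu>. \<nu> E) \<longlongrightarrow> \<mu> E) (at \<mu>)"
      using continuous_on_product_coordinates[of E] unfolding continuous_on_def by blast
    then have "((\<lambda>\<nu>. \<nu> E) \<longlongrightarrow> \<mu> E) (nhds \<mu>)" by (rule tendsto_at_iff_tendsto_nhds[THEN iffD1])
    then show ?thesis using G(2) by (rule tendsto_mono[rotated])
  qed
  have "eventually (\<lambda>T. 1 \<le> card (F T)) sequentially"
    using inf unfolding filterlim_at_top by (rule spec)
  then have pos: "eventually (\<lambda>T. 0 < card (F T)) sequentially" by (simp add: Suc_le_eq)
  have ev: "eventually P G" if "eventually (\<lambda>T. P (\<nu> T)) sequentially" for P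
    using that G(3) by (simp add: eventually_filtermap filter_leD)
  have ge0: "0 \<le> \<mu> E" for E
    using lim by (rule tendsto_lowerbound[OF _ ev G(1)]) (simp add: \<nu>_def)
  have one: "\<mu> S = 1"
  proof -
    have "eventually (\<lambda>x. x S = 1) G"
      using pos by (intro ev, elim eventually_mono) (use sub in \<open>simp add: \<nu>_def Int_absorb1\<close>)
    then have "((\<lambda>\<nu>. \<nu> S) \<longlongrightarrow> 1) G" by (rule tendsto_eventually)
    then show ?thesis using tendsto_unique[OF G(1) lim] by blast
  qed
  have add: "\<mu> (x \<union> y) = \<mu> x + \<mu> y" if "x \<inter> y = {}" for x y
  proof -
    have "\<nu> T (x \<union> y) = \<nu> T x + \<nu> T y" for T
    proof -
      have "card ((x \<union> y) \<inter> F T) = card (x \<inter> F T) + card (y \<inter> F T)"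
        using that fin[of T] by (subst card_Un_disjoint[symmetric]) (auto simp: Int_Un_distrib2)
      then show ?thesis by (simp add: \<nu>_def add_divide_distrib)
    qed
    then have "eventually (\<lambda>\<nu>. \<nu> (x \<union> y) = \<nu> x + \<nu> y) G" by (intro ev) simp
    then have "((\<lambda>\<nu>. \<nu> x + \<nu> y) \<longlongrightarrow> \<mu> (x \<union> y)) G"
      using lim[of "x \<union> y"] by (rule Lim_transform_eventually[rotated])
    then show ?thesis using tendsto_unique[OF G(1) _ tendsto_add[OF lim lim]] by blast
  qed
  show thesis
  proof (rule that[of \<mu>])
    show "fin_additive_prob S \<mu>"
      unfolding fin_additive_prob_def additive_def using ge0 one add by blast
    show "\<forall>E E' c. E \<subseteq> S \<longrightarrow> E' \<subseteq> S \<longrightarrow>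
       (\<forall>T. \<bar>real (card (E \<inter> F T)) - real (card (E' \<inter> F T))\<bar> \<le> c) \<longrightarrow> \<mu> E = \<mu> E'"
    proof (intro allI impI)
    fix E E' c
    assume "\<forall>T. \<bar>real (card (E \<inter> F T)) - real (card (E' \<inter> F T))\<bar> \<le> c"
    then have c: "\<And>T. \<bar>real (card (E \<inter> F T)) - real (card (E' \<inter> F T))\<bar> \<le> c" by blast
    have "(\<lambda>T. c / real (card (F T))) \<longlonglongrightarrow> 0"
      by (intro tendsto_divide_0[OF tendsto_const] filterlim_at_top_imp_at_infinity
          filterlim_compose[OF filterlim_real_sequentially inf])
    moreover have "\<bar>\<nu> T E - \<nu> T E'\<bar> \<le> c / real (card (F T))" for T
      using c[of T] by (simp add: \<nu>_def divide_right_mono flip: diff_divide_distrib)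
    ultimately have "(\<lambda>T. \<nu> T E - \<nu> T E') \<longlonglongrightarrow> 0"
      by (intro Lim_null_comparison[of "\<lambda>T. \<nu> T E - \<nu> T E'" "\<lambda>T. c / real (card (F T))"]) auto
    then have "((\<lambda>\<nu>. \<nu> E - \<nu> E') \<longlongrightarrow> 0) (filtermap \<nu> sequentially)"
      by (simp add: filterlim_filtermap)
    then have "((\<lambda>\<nu>. \<nu> E - \<nu> E') \<longlongrightarrow> 0) G" using G(3) by (rule tendsto_mono[rotated])
    then show "\<mu> E = \<mu> E'" using tendsto_unique[OF G(1) _ tendsto_diff[OF lim lim]] by fastforce
    qed
  qed
qed

text \<open>Translation by \<open>a\<close> shifts lengths by \<open>l a\<close>, and each level has
  at most \<open>K\<close> elements, so counts in a ball change by at most \<open>l a * K\<close>.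
  This stays bounded while the powers of \<open>b\<close> make the balls grow without bound.\<close>

lemma amenable_of_length:
  fixes m :: "'a \<Rightarrow> 'a \<Rightarrow> 'a" and l :: "'a \<Rightarrow> nat"
  assumes closed: "\<And>a b. a \<in> S \<Longrightarrow> b \<in> S \<Longrightarrow> m a b \<in> S"
    and add: "\<And>a b. a \<in> S \<Longrightarrow> b \<in> S \<Longrightarrow> l (m a b) = l a + l b"
    and level: "\<And>t. finite {x \<in> S. l x = t}" "\<And>t. card {x \<in> S. l x = t} \<le> K"
    and cancel: "\<And>a x y. a \<in> S \<Longrightarrow> x \<in> S \<Longrightarrow> y \<in> S \<Longrightarrow> m a x = m a y \<Longrightarrow> x = y"
      "\<And>a x y. a \<in> S \<Longrightarrow> x \<in> S \<Longrightarrow> y \<in> S \<Longrightarrow> m x a = m y a \<Longrightarrow> x = y"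
    and pos: "b \<in> S" "0 < l b"
  shows "amenable m S"
proof -
  define F where "F = (\<lambda>T. {x \<in> S. l x < T})"
  have F_Suc: "F (Suc T) = F T \<union> {x \<in> S. l x = T}" for T by (auto simp: F_def)
  have fin: "finite (F T)" for T
  proof (induction T)
    case (Suc T)
    then show ?case unfolding F_Suc using level(1) by simp
  qed (simp add: F_def)
  have grow: "card (F (T + s)) \<le> card (F T) + s * K" for T s
  proof (induction s)
    case (Suc s)
    have "card (F (T + Suc s)) \<le> card (F (T + s)) + card {x \<in> S. l x = T + s}"
      by (simp add: F_Suc card_Un_le)
    then show ?case using Suc level(2)[of "T + s"] by simp
  qed simp
  have mono: "F T \<subseteq> F (T + s)" for T s by (auto simp: F_def)
  have inf: "filterlim (\<lambda>T. card (F T)) at_top sequentially"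
    unfolding filterlim_at_top
  proof
    fix Z
    define c where "c = (\<lambda>k. (m b ^^ k) b)"
    have c: "c k \<in> S \<and> l (c k) = Suc k * l b" for k
      by (induction k) (auto simp: c_def pos closed add)
    have "inj c"
    proof (rule injI)
      fix i j assume "c i = c j"
      then have "Suc i * l b = Suc j * l b" using c by metis
      then show "i = j" using pos(2) by simp
    qed
    have "Z \<le> card (F T)" if "Suc Z * l b \<le> T" for T
    proof -
      have "c ` {..<Z} \<subseteq> F T"
      proof
        fix x assume "x \<in> c ` {..<Z}"
        then obtain k where k: "k < Z" "x = c k" by auto
        have "l (c k) < Suc Z * l b" using c[of k] k(1) pos(2) by simp
        then have "l (c k) < T" using that by linarith
        then show "x \<in> F T" using c[of k] k(2) by (simp add: F_def)
      qed
      then have "card (c ` {..<Z}) \<le> card (F T)" using fin by (intro card_mono)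
      then show ?thesis using \<open>inj c\<close> by (simp add: card_image inj_on_subset)
    qed
    then show "eventually (\<lambda>T. Z \<le> card (F T)) sequentially"
      unfolding eventually_sequentially by blast
  qed
  have sub: "F T \<subseteq> S" for T by (auto simp: F_def)
  obtain \<mu> where \<mu>: "fin_additive_prob S \<mu>"
    "\<forall>E E' c. E \<subseteq> S \<longrightarrow> E' \<subseteq> S \<longrightarrow>
       (\<forall>T. \<bar>real (card (E \<inter> F T)) - real (card (E' \<inter> F T))\<bar> \<le> c) \<longrightarrow> \<mu> E = \<mu> E'"
    by (rule ex_mean[OF fin sub inf])
  have translate: "\<mu> {x \<in> S. f x \<in> E} = \<mu> E"
    if E: "E \<subseteq> S" and f: "\<And>x. x \<in> S \<Longrightarrow> f x \<in> S" "\<And>x. x \<in> S \<Longrightarrow> l (f x) = l x + s" "inj_on f S" for f E s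
  proof (rule \<mu>(2)[rule_format, of _ _ "real (s * K)"])
    fix T
    define E' where "E' = {x \<in> S. f x \<in> E}"
    have fF: "f ` F T \<subseteq> F (T + s)" using f by (auto simp: F_def)
    have inj: "inj_on f (F T)" using f(3) by (rule inj_on_subset) (auto simp: F_def)
    have "f ` (E' \<inter> F T) = E \<inter> f ` F T" by (auto simp: E'_def F_def)
    moreover have "card (f ` (E' \<inter> F T)) = card (E' \<inter> F T)"
      using inj by (intro card_image) (rule inj_on_subset, auto)
    ultimately have 1: "card (E' \<inter> F T) = card (E \<inter> f ` F T)" by simp
    have "card (E \<inter> f ` F T) \<le> card (E \<inter> F T \<union> (F (T + s) - F T))"
      using fF fin by (intro card_mono) auto
    also have "\<dots> \<le> card (E \<inter> F T) + card (F (T + s) - F T)" by (rule card_Un_le)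
    also have "card (F (T + s) - F T) \<le> s * K"
      using grow[of T s] mono[of T s] fin by (simp add: card_Diff_subset)
    finally have 2: "card (E' \<inter> F T) \<le> card (E \<inter> F T) + s * K" using 1 by simp
    have "card (E \<inter> F T) \<le> card (E \<inter> f ` F T \<union> (F (T + s) - f ` F T))"
      using mono[of T s] fin by (intro card_mono) auto
    also have "\<dots> \<le> card (E \<inter> f ` F T) + card (F (T + s) - f ` F T)" by (rule card_Un_le)
    also have "card (F (T + s) - f ` F T) \<le> s * K"
      using grow[of T s] fF fin inj by (simp add: card_Diff_subset card_image)
    finally have 3: "card (E \<inter> F T) \<le> card (E' \<inter> F T) + s * K" using 1 by simp
    show "\<bar>real (card ({x \<in> S. f x \<in> E} \<inter> F T)) - real (card (E \<inter> F T))\<bar> \<le> real (s * K)"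
      using 2 3 unfolding E'_def[symmetric] by linarith
  qed (use E in auto)
  have left: "\<mu> {s \<in> S. m a s \<in> E} = \<mu> E" if a: "a \<in> S" and E: "E \<subseteq> S" for a E
  proof (rule translate[where f = "m a" and s = "l a", OF E])
    show "m a x \<in> S" "l (m a x) = l x + l a" if "x \<in> S" for x
      using closed[OF a that] add[OF a that] by simp_all
    show "inj_on (m a) S" using cancel(1)[OF a] by (rule inj_onI)
  qed
  have right: "\<mu> {s \<in> S. m s a \<in> E} = \<mu> E" if a: "a \<in> S" and E: "E \<subseteq> S" for a E
  proof (rule translate[where f = "\<lambda>s. m s a" and s = "l a", OF E])
    show "m x a \<in> S" "l (m x a) = l x + l a" if "x \<in> S" for x
      using closed[OF that a] add[OF that a] by simp_all
    show "inj_on (\<lambda>s. m s a) S" using cancel(2)[OF a] by (rule inj_onI)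
  qed
  show ?thesis
    unfolding amenable_def left_amenable_def right_amenable_def using \<mu>(1) left right by blast
qed

text \<open>The set of all products \<open>m a s\<close> has measure 1, since its preimage under
  multiplication by \<open>a\<close> is \<open>S\<close>; two disjoint sets of this kind would have
  total measure 2.\<close>

lemma left_amenable_imp_left_reversible:
  assumes closed: "\<And>a b. a \<in> S \<Longrightarrow> b \<in> S \<Longrightarrow> m a b \<in> S" and "left_amenable m S"
  shows "left_reversible m S"
proof -
  obtain \<mu> where \<mu>: "fin_additive_prob S \<mu>" "\<And>a T. a \<in> S \<Longrightarrow> T \<subseteq> S \<Longrightarrow> \<mu> {s \<in> S. m a s \<in> T} = \<mu> T"
    using assms(2) by (auto simp: left_amenable_def)
  have full: "\<mu> (m a ` S) = 1" if "a \<in> S" for a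
  proof -
    have "{s \<in> S. m a s \<in> m a ` S} = S" by auto
    then show ?thesis using \<mu>(2)[OF that, of "m a ` S"] closed[OF that] \<mu>(1)
      by (auto simp: fin_additive_prob_def)
  qed
  show ?thesis unfolding left_reversible_def
  proof (intro ballI)
    fix a b assume ab: "a \<in> S" "b \<in> S"
    show "\<exists>x\<in>S. \<exists>y\<in>S. m a x = m b y"
    proof (rule ccontr)
      assume "\<not> ?thesis"
      then have disj: "m a ` S \<inter> m b ` S = {}" by auto
      have sub: "m a ` S \<subseteq> S" "m b ` S \<subseteq> S" using closed ab by auto
      define R where "R = S - (m a ` S \<union> m b ` S)"
      have add: "\<mu> (x \<union> y) = \<mu> x + \<mu> y" if "x \<subseteq> S" "y \<subseteq> S" "x \<inter> y = {}" for x y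
        using \<mu>(1) that by (auto simp: fin_additive_prob_def additive_def)
      have "S = (m a ` S \<union> m b ` S) \<union> R" using sub by (auto simp: R_def)
      then have "\<mu> S = \<mu> (m a ` S \<union> m b ` S) + \<mu> R"
        using add[of "m a ` S \<union> m b ` S" R] sub by (auto simp: R_def)
      also have "\<mu> (m a ` S \<union> m b ` S) = 1 + 1" using add[OF sub disj] full ab by simp
      finally have "\<mu> S = 2 + \<mu> R" by simp
      moreover have "0 \<le> \<mu> R" "\<mu> S = 1" using \<mu>(1) by (auto simp: fin_additive_prob_def R_def)
      ultimately show False by simp
    qed
  qed
qed

section \<open>Affine symmetries and left reversible semigroups\<close>

text \<open>For nonzero \<epsilon> this means
  \<open>P (\<epsilon> * z) = \<epsilon> ^ degree P * P z\<close>; in terms of coefficients, closure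
  under products, powers and inverses is immediate.\<close>

definition symmetry :: "complex poly \<Rightarrow> complex \<Rightarrow> bool" where
  "symmetry P \<epsilon> \<longleftrightarrow> \<epsilon> \<noteq> 0 \<and> (\<forall>i. coeff P i \<noteq> 0 \<longrightarrow> \<epsilon> ^ i = \<epsilon> ^ degree P)"

lemma rotation_pcompose: "[:0, c:] \<circ>\<^sub>p p = smult c p" for p :: "complex poly"
  by (simp add: pcompose_pCons)

lemma rotation_rotation: "[:0, a:] \<circ>\<^sub>p [:0, b:] = [:0, a * b :: complex:]"
  by (simp add: pcompose_pCons)

lemma symmetry_pcompose: "symmetry P \<epsilon> \<Longrightarrow> P \<circ>\<^sub>p [:0, \<epsilon>:] = [:0, \<epsilon> ^ degree P:] \<circ>\<^sub>p P"
  by (rule poly_eqI) (auto simp: symmetry_def rotation_pcompose coeff_pcompose_linear)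

lemma symmetryI:
  assumes "\<epsilon> \<noteq> 0" "P \<noteq> 0" "P \<circ>\<^sub>p [:0, \<epsilon>:] = [:0, w:] \<circ>\<^sub>p P"
  shows "symmetry P \<epsilon>"
proof -
  have c: "\<epsilon> ^ i * coeff P i = w * coeff P i" for i
    using arg_cong[OF assms(3), of "\<lambda>q. coeff q i"] by (simp add: rotation_pcompose coeff_pcompose_linear)
  have "\<epsilon> ^ degree P = w" using c[of "degree P"] assms(2) by simp
  then show ?thesis using c assms(1) by (simp add: symmetry_def) (metis mult_right_cancel)
qed

lemma symmetry_power: "symmetry P \<epsilon> \<Longrightarrow> symmetry P (\<epsilon> ^ k)"
  by (simp add: symmetry_def) (metis mult.commute power_mult)

lemma symmetry_mult: "symmetry P \<epsilon> \<Longrightarrow> symmetry P \<delta> \<Longrightarrow> symmetry P (\<epsilon> * \<delta>)"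
  by (simp add: symmetry_def power_mult_distrib)

lemma symmetry_inverse: "symmetry P \<epsilon> \<Longrightarrow> symmetry P (1 / \<epsilon>)"
  by (simp add: symmetry_def power_one_over)

lemma symmetry_poly_iter:
  assumes "symmetry P \<epsilon>"
  shows "poly_iter P k \<circ>\<^sub>p [:0, \<epsilon>:] = [:0, \<epsilon> ^ (degree P ^ k):] \<circ>\<^sub>p poly_iter P k"
proof (induction k)
  case (Suc k)
  have "poly_iter P (Suc k) \<circ>\<^sub>p [:0, \<epsilon>:] = P \<circ>\<^sub>p (poly_iter P k \<circ>\<^sub>p [:0, \<epsilon>:])"
    by (simp only: poly_iter_Suc pcompose_assoc)
  also have "\<dots> = (P \<circ>\<^sub>p [:0, \<epsilon> ^ (degree P ^ k):]) \<circ>\<^sub>p poly_iter P k"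
    by (simp only: Suc pcompose_assoc)
  also have "\<dots> = [:0, (\<epsilon> ^ (degree P ^ k)) ^ degree P:] \<circ>\<^sub>p (P \<circ>\<^sub>p poly_iter P k)"
    by (simp only: symmetry_pcompose[OF symmetry_power[OF assms]] pcompose_assoc)
  finally show ?case by (simp only: poly_iter_Suc power_mult[symmetric] power_Suc2[symmetric])
qed simp

text \<open>\<open>P\<close> is not a multiple of a monomial, so some coefficient of index
  \<open>j < degree P\<close> is nonzero, and the order divides \<open>degree P - j\<close>.\<close>

lemma symmetry_finite_order:
  assumes "\<not> quadratic_ode P"
  obtains m where "1 \<le> m" "\<And>\<epsilon>. symmetry P \<epsilon> \<Longrightarrow> \<epsilon> ^ m = 1"
proof -
  have "euler_defect P \<noteq> 0" using assms quadratic_ode_of_euler_defect by blast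
  then obtain j where j: "coeff (euler_defect P) j \<noteq> 0" by (auto simp: poly_eq_iff)
  then have "j \<noteq> degree P" "coeff P j \<noteq> 0" by (auto simp: coeff_euler_defect)
  then have jn: "j < degree P" using le_degree[of P j] by simp
  show thesis
  proof (rule that[of "degree P - j"])
    show "\<epsilon> ^ (degree P - j) = 1" if "symmetry P \<epsilon>" for \<epsilon>
      using that \<open>coeff P j \<noteq> 0\<close> jn by (simp add: symmetry_def power_diff)
  qed (use jn in simp)
qed

text \<open>From the second iterate on, every affine symmetry of an iterate is a symmetry of \<open>P\<close>; for \<open>P\<close> itself this may
  fail, as \<open>z ^ n + b\<close> shows.\<close>

lemma symmetry_of_poly_iter:
  assumes P: "centered P" "2 \<le> degree P" and k: "2 \<le> k" and \<epsilon>: "\<epsilon> \<noteq> 0" and \<nu>: "degree \<nu> = 1"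
    and eq: "poly_iter P k \<circ>\<^sub>p [:0, \<epsilon>:] = \<nu> \<circ>\<^sub>p poly_iter P k"
  shows "symmetry P \<epsilon>"
proof -
  define I where "I = poly_iter P (k - 1)"
  have dI: "2 \<le> degree I" using P k self_le_power[of "degree P" "k - 1"] by (simp add: I_def degree_poly_iter)
  have Ic: "centered I" unfolding I_def using P k by (intro centered_poly_iter) auto
  have PI: "poly_iter P k = I \<circ>\<^sub>p P" using k poly_iter_Suc2[of P "k - 1"] by (simp add: I_def)
  have "I \<circ>\<^sub>p (P \<circ>\<^sub>p [:0, \<epsilon>:]) = (\<nu> \<circ>\<^sub>p I) \<circ>\<^sub>p P" using eq unfolding PI by (simp only: pcompose_assoc)
  moreover have "0 < degree I" "0 < degree (P \<circ>\<^sub>p [:0, \<epsilon>:])" "0 < degree P" "degree I = degree (\<nu> \<circ>\<^sub>p I)"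
    using P \<epsilon> dI \<nu> by (simp_all add: degree_pcompose)
  ultimately obtain W where W: "degree W = 1" "P \<circ>\<^sub>p [:0, \<epsilon>:] = W \<circ>\<^sub>p P" "\<nu> \<circ>\<^sub>p I = I \<circ>\<^sub>p W"
    by (rule equal_degree_decomposition)
  obtain w t where w: "W = [:t, w:]" "w \<noteq> 0" using W(1) by (rule degree_1_E)
  \<comment> \<open>The centered outer factor \<open>I\<close> forces the affine map
    \<open>W\<close> to be a rotation; this is where the second iterate is needed.\<close>
  have "centered (\<nu> \<circ>\<^sub>p I)" using Ic dI \<nu> by (subst centered_pcompose) auto
  then have "t = 0" using centered_pcompose_linear[OF dI Ic w(2)] W(3) w by simp
  moreover have "P \<noteq> 0" using P by auto
  ultimately show ?thesis using symmetryI[OF \<epsilon>, of P w] W(2) w by simp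
qed

text \<open>The powers of \<open>n\<close> modulo \<open>m\<close> are eventually periodic, and a
  finite cyclic semigroup contains an idempotent.\<close>

lemma ex_idempotent_power:
  fixes n m :: nat
  assumes "1 \<le> m"
  obtains k where "2 \<le> k" "n ^ k * n ^ k mod m = n ^ k mod m"
proof -
  have "\<not> inj (\<lambda>i. n ^ i mod m)"
  proof
    assume "inj (\<lambda>i. n ^ i mod m)"
    then have "infinite (range (\<lambda>i. n ^ i mod m))" by (simp add: finite_image_iff)
    moreover have "range (\<lambda>i. n ^ i mod m) \<subseteq> {..<m}" using assms by auto
    ultimately show False using finite_subset by blast
  qed
  then obtain a b where "a \<noteq> b" "n ^ a mod m = n ^ b mod m" by (auto simp: inj_def)
  then obtain i j where ij: "i < j" "n ^ i mod m = n ^ j mod m" by (metis linorder_neqE_nat)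
  define p where "p = j - i"
  have p: "0 < p" "j = i + p" using ij by (auto simp: p_def)
  have step: "n ^ (l + p) mod m = n ^ l mod m" if "i \<le> l" for l
  proof -
    have "n ^ (l + p) mod m = (n ^ j mod m) * n ^ (l - i) mod m"
      using that p by (simp add: mod_mult_left_eq add.commute flip: power_add)
    also have "\<dots> = n ^ l mod m"
      using that by (simp add: mod_mult_left_eq flip: power_add ij(2))
    finally show ?thesis .
  qed
  have steps: "n ^ (l + t * p) mod m = n ^ l mod m" if "i \<le> l" for l t
  proof (induction t)
    case (Suc t)
    have "n ^ (l + Suc t * p) mod m = n ^ (l + t * p + p) mod m" by (simp add: algebra_simps)
    also have "\<dots> = n ^ (l + t * p) mod m" using that by (intro step) simp
    finally show ?case using Suc by simp
  qed simp
  \<comment> \<open>A multiple of the period \<open>p\<close> that lies beyond the preperiod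
    \<open>i\<close> and is at least 2.\<close>
  define k where "k = (i + 2) * p"
  have "(i + 2) * 1 \<le> (i + 2) * p" using p by (intro mult_le_mono2) simp
  then have "i + 2 \<le> k" by (simp only: k_def mult_1_right)
  then have "n ^ (k + (i + 2) * p) mod m = n ^ k mod m" by (intro steps) simp
  then have "n ^ k * n ^ k mod m = n ^ k mod m" unfolding k_def[symmetric] power_add .
  show thesis by (rule that[OF _ \<open>n ^ k * n ^ k mod m = n ^ k mod m\<close>]) (use \<open>i + 2 \<le> k\<close> in linarith)
qed

lemma power_mod_order:
  fixes \<epsilon> :: complex
  assumes "\<epsilon> ^ m = 1" "a mod m = b mod m"
  shows "\<epsilon> ^ a = \<epsilon> ^ b"
proof -
  have "\<epsilon> ^ a = \<epsilon> ^ (a mod m)" for a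
  proof -
    have "\<epsilon> ^ a = \<epsilon> ^ (m * (a div m) + a mod m)" by simp
    then show ?thesis by (simp only: power_add power_mult assms(1) power_one mult_1)
  qed
  then show ?thesis using assms(2) by metis
qed

text \<open>The twists \<open>W\<close> are rotations by symmetries \<open>\<eta>\<close> of \<open>P\<close>. For an iterate of \<open>P\<close> whose degree \<open>N\<close> acts idempotently on
  the symmetries, \<open>\<eta>\<close> may be replaced by \<open>\<eta> ^ N\<close>, which is fixed by the action, and then dies after \<open>m\<close> steps.\<close>

lemma uniform_commuting_iterate_centered:
  assumes P: "centered P" "2 \<le> degree P" and ns: "\<not> quadratic_ode P"
  obtains K where "1 \<le> K"
    "\<And>A. 2 \<le> degree A \<Longrightarrow> (\<And>k. \<exists>W. degree W = 1 \<and> A \<circ>\<^sub>p poly_iter P k = poly_iter P k \<circ>\<^sub>p A \<circ>\<^sub>p W)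
      \<Longrightarrow> A \<circ>\<^sub>p poly_iter P K = poly_iter P K \<circ>\<^sub>p A"
proof -
  define n where "n = degree P"
  obtain m where m: "1 \<le> m" "\<And>\<epsilon>. symmetry P \<epsilon> \<Longrightarrow> \<epsilon> ^ m = 1" using symmetry_finite_order[OF ns] by blast
  obtain k where k: "2 \<le> k" "n ^ k * n ^ k mod m = n ^ k mod m" using ex_idempotent_power[OF m(1)] by blast
  define B where "B = poly_iter P k"
  define N where "N = n ^ k"
  have idem: "\<epsilon> ^ (N * N) = \<epsilon> ^ N" if "symmetry P \<epsilon>" for \<epsilon>
    using power_mod_order[OF m(2)[OF that] k(2)] by (simp add: N_def)
  have B2: "2 \<le> degree B" using P k self_le_power[of "degree P" k] by (simp add: B_def degree_poly_iter)
  then have B0: "0 < degree B" by simp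
  have Bc: "centered B" unfolding B_def using P k by (intro centered_poly_iter) auto
  have Bsym: "B \<circ>\<^sub>p [:0, \<epsilon>:] = [:0, \<epsilon> ^ N:] \<circ>\<^sub>p B" if "symmetry P \<epsilon>" for \<epsilon>
    using symmetry_poly_iter[OF that, of k] by (simp only: B_def N_def n_def)
  have symB: "symmetry P \<epsilon>" if "\<epsilon> \<noteq> 0" "degree \<nu> = 1" "B \<circ>\<^sub>p [:0, \<epsilon>:] = \<nu> \<circ>\<^sub>p B" for \<epsilon> \<nu>
    using symmetry_of_poly_iter[OF P k(1) that(1,2)] that(3) by (simp add: B_def)
  show thesis
  proof (rule that[of "k * m"])
    show "1 \<le> k * m" using k m by simp
    fix A
    assume A2: "2 \<le> degree A" and W: "\<And>k. \<exists>W. degree W = 1 \<and> A \<circ>\<^sub>p poly_iter P k = poly_iter P k \<circ>\<^sub>p A \<circ>\<^sub>p W"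
    obtain c where c: "\<And>t w. w \<noteq> 0 \<Longrightarrow> centered (A \<circ>\<^sub>p [:t, w:]) \<longleftrightarrow> t = c" using ex_shift_centered[OF A2] by blast
    define A0 where "A0 = A \<circ>\<^sub>p [:c, 1:]"
    have A0c: "centered A0" unfolding A0_def using c[of 1 c] by simp
    have A02: "2 \<le> degree A0" using A2 by (simp add: A0_def degree_pcompose)
    \<comment> \<open>Against a centered \<open>D\<close>, the translation part of every twist is
      the same \<open>c\<close>, which is absorbed into \<open>A0\<close>; only a rotation
      remains.\<close>
    have twist: "\<exists>w. w \<noteq> 0 \<and> A \<circ>\<^sub>p D = D \<circ>\<^sub>p A0 \<circ>\<^sub>p [:0, w:]"
      if D: "centered D" "2 \<le> degree D" and W: "degree W = 1" "A \<circ>\<^sub>p D = D \<circ>\<^sub>p A \<circ>\<^sub>p W" for D W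
    proof -
      obtain w t where w: "W = [:t, w:]" "w \<noteq> 0" using W(1) by (rule degree_1_E)
      have "centered (A \<circ>\<^sub>p D)" using A2 D by (subst centered_pcompose) auto
      then have "centered (D \<circ>\<^sub>p (A \<circ>\<^sub>p W))" using W(2) by (simp add: pcompose_assoc)
      then have "centered (A \<circ>\<^sub>p W)" using D A2 W(1) by (subst (asm) centered_pcompose) (auto simp: degree_pcompose)
      then have "t = c" using c w by simp
      then have "W = [:c, 1:] \<circ>\<^sub>p [:0, w:]" by (simp add: w pcompose_pCons)
      then show ?thesis using W(2) w(2) by (auto simp: A0_def pcompose_assoc)
    qed
    obtain W1 where "degree W1 = 1" "A \<circ>\<^sub>p B = B \<circ>\<^sub>p A \<circ>\<^sub>p W1" using W[of k] by (auto simp: B_def)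
    then obtain w1 where w1: "w1 \<noteq> 0" "A \<circ>\<^sub>p B = B \<circ>\<^sub>p A0 \<circ>\<^sub>p [:0, w1:]" using twist[OF Bc B2] by blast
    have BB: "B \<circ>\<^sub>p B = poly_iter P (k + k)" by (simp add: B_def poly_iter_add)
    obtain W2 where W2: "degree W2 = 1" "A \<circ>\<^sub>p (B \<circ>\<^sub>p B) = (B \<circ>\<^sub>p B) \<circ>\<^sub>p A \<circ>\<^sub>p W2" using W[of "k + k"] by (auto simp: BB)
    have "centered (B \<circ>\<^sub>p B)" "2 \<le> degree (B \<circ>\<^sub>p B)"
      using Bc B2 by (auto simp: centered_pcompose degree_pcompose intro: order.trans[OF _ le_square])
    from twist[OF this W2] obtain w2 where w2: "w2 \<noteq> 0" "A \<circ>\<^sub>p (B \<circ>\<^sub>p B) = (B \<circ>\<^sub>p B) \<circ>\<^sub>p A0 \<circ>\<^sub>p [:0, w2:]" by blast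
    \<comment> \<open>Both \<open>B \<circ>\<^sub>p X\<close> and \<open>B \<circ>\<^sub>p Y\<close>
      equal \<open>A \<circ>\<^sub>p (B \<circ>\<^sub>p B)\<close>, computed with the twist of
      \<open>B\<close> and with that of \<open>B \<circ>\<^sub>p B\<close>. Hence \<open>X\<close>
      and \<open>Y\<close> differ by a \<open>V\<close> with
      \<open>B = B \<circ>\<^sub>p V\<close>.\<close>
    define X Y where "X = A0 \<circ>\<^sub>p [:0, w1:] \<circ>\<^sub>p B" and "Y = B \<circ>\<^sub>p A0 \<circ>\<^sub>p [:0, w2:]"
    have "B \<circ>\<^sub>p X = (A \<circ>\<^sub>p B) \<circ>\<^sub>p B" unfolding w1(2) X_def by (simp only: pcompose_assoc)
    also have "\<dots> = B \<circ>\<^sub>p Y" using w2(2) unfolding Y_def by (simp only: pcompose_assoc)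
    finally have BXY: "B \<circ>\<^sub>p X = B \<circ>\<^sub>p Y" .
    have dXY: "0 < degree X" "0 < degree Y"
      unfolding X_def Y_def using A02 B2 w1(1) w2(1) by (simp_all add: degree_pcompose)
    obtain V where V: "degree V = 1" "X = V \<circ>\<^sub>p Y" "B = B \<circ>\<^sub>p V"
      by (rule equal_degree_decomposition[OF BXY B0 dXY refl])
    obtain \<omega> t where \<omega>: "V = [:t, \<omega>:]" "\<omega> \<noteq> 0" using V(1) by (rule degree_1_E)
    define \<epsilon> where "\<epsilon> = w1 / w2"
    have \<epsilon>: "\<epsilon> \<noteq> 0" "[:0, w2:] \<circ>\<^sub>p [:0, \<epsilon>:] = [:0, w1:]" using w1 w2 by (simp_all add: \<epsilon>_def rotation_rotation)
    have e1: "(A0 \<circ>\<^sub>p [:0, w1:]) \<circ>\<^sub>p (B \<circ>\<^sub>p [:0, \<epsilon>:]) = (V \<circ>\<^sub>p A) \<circ>\<^sub>p B"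
    proof -
      have "(A0 \<circ>\<^sub>p [:0, w1:]) \<circ>\<^sub>p (B \<circ>\<^sub>p [:0, \<epsilon>:]) = X \<circ>\<^sub>p [:0, \<epsilon>:]" by (simp only: X_def pcompose_assoc)
      also have "\<dots> = V \<circ>\<^sub>p (B \<circ>\<^sub>p A0 \<circ>\<^sub>p ([:0, w2:] \<circ>\<^sub>p [:0, \<epsilon>:]))" by (simp only: V(2) Y_def pcompose_assoc)
      also have "\<dots> = V \<circ>\<^sub>p (A \<circ>\<^sub>p B)" by (simp only: \<epsilon>(2) w1(2))
      finally show ?thesis by (simp only: pcompose_assoc)
    qed
    have dA0: "degree A0 = degree A" by (simp add: A0_def degree_pcompose)
    have d1: "0 < degree (A0 \<circ>\<^sub>p [:0, w1:])" "0 < degree (B \<circ>\<^sub>p [:0, \<epsilon>:])"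
      "degree (A0 \<circ>\<^sub>p [:0, w1:]) = degree (V \<circ>\<^sub>p A)"
      using B0 \<epsilon>(1) A2 w1(1) V(1) by (simp_all add: degree_pcompose dA0)
    obtain U where U: "degree U = 1" "B \<circ>\<^sub>p [:0, \<epsilon>:] = U \<circ>\<^sub>p B" "V \<circ>\<^sub>p A = A0 \<circ>\<^sub>p [:0, w1:] \<circ>\<^sub>p U"
      by (rule equal_degree_decomposition[OF e1 d1(1,2) B0 d1(3)])
    have sym: "symmetry P \<epsilon>" by (rule symB[OF \<epsilon>(1) U(1,2)])
    have "U = [:0, \<epsilon> ^ N:]" using U(2) Bsym[OF sym] pcompose_right_cancel[OF _ B0] by metis
    with U(3) have e2: "V \<circ>\<^sub>p A = A0 \<circ>\<^sub>p [:0, w1 * \<epsilon> ^ N:]"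
      by (simp add: rotation_rotation flip: pcompose_assoc)
    \<comment> \<open>By \<open>e2\<close> the composition \<open>V \<circ>\<^sub>p A\<close> is
      centered, so \<open>A\<close> is centered itself and \<open>c = 0\<close>.\<close>
    have "centered (A0 \<circ>\<^sub>p [:0, w1 * \<epsilon> ^ N:])"
      using A0c A02 w1 \<epsilon> by (subst centered_pcompose_rotation) auto
    then have "centered (V \<circ>\<^sub>p A)" by (simp only: e2)
    then have "centered A" using V(1) A2 by (subst (asm) centered_pcompose) auto
    then have "c = 0" using c[of 1 0] by simp
    then have A0: "A0 = A" by (simp add: A0_def)
    define \<eta> where "\<eta> = 1 / \<epsilon> ^ N"
    have \<eta>: "symmetry P \<eta>" unfolding \<eta>_def by (intro symmetry_inverse symmetry_power sym)
    have "A \<circ>\<^sub>p [:0, w1:] = A0 \<circ>\<^sub>p [:0, w1 * \<epsilon> ^ N:] \<circ>\<^sub>p [:0, \<eta>:]"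
      using \<epsilon>(1) by (simp add: A0 \<eta>_def rotation_rotation flip: pcompose_assoc)
    also have "\<dots> = V \<circ>\<^sub>p A \<circ>\<^sub>p [:0, \<eta>:]" by (simp only: e2)
    finally have "A \<circ>\<^sub>p B = B \<circ>\<^sub>p (V \<circ>\<^sub>p A \<circ>\<^sub>p [:0, \<eta>:])" using w1(2) by (simp add: A0 flip: pcompose_assoc)
    also have "\<dots> = (B \<circ>\<^sub>p V) \<circ>\<^sub>p A \<circ>\<^sub>p [:0, \<eta>:]" by (simp only: pcompose_assoc)
    finally have e3: "A \<circ>\<^sub>p B = B \<circ>\<^sub>p A \<circ>\<^sub>p [:0, \<eta>:]" by (simp only: V(3)[symmetric])
    have \<eta>0: "\<eta> \<noteq> 0" using \<eta> by (simp add: symmetry_def)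
    define \<eta>2 where "\<eta>2 = \<eta> ^ N"
    define \<eta>1 where "\<eta>1 = \<eta> * (1 / \<eta>2)"
    have s12: "symmetry P \<eta>2" "symmetry P \<eta>1"
      unfolding \<eta>1_def \<eta>2_def by (intro symmetry_mult symmetry_inverse symmetry_power \<eta>)+
    have "\<eta>1 ^ N = 1" using idem[OF \<eta>] \<eta>0 by (simp add: \<eta>1_def \<eta>2_def power_divide power_mult)
    then have B1: "B \<circ>\<^sub>p [:0, \<eta>1:] = B" using Bsym[OF s12(2)] by (simp add: rotation_pcompose)
    have \<eta>2N: "\<eta>2 ^ N = \<eta>2" using idem[OF \<eta>] by (simp add: \<eta>2_def power_mult)
    have \<eta>12: "[:0, \<eta>:] = [:0, \<eta>1:] \<circ>\<^sub>p [:0, \<eta>2:]" "[:0, \<eta>:] = [:0, \<eta>2:] \<circ>\<^sub>p [:0, \<eta>1:]"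
      using \<eta>0 by (simp_all add: \<eta>1_def \<eta>2_def rotation_rotation)
    have e4: "A \<circ>\<^sub>p B = B \<circ>\<^sub>p A \<circ>\<^sub>p [:0, \<eta>2:]"
    proof -
      have "B \<circ>\<^sub>p A \<circ>\<^sub>p [:0, \<eta>2:] \<circ>\<^sub>p [:0, \<eta>1:] = A \<circ>\<^sub>p (B \<circ>\<^sub>p [:0, \<eta>1:])"
        unfolding B1 e3 \<eta>12(2) by (simp only: pcompose_assoc)
      also have "\<dots> = B \<circ>\<^sub>p A \<circ>\<^sub>p [:0, \<eta>2:] \<circ>\<^sub>p [:0, \<eta>1:] \<circ>\<^sub>p [:0, \<eta>1:]"
        using e3 unfolding \<eta>12(2) by (simp only: pcompose_assoc)
      finally have "B \<circ>\<^sub>p A \<circ>\<^sub>p [:0, \<eta>2:] = B \<circ>\<^sub>p A \<circ>\<^sub>p [:0, \<eta>2:] \<circ>\<^sub>p [:0, \<eta>1:]"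
        by (rule pcompose_right_cancel) (use \<eta>0 in \<open>simp add: \<eta>1_def \<eta>2_def\<close>)
      also have "\<dots> = A \<circ>\<^sub>p B" unfolding e3 \<eta>12(2) by (simp only: pcompose_assoc)
      finally show ?thesis by simp
    qed
    \<comment> \<open>Since \<open>\<eta>2 ^ N = \<eta>2\<close>, this rotation commutes with
      \<open>B\<close>, and its powers accumulate until they reach
      \<open>\<eta>2 ^ m = 1\<close>.\<close>
    have "A \<circ>\<^sub>p poly_iter B j = poly_iter B j \<circ>\<^sub>p A \<circ>\<^sub>p [:0, \<eta>2 ^ j:]" for j
    proof (induction j)
      case (Suc j)
      have r: "[:0, \<eta>2 ^ j:] \<circ>\<^sub>p B = B \<circ>\<^sub>p [:0, \<eta>2 ^ j:]"
        using Bsym[OF symmetry_power[OF s12(1), of j]] \<eta>2N by (simp only: power_mult[symmetric] mult.commute[of j N])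
          (simp only: power_mult)
      have "A \<circ>\<^sub>p poly_iter B (Suc j) = (A \<circ>\<^sub>p poly_iter B j) \<circ>\<^sub>p B" by (simp only: poly_iter_Suc2 pcompose_assoc)
      also have "\<dots> = poly_iter B j \<circ>\<^sub>p A \<circ>\<^sub>p ([:0, \<eta>2 ^ j:] \<circ>\<^sub>p B)" by (simp only: Suc pcompose_assoc)
      also have "\<dots> = poly_iter B j \<circ>\<^sub>p (A \<circ>\<^sub>p B) \<circ>\<^sub>p [:0, \<eta>2 ^ j:]" by (simp only: r pcompose_assoc)
      also have "\<dots> = (poly_iter B j \<circ>\<^sub>p B) \<circ>\<^sub>p A \<circ>\<^sub>p ([:0, \<eta>2:] \<circ>\<^sub>p [:0, \<eta>2 ^ j:])" by (simp only: e4 pcompose_assoc)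
      finally show ?case by (simp only: poly_iter_Suc2 rotation_rotation power_Suc)
    qed simp
    from this[of m] show "A \<circ>\<^sub>p poly_iter P (k * m) = poly_iter P (k * m) \<circ>\<^sub>p A"
      using m(2)[OF s12(1)] by (simp add: poly_iter_mult B_def)
  qed
qed

lemma shift_conj_quadratic_ode: "quadratic_ode (shift_conj s P) \<longleftrightarrow> quadratic_ode P"
proof -
  have *: "quadratic_ode P" if "quadratic_ode (shift_conj s P)" for s P
  proof -
    have "shift_conj s P \<circ>\<^sub>p [:- s, 1:] = [:- s, 1:] \<circ>\<^sub>p P \<circ>\<^sub>p ([:s, 1:] \<circ>\<^sub>p [:- s, 1:])"
      unfolding shift_conj_def by (simp only: pcompose_assoc)
    then have "[:- s, 1:] \<circ>\<^sub>p P = shift_conj s P \<circ>\<^sub>p [:- s, 1:]" by simp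
    then show ?thesis using quadratic_ode_conj[of "[:- s, 1:]" P "shift_conj s P"] that by simp
  qed
  then show ?thesis using *[of "- s" "shift_conj s P"] by auto
qed

lemma uniform_commuting_iterate:
  assumes P: "2 \<le> degree P" and ns: "\<not> quadratic_ode P"
  obtains K where "1 \<le> K"
    "\<And>A. 2 \<le> degree A \<Longrightarrow> (\<And>k. \<exists>W. degree W = 1 \<and> A \<circ>\<^sub>p poly_iter P k = poly_iter P k \<circ>\<^sub>p A \<circ>\<^sub>p W)
      \<Longrightarrow> A \<circ>\<^sub>p poly_iter P K = poly_iter P K \<circ>\<^sub>p A"
proof -
  obtain s where s: "centered (shift_conj s P)" using ex_centered_conj[OF P] .
  have "2 \<le> degree (shift_conj s P)" "\<not> quadratic_ode (shift_conj s P)"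
    using P ns by (simp_all add: shift_conj_quadratic_ode)
  then obtain K where K: "1 \<le> K" "\<And>A. 2 \<le> degree A \<Longrightarrow>
      (\<And>k. \<exists>W. degree W = 1 \<and> A \<circ>\<^sub>p poly_iter (shift_conj s P) k = poly_iter (shift_conj s P) k \<circ>\<^sub>p A \<circ>\<^sub>p W)
      \<Longrightarrow> A \<circ>\<^sub>p poly_iter (shift_conj s P) K = poly_iter (shift_conj s P) K \<circ>\<^sub>p A"
    using uniform_commuting_iterate_centered[OF s] by blast
  show thesis
  proof (rule that[OF K(1)])
    fix A assume A: "2 \<le> degree A" "\<And>k. \<exists>W. degree W = 1 \<and> A \<circ>\<^sub>p poly_iter P k = poly_iter P k \<circ>\<^sub>p A \<circ>\<^sub>p W"
    have "shift_conj s A \<circ>\<^sub>p poly_iter (shift_conj s P) K = poly_iter (shift_conj s P) K \<circ>\<^sub>p shift_conj s A"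
    proof (rule K(2))
      fix k
      obtain W where "degree W = 1" "A \<circ>\<^sub>p poly_iter P k = poly_iter P k \<circ>\<^sub>p A \<circ>\<^sub>p W" using A(2) by blast
      then show "\<exists>W. degree W = 1 \<and> shift_conj s A \<circ>\<^sub>p poly_iter (shift_conj s P) k
          = poly_iter (shift_conj s P) k \<circ>\<^sub>p shift_conj s A \<circ>\<^sub>p W"
        by (intro exI[of _ "shift_conj s W"]) (simp flip: shift_conj_poly_iter shift_conj_pcompose)
    qed (use A in simp)
    then have "shift_conj s (A \<circ>\<^sub>p poly_iter P K) = shift_conj s (poly_iter P K \<circ>\<^sub>p A)"
      by (simp add: shift_conj_pcompose shift_conj_poly_iter)
    then show "A \<circ>\<^sub>p poly_iter P K = poly_iter P K \<circ>\<^sub>p A" by (simp add: shift_conj_inject)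
  qed
qed

section \<open>From left reversibility to a centralizer\<close>

lemma poly_iter_mem:
  assumes "poly_semigroup S" "A \<in> S" "1 \<le> k"
  shows "poly_iter A k \<in> S"
  using assms(3)
proof (induction k rule: dec_induct)
  case (step k)
  then show ?case using assms by (simp add: poly_iter_Suc poly_semigroup_def)
qed (use assms in simp)

theorem left_reversible_imp_centralized:
  assumes S: "poly_semigroup S" and P: "P \<in> S" "2 \<le> degree P" "\<not> quadratic_ode P" and rev: "left_reversible pcompose S"
  obtains Q where "2 \<le> degree Q" "\<not> quadratic_ode Q" "\<And>A. A \<in> S \<Longrightarrow> A \<circ>\<^sub>p Q = Q \<circ>\<^sub>p A"
proof -
  have pos: "0 < degree A" if "A \<in> S" for A using S that by (simp add: poly_semigroup_def)
  have mem: "A \<circ>\<^sub>p B \<in> S" if "A \<in> S" "B \<in> S" for A B using S that by (simp add: poly_semigroup_def)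
  obtain K where K: "1 \<le> K" "\<And>A. 2 \<le> degree A \<Longrightarrow>
      (\<And>k. \<exists>W. degree W = 1 \<and> A \<circ>\<^sub>p poly_iter P k = poly_iter P k \<circ>\<^sub>p A \<circ>\<^sub>p W)
      \<Longrightarrow> A \<circ>\<^sub>p poly_iter P K = poly_iter P K \<circ>\<^sub>p A"
    using uniform_commuting_iterate[OF P(2,3)] by blast
  define Q where "Q = poly_iter P K"
  have comm2: "A \<circ>\<^sub>p Q = Q \<circ>\<^sub>p A" if A: "A \<in> S" "2 \<le> degree A" for A
    unfolding Q_def
  proof (rule K(2)[OF A(2)])
    fix k
    show "\<exists>W. degree W = 1 \<and> A \<circ>\<^sub>p poly_iter P k = poly_iter P k \<circ>\<^sub>p A \<circ>\<^sub>p W"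
    proof (cases "k = 0")
      case False
      define I where "I = poly_iter P k"
      have I: "I \<in> S" unfolding I_def using False by (intro poly_iter_mem S P) simp
      \<comment> \<open>\<open>I \<circ>\<^sub>p A\<close> and \<open>A \<circ>\<^sub>p I\<close>
        have equal degrees, so a common right multiple yields the affine twist.\<close>
      obtain X Y where XY: "X \<in> S" "Y \<in> S" "(I \<circ>\<^sub>p A) \<circ>\<^sub>p X = (A \<circ>\<^sub>p I) \<circ>\<^sub>p Y"
        using rev mem[OF I A(1)] mem[OF A(1) I] unfolding left_reversible_def by blast
      obtain W where "degree W = 1" "A \<circ>\<^sub>p I = (I \<circ>\<^sub>p A) \<circ>\<^sub>p W"
        by (rule equal_degree_decomposition[OF XY(3)]) (use pos mem I A XY in \<open>auto simp: degree_pcompose\<close>)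
      then show ?thesis unfolding I_def by blast
    qed (intro exI[of _ "[:0, 1:]"], simp)
  qed
  have Q2: "2 \<le> degree Q" using P K self_le_power[of "degree P" K] by (simp add: Q_def degree_poly_iter)
  show thesis
  proof (rule that[OF Q2])
    show "\<not> quadratic_ode Q" using quadratic_ode_of_poly_iter[OF _ K(1) P(2)] P(3) by (auto simp: Q_def)
    fix A assume A: "A \<in> S"
    \<comment> \<open>Affine elements are reached through \<open>A \<circ>\<^sub>p P\<close>, from
      which \<open>P\<close> cancels on the right.\<close>
    have AP: "2 \<le> degree (A \<circ>\<^sub>p P)" using pos[OF A] P(2) by (simp add: degree_pcompose Suc_leI order.trans[OF P(2)])
    have "A \<circ>\<^sub>p Q \<circ>\<^sub>p P = A \<circ>\<^sub>p (P \<circ>\<^sub>p Q)" using comm2[OF P(1,2)] by (simp add: pcompose_assoc)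
    also have "\<dots> = (A \<circ>\<^sub>p P) \<circ>\<^sub>p Q" by (simp add: pcompose_assoc)
    also have "\<dots> = Q \<circ>\<^sub>p A \<circ>\<^sub>p P" using comm2[OF mem[OF A P(1)] AP] by (simp add: pcompose_assoc)
    finally show "A \<circ>\<^sub>p Q = Q \<circ>\<^sub>p A" using pos[OF P(1)] by (rule pcompose_right_cancel)
  qed
qed

section \<open>Amenability of semigroups inside a centralizer\<close>

lemma degree_dependent:
  assumes "A \<circ>\<^sub>p P = P \<circ>\<^sub>p A" "2 \<le> degree P" "\<not> quadratic_ode P" "0 < degree A"
  obtains i j where "1 \<le> i" "degree A ^ i = degree P ^ j"
proof (cases "degree A = 1")
  case True
  then show ?thesis using that[of 1 0] by simp
next
  case False
  with assms have "2 \<le> degree A" by linarith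
  then obtain i j where "1 \<le> i" "poly_iter A i = poly_iter P j"
    using commuting_common_iterate[OF assms(1,2) _ assms(3)] by blast
  then show ?thesis using that by (metis degree_poly_iter)
qed

lemma power_degree_fixed:
  fixes \<epsilon> :: complex
  assumes "\<epsilon> ^ (n - 1) = 1" "1 \<le> n"
  shows "\<epsilon> ^ (n ^ j) = \<epsilon>"
proof (induction j)
  case (Suc j)
  have "\<epsilon> ^ n = \<epsilon> ^ (n - 1) * \<epsilon>" using assms(2) by (metis One_nat_def Suc_pred less_eq_Suc_le power_Suc2)
  then show ?case using Suc assms(1) by (simp add: power_mult)
qed simp

text \<open>The order of the ratio \<rho> of leading coefficients divides both
  \<open>a = degree A\<close> and \<open>n - 1\<close>. Some power of \<open>a\<close> is a power of
  \<open>n\<close>, and \<open>n\<close> is 1 modulo \<open>n - 1\<close>, so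
  \<open>\<rho> = 1\<close> and \<open>commute_unique\<close> applies.\<close>

lemma commuting_left_cancel:
  assumes P: "2 \<le> degree P" "\<not> quadratic_ode P"
    and comm: "A \<circ>\<^sub>p P = P \<circ>\<^sub>p A" "X \<circ>\<^sub>p P = P \<circ>\<^sub>p X" "Y \<circ>\<^sub>p P = P \<circ>\<^sub>p Y"
    and pos: "0 < degree A" "0 < degree X" "0 < degree Y" and eq: "A \<circ>\<^sub>p X = A \<circ>\<^sub>p Y"
  shows "X = Y"
proof -
  define n a where "n = degree P" and "a = degree A"
  obtain i j where ij: "1 \<le> i" "a ^ i = n ^ j"
    using degree_dependent[OF comm(1) P pos(1)] unfolding n_def a_def by metis
  have deg: "degree X = degree Y"
    using arg_cong[OF eq, of degree] pos by (simp add: degree_pcompose)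
  have nz: "lead_coeff A \<noteq> 0" "lead_coeff X \<noteq> 0" "lead_coeff Y \<noteq> 0" using pos by auto
  define \<rho> where "\<rho> = lead_coeff X / lead_coeff Y"
  have "lead_coeff X ^ a = lead_coeff Y ^ a"
    using arg_cong[OF eq, of lead_coeff] nz(1) unfolding lead_coeff_comp[OF pos(2)] lead_coeff_comp[OF pos(3)]
    by (simp add: a_def)
  then have \<rho>a: "\<rho> ^ a = 1" using nz by (simp add: \<rho>_def power_divide)
  have "lead_coeff X ^ (n - 1) = lead_coeff Y ^ (n - 1)"
    using commute_lead_coeff[OF comm(2) pos(2)] commute_lead_coeff[OF comm(3) pos(3)] P(1) deg by (simp add: n_def)
  then have "\<rho> ^ (n - 1) = 1" using nz by (simp add: \<rho>_def power_divide)
  then have "\<rho> = \<rho> ^ (n ^ j)" using power_degree_fixed[of \<rho> n j] P by (simp add: n_def)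
  also have "\<dots> = (\<rho> ^ a) ^ (a ^ (i - 1))" unfolding ij(2)[symmetric] power_mult[symmetric]
    using ij(1) by (simp flip: power_Suc)
  finally have "\<rho> = 1" by (simp add: \<rho>a)
  then have "lead_coeff X = lead_coeff Y" using nz by (simp add: \<rho>_def)
  then show ?thesis using commute_unique[OF comm(2,3) deg pos(2) P(1)] by simp
qed

text \<open>By \<open>commute_unique\<close> an element is determined by its leading coefficient, a
  root of an equation of degree \<open>degree P - 1\<close>.\<close>

lemma finite_commuting_degree:
  fixes P :: "complex poly"
  assumes P: "2 \<le> degree P" and d: "0 < d"
  shows "finite {A. A \<circ>\<^sub>p P = P \<circ>\<^sub>p A \<and> degree A = d} \<and> card {A. A \<circ>\<^sub>p P = P \<circ>\<^sub>p A \<and> degree A = d} \<le> degree P - 1"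
proof -
  define M where "M = {A. A \<circ>\<^sub>p P = P \<circ>\<^sub>p A \<and> degree A = d}"
  define Z where "Z = {z. z ^ (degree P - 1) = lead_coeff P ^ (d - 1)}"
  have "lead_coeff P \<noteq> 0" using P by auto
  then have Z: "finite Z" "card Z = degree P - 1"
    using P by (auto simp: Z_def finite_nth_roots card_nth_roots)
  have "inj_on lead_coeff M"
    by (rule inj_onI) (rule commute_unique[of _ P], use P d in \<open>auto simp: M_def\<close>)
  moreover have "lead_coeff ` M \<subseteq> Z"
    using commute_lead_coeff[of _ P] P d by (auto simp: M_def Z_def)
  ultimately show ?thesis using Z unfolding M_def[symmetric] by (metis card_inj_on_le inj_on_finite)
qed

theorem centralized_imp_amenable:
  assumes S: "poly_semigroup S" and big: "P0 \<in> S" "2 \<le> degree P0"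
    and P: "2 \<le> degree P" "\<not> quadratic_ode P" and comm: "\<And>A. A \<in> S \<Longrightarrow> A \<circ>\<^sub>p P = P \<circ>\<^sub>p A"
  shows "amenable pcompose S"
proof -
  have pos: "0 < degree A" if "A \<in> S" for A using S that by (simp add: poly_semigroup_def)
  define n where "n = degree P"
  have "n \<noteq> 1" using P by (simp add: n_def)
  then obtain p where p: "prime p" "p dvd n" using prime_factor_nat by blast
  have n0: "0 < n" using P by (simp add: n_def)
  define v where "v = multiplicity p"
  have v_power: "v (a ^ i) = i * v a" if "0 < a" for a i
    unfolding v_def using that p(1) by (intro prime_elem_multiplicity_power_distrib) auto
  have vn: "0 < v n" unfolding v_def using p n0 by (simp add: prime_multiplicity_gt_zero_iff)
  have dep: "\<exists>i j. 1 \<le> i \<and> degree A ^ i = n ^ j" if "A \<in> S" for A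
    using degree_dependent[OF comm[OF that] P pos[OF that]] unfolding n_def by metis
  \<comment> \<open>All degrees are multiplicatively dependent on \<open>n\<close>, so their
    logarithms are rational multiples of that of \<open>n\<close>, and one prime factor of
    \<open>n\<close> already separates them.\<close>
  have inj: "degree A = degree B" if AB: "A \<in> S" "B \<in> S" and v: "v (degree A) = v (degree B)" for A B
  proof -
    obtain i j where ij: "1 \<le> i" "degree A ^ i = n ^ j" using dep[OF AB(1)] by blast
    obtain i' j' where ij': "1 \<le> i'" "degree B ^ i' = n ^ j'" using dep[OF AB(2)] by blast
    have "i * v (degree A) = j * v n" using arg_cong[OF ij(2), of v] pos[OF AB(1)] n0 by (simp add: v_power)
    moreover have "i' * v (degree B) = j' * v n" using arg_cong[OF ij'(2), of v] pos[OF AB(2)] n0 by (simp add: v_power)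
    ultimately have "(j * i') * v n = (j' * i) * v n"
      using v by (metis mult.assoc mult.commute)
    then have "j * i' = j' * i" using vn by simp
    then have "(degree A ^ i) ^ i' = (degree B ^ i') ^ i"
      unfolding ij(2) ij'(2) power_mult[symmetric] by simp
    then have "degree A ^ (i * i') = degree B ^ (i * i')" by (simp add: mult.commute flip: power_mult)
    then show ?thesis using ij(1) ij'(1) by (intro power_eq_imp_eq_base[of "degree A" "i * i'" "degree B"]) auto
  qed
  show ?thesis
  proof (rule amenable_of_length[where l = "\<lambda>A. v (degree A)" and K = "n - 1" and b = P0])
    show "A \<circ>\<^sub>p B \<in> S" if "A \<in> S" "B \<in> S" for A B using S that by (simp add: poly_semigroup_def)
    show "v (degree (A \<circ>\<^sub>p B)) = v (degree A) + v (degree B)" if "A \<in> S" "B \<in> S" for A B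
      unfolding v_def degree_pcompose using p(1) pos that
      by (intro prime_elem_multiplicity_mult_distrib) auto
    have level: "finite {A \<in> S. v (degree A) = t} \<and> card {A \<in> S. v (degree A) = t} \<le> n - 1" for t
    proof (cases "{A \<in> S. v (degree A) = t} = {}")
      case False
      then obtain B where B: "B \<in> S" "v (degree B) = t" by blast
      have "{A \<in> S. v (degree A) = t} \<subseteq> {A. A \<circ>\<^sub>p P = P \<circ>\<^sub>p A \<and> degree A = degree B}"
        using comm inj[OF _ B(1)] B(2) by auto
      then show ?thesis using finite_commuting_degree[OF P(1) pos[OF B(1)]] unfolding n_def
        by (meson card_mono finite_subset le_trans)
    next
      case True
      then show ?thesis by (metis card.empty finite.emptyI le0)
    qed
    show "finite {A \<in> S. v (degree A) = t}" "card {A \<in> S. v (degree A) = t} \<le> n - 1" for t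
      using level by auto
    show "X = Y" if A: "A \<in> S" "X \<in> S" "Y \<in> S" "X \<circ>\<^sub>p A = Y \<circ>\<^sub>p A" for A X Y
      using A(4) pos[OF A(1)] by (rule pcompose_right_cancel)
    show "X = Y" if A: "A \<in> S" "X \<in> S" "Y \<in> S" "A \<circ>\<^sub>p X = A \<circ>\<^sub>p Y" for A X Y
      by (rule commuting_left_cancel[OF P comm[OF A(1)] comm[OF A(2)] comm[OF A(3)]])
        (use A pos in auto)
    show "P0 \<in> S" by (rule big)
    obtain i j where ij: "1 \<le> i" "degree P0 ^ i = n ^ j" using dep[OF big(1)] by blast
    have "1 < degree P0 ^ i" using one_less_power[of "degree P0" i] ij(1) big(2) by simp
    then have "j \<noteq> 0" unfolding ij(2) by (cases j) auto
    then have "0 < i * v (degree P0)"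
      using arg_cong[OF ij(2), of v] pos[OF big(1)] n0 vn by (simp add: v_power)
    then show "0 < v (degree P0)" by simp
  qed
qed

section \<open>Centralizers\<close>

text \<open>Left division inside the centralizer of \<open>P\<close>: the quotient \<open>W\<close> commutes with \<open>P\<close> up to a deck rotation \<open>\<kappa>\<close> of \<open>R\<close>
  of order prime to \<open>degree P - 1\<close>, which is absorbed into \<open>W\<close>.\<close>

lemma centralizer_left_division_centered:
  assumes P: "centered P" "2 \<le> degree P" "\<not> quadratic_ode P"
    and R: "R \<circ>\<^sub>p P = P \<circ>\<^sub>p R" "2 \<le> degree R" and A: "A \<circ>\<^sub>p P = P \<circ>\<^sub>p A" "0 < degree A"
    and dvd: "degree R dvd degree A"
  obtains W where "W \<circ>\<^sub>p P = P \<circ>\<^sub>p W" "0 < degree W" "A = R \<circ>\<^sub>p W"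
proof -
  define n where "n = degree P"
  obtain i j where ij: "1 \<le> i" "1 \<le> j" "poly_iter R i = poly_iter P j"
    using commuting_common_iterate[OF R(1) P(2) R(2) P(3)] by blast
  \<comment> \<open>Doubled because \<open>symmetry_of_poly_iter\<close> needs at least the second
    iterate.\<close>
  define j2 where "j2 = j * 2"
  have ij2: "poly_iter R (i * 2) = poly_iter P j2" by (simp add: j2_def poly_iter_mult ij)
  have Rc: "centered R" using commute_centered[OF R(1) P(2,1) R(2)] .
  have R0: "0 < degree R" using R by simp
  obtain i' where i': "i * 2 = Suc i'" using ij(1) by (cases "i * 2") auto
  have "A \<circ>\<^sub>p poly_iter P j2 = poly_iter P j2 \<circ>\<^sub>p A" using A(1) by (rule commute_poly_iter)
  also have "\<dots> = R \<circ>\<^sub>p (poly_iter R i' \<circ>\<^sub>p A)" by (simp add: i' poly_iter_Suc pcompose_assoc flip: ij2)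
  finally have "R \<circ>\<^sub>p (poly_iter R i' \<circ>\<^sub>p A) = A \<circ>\<^sub>p poly_iter P j2" by simp
  moreover have "0 < degree (poly_iter R i' \<circ>\<^sub>p A)" "0 < degree (poly_iter P j2)"
    using R0 A(2) P(2) by (simp_all add: degree_pcompose degree_poly_iter)
  ultimately obtain W where W: "A = R \<circ>\<^sub>p W"
    using left_divisor_of_decomposition[OF _ R0 _ _ dvd] by blast
  have W0: "0 < degree W" using A(2) by (auto simp: W degree_pcompose)
  have "R \<circ>\<^sub>p (P \<circ>\<^sub>p W) = (R \<circ>\<^sub>p P) \<circ>\<^sub>p W" by (simp only: pcompose_assoc)
  also have "\<dots> = P \<circ>\<^sub>p A" by (simp only: R(1) W pcompose_assoc)
  also have "\<dots> = R \<circ>\<^sub>p (W \<circ>\<^sub>p P)" unfolding A(1)[symmetric] by (simp only: W pcompose_assoc)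
  finally have RR: "R \<circ>\<^sub>p (P \<circ>\<^sub>p W) = R \<circ>\<^sub>p (W \<circ>\<^sub>p P)" .
  have d: "0 < degree (P \<circ>\<^sub>p W)" "0 < degree (W \<circ>\<^sub>p P)" using W0 P(2) by (simp_all add: degree_pcompose)
  obtain V where V: "degree V = 1" "P \<circ>\<^sub>p W = V \<circ>\<^sub>p (W \<circ>\<^sub>p P)" "R = R \<circ>\<^sub>p V"
    by (rule equal_degree_decomposition[OF RR R0 d refl])
  obtain \<kappa> t where \<kappa>: "V = [:t, \<kappa>:]" "\<kappa> \<noteq> 0" using V(1) by (rule degree_1_E)
  have "t = 0" using centered_pcompose_linear[OF R(2) Rc \<kappa>(2), of t] Rc V(3) \<kappa>(1) by simp
  with \<kappa> have V\<kappa>: "V = [:0, \<kappa>:]" by simp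
  have "poly_iter R (i * 2) \<circ>\<^sub>p V = poly_iter R i' \<circ>\<^sub>p (R \<circ>\<^sub>p V)" by (simp only: i' poly_iter_Suc2 pcompose_assoc)
  also have "\<dots> = poly_iter R (i * 2)" by (simp only: V(3)[symmetric] i' poly_iter_Suc2)
  finally have deck: "poly_iter P j2 \<circ>\<^sub>p [:0, \<kappa>:] = poly_iter P j2" by (simp only: ij2 V\<kappa>)
  have sym: "symmetry P \<kappa>"
    by (rule symmetry_of_poly_iter[OF P(1,2), of j2 _ "[:0, 1:]"]) (use ij(2) \<kappa>(2) deck in \<open>simp_all add: j2_def\<close>)
  have "\<kappa> ^ (n ^ j2) = 1"
  proof -
    have "smult (\<kappa> ^ (n ^ j2)) (poly_iter P j2) = smult 1 (poly_iter P j2)"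
      using symmetry_poly_iter[OF sym, of j2] deck by (simp add: n_def rotation_pcompose)
    moreover have "poly_iter P j2 \<noteq> 0" using P(2) degree_poly_iter[of P j2] by auto
    ultimately show ?thesis by (metis smult_eq_0_iff smult_diff_left right_minus_eq)
  qed
  \<comment> \<open>Solves \<open>\<epsilon> ^ (n - 1) * \<kappa> = 1\<close>: the exponent times
    \<open>n - 1\<close> is \<open>n ^ j2 - 1\<close>, and \<open>\<kappa> ^ (n ^ j2) = 1\<close>.
    Being a power of \<kappa>, the rotation leaves \<open>R\<close> unchanged.\<close>
  define \<epsilon> where "\<epsilon> = \<kappa> ^ (\<Sum>i<j2. n ^ i)"
  have "Suc ((n - 1) * (\<Sum>i<j2. n ^ i)) = n ^ j2"
  proof (induction j2)
    case (Suc k)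
    have "Suc ((n - 1) * (\<Sum>i<Suc k. n ^ i)) = Suc ((n - 1) * (\<Sum>i<k. n ^ i)) + (n - 1) * n ^ k"
      by (simp add: algebra_simps)
    also have "\<dots> = n ^ Suc k" using Suc P(2) by (cases n) (simp_all add: n_def)
    finally show ?case .
  qed simp
  then have \<epsilon>\<kappa>: "\<epsilon> ^ (n - 1) * \<kappa> = 1"
    using \<open>\<kappa> ^ (n ^ j2) = 1\<close> by (metis \<epsilon>_def mult.commute power_Suc2 power_mult)
  have \<epsilon>: "symmetry P \<epsilon>" unfolding \<epsilon>_def using sym by (rule symmetry_power)
  have R\<kappa>: "R \<circ>\<^sub>p [:0, \<kappa> ^ s:] = R" for s
  proof (induction s)
    case (Suc s)
    have "R \<circ>\<^sub>p [:0, \<kappa> ^ Suc s:] = R \<circ>\<^sub>p V \<circ>\<^sub>p [:0, \<kappa> ^ s:]"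
      by (simp add: V\<kappa> rotation_rotation flip: pcompose_assoc)
    then show ?case using Suc by (simp only: V(3)[symmetric])
  qed simp
  have \<epsilon>0: "\<epsilon> \<noteq> 0" using \<epsilon> by (simp add: symmetry_def)
  show thesis
  proof (rule that[of "[:0, \<epsilon>:] \<circ>\<^sub>p W"])
    have "P \<circ>\<^sub>p ([:0, \<epsilon>:] \<circ>\<^sub>p W) = (P \<circ>\<^sub>p [:0, \<epsilon>:]) \<circ>\<^sub>p W" by (simp only: pcompose_assoc)
    also have "\<dots> = [:0, \<epsilon> ^ n:] \<circ>\<^sub>p (P \<circ>\<^sub>p W)" by (simp only: symmetry_pcompose[OF \<epsilon>] n_def pcompose_assoc)
    also have "\<dots> = smult (\<epsilon> ^ n * \<kappa>) (W \<circ>\<^sub>p P)" by (simp add: V(2) V\<kappa> rotation_pcompose)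
    also have "\<epsilon> ^ n * \<kappa> = \<epsilon>" using \<epsilon>\<kappa> P(2) by (cases n) (simp_all add: n_def)
    also have "smult \<epsilon> (W \<circ>\<^sub>p P) = [:0, \<epsilon>:] \<circ>\<^sub>p W \<circ>\<^sub>p P" by (simp add: rotation_pcompose pcompose_smult)
    finally show "[:0, \<epsilon>:] \<circ>\<^sub>p W \<circ>\<^sub>p P = P \<circ>\<^sub>p ([:0, \<epsilon>:] \<circ>\<^sub>p W)" by simp
    show "0 < degree ([:0, \<epsilon>:] \<circ>\<^sub>p W)" using W0 \<epsilon>0 by (simp add: rotation_pcompose)
    have "R \<circ>\<^sub>p ([:0, \<epsilon>:] \<circ>\<^sub>p W) = (R \<circ>\<^sub>p [:0, \<epsilon>:]) \<circ>\<^sub>p W" by (simp only: pcompose_assoc)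
    then show "A = R \<circ>\<^sub>p ([:0, \<epsilon>:] \<circ>\<^sub>p W)" using R\<kappa> by (simp add: W \<epsilon>_def)
  qed
qed

definition linear_centralizer :: "complex poly \<Rightarrow> complex poly set" where
  "linear_centralizer P = {\<sigma>. degree \<sigma> = 1 \<and> \<sigma> \<circ>\<^sub>p P = P \<circ>\<^sub>p \<sigma>}"

lemma linear_centralizer_rotation:
  assumes P: "centered P" "2 \<le> degree P" and \<sigma>: "\<sigma> \<in> linear_centralizer P"
  obtains \<epsilon> where "\<sigma> = [:0, \<epsilon>:]" "symmetry P \<epsilon>" "\<epsilon> ^ (degree P - 1) = 1"
proof -
  have d: "degree \<sigma> = 1" and comm: "\<sigma> \<circ>\<^sub>p P = P \<circ>\<^sub>p \<sigma>" using \<sigma> by (auto simp: linear_centralizer_def)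
  obtain \<epsilon> t where \<epsilon>: "\<sigma> = [:t, \<epsilon>:]" "\<epsilon> \<noteq> 0" using d by (rule degree_1_E)
  have "centered (\<sigma> \<circ>\<^sub>p P)" using P d by (subst centered_pcompose) auto
  then have "t = 0" using centered_pcompose_linear[OF P(2,1) \<epsilon>(2)] comm \<epsilon> by simp
  then have \<sigma>\<epsilon>: "\<sigma> = [:0, \<epsilon>:]" using \<epsilon> by simp
  have "P \<noteq> 0" using P by auto
  moreover have "P \<circ>\<^sub>p [:0, \<epsilon>:] = [:0, \<epsilon>:] \<circ>\<^sub>p P" using comm \<sigma>\<epsilon> by simp
  ultimately have "symmetry P \<epsilon>" using \<epsilon>(2) by (intro symmetryI)
  moreover have "\<epsilon> ^ (degree P - 1) = 1"
    using commute_lead_coeff[OF comm] P d by (simp add: \<sigma>\<epsilon>)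
  ultimately show thesis using that \<sigma>\<epsilon> by blast
qed

lemma rotation_in_linear_centralizer:
  assumes "symmetry P \<epsilon>" "\<epsilon> ^ (degree P - 1) = 1" "0 < degree P"
  shows "[:0, \<epsilon>:] \<in> linear_centralizer P"
proof -
  have "\<epsilon> ^ degree P = \<epsilon>" using power_degree_fixed[OF assms(2), of 1] assms(3) by simp
  then show ?thesis using symmetry_pcompose[OF assms(1)] assms(1)
    by (simp add: linear_centralizer_def symmetry_def)
qed

text \<open>\<open>R\<close> has minimal degree among the elements of degree at least 2. Dependence
  of the degrees together with minimality makes \<open>degree R\<close> divide all of these, so
  \<open>R\<close> can be divided off on the left until an affine element remains.\<close>

lemma centralizer_structure_centered:
  assumes P: "centered P" "2 \<le> degree P" "\<not> quadratic_ode P"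
  obtains R where "2 \<le> degree R" "R \<circ>\<^sub>p P = P \<circ>\<^sub>p R"
    "\<And>\<sigma>. \<sigma> \<in> linear_centralizer P \<Longrightarrow> \<exists>\<nu>\<in>linear_centralizer P. R \<circ>\<^sub>p \<sigma> = \<nu> \<circ>\<^sub>p R"
    "\<And>\<nu>. \<nu> \<in> linear_centralizer P \<Longrightarrow> \<exists>\<sigma>\<in>linear_centralizer P. R \<circ>\<^sub>p \<sigma> = \<nu> \<circ>\<^sub>p R"
    "\<And>A. A \<circ>\<^sub>p P = P \<circ>\<^sub>p A \<Longrightarrow> 0 < degree A \<Longrightarrow> A \<in> semigroup_gen pcompose (insert R (linear_centralizer P))"
proof -
  define n where "n = degree P"
  define C where "C = (\<lambda>A. A \<circ>\<^sub>p P = P \<circ>\<^sub>p A \<and> 2 \<le> degree A)"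
  have "C P" using P by (simp add: C_def)
  define R where "R = arg_min degree C"
  have R: "C R" "\<And>A. C A \<Longrightarrow> degree R \<le> degree A"
    using arg_min_nat_lemma[of C P degree] \<open>C P\<close> by (auto simp: R_def)
  define r where "r = degree R"
  have RP: "R \<circ>\<^sub>p P = P \<circ>\<^sub>p R" "2 \<le> degree R" using R(1) by (auto simp: C_def)
  obtain i j where ij: "1 \<le> i" "r ^ i = n ^ j"
    using degree_dependent[OF RP(1) P(2,3)] RP(2) unfolding n_def r_def by (metis gr0I not_numeral_le_zero)
  \<comment> \<open>Both sides commute with \<open>P\<close> and have the same leading
    coefficient.\<close>
  have twist: "R \<circ>\<^sub>p [:0, \<epsilon>:] = [:0, \<epsilon> ^ r:] \<circ>\<^sub>p R"
    if \<epsilon>: "symmetry P \<epsilon>" "\<epsilon> ^ (degree P - 1) = 1" for \<epsilon>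
  proof (rule commute_unique)
    have comm: "[:0, \<delta>:] \<circ>\<^sub>p P = P \<circ>\<^sub>p [:0, \<delta>:]" if "symmetry P \<delta>" "\<delta> ^ (degree P - 1) = 1" for \<delta>
      using rotation_in_linear_centralizer[OF that] P(2) by (simp add: linear_centralizer_def)
    have er: "symmetry P (\<epsilon> ^ r)" "(\<epsilon> ^ r) ^ (degree P - 1) = 1"
      using symmetry_power[OF \<epsilon>(1)] \<epsilon>(2) by (blast, metis mult.commute power_mult power_one)
    show "R \<circ>\<^sub>p [:0, \<epsilon>:] \<circ>\<^sub>p P = P \<circ>\<^sub>p (R \<circ>\<^sub>p [:0, \<epsilon>:])"
    proof -
      have "R \<circ>\<^sub>p [:0, \<epsilon>:] \<circ>\<^sub>p P = R \<circ>\<^sub>p ([:0, \<epsilon>:] \<circ>\<^sub>p P)" by (simp only: pcompose_assoc)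
      also have "\<dots> = (R \<circ>\<^sub>p P) \<circ>\<^sub>p [:0, \<epsilon>:]" by (simp only: comm[OF \<epsilon>] pcompose_assoc)
      finally show ?thesis by (simp only: RP(1) pcompose_assoc)
    qed
    show "[:0, \<epsilon> ^ r:] \<circ>\<^sub>p R \<circ>\<^sub>p P = P \<circ>\<^sub>p ([:0, \<epsilon> ^ r:] \<circ>\<^sub>p R)"
    proof -
      have "[:0, \<epsilon> ^ r:] \<circ>\<^sub>p R \<circ>\<^sub>p P = [:0, \<epsilon> ^ r:] \<circ>\<^sub>p (P \<circ>\<^sub>p R)" by (simp only: RP(1)[symmetric] pcompose_assoc)
      also have "\<dots> = ([:0, \<epsilon> ^ r:] \<circ>\<^sub>p P) \<circ>\<^sub>p R" by (simp only: pcompose_assoc)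
      finally show ?thesis by (simp only: comm[OF er] pcompose_assoc)
    qed
    have "\<epsilon> \<noteq> 0" using \<epsilon> by (simp add: symmetry_def)
    then show "degree (R \<circ>\<^sub>p [:0, \<epsilon>:]) = degree ([:0, \<epsilon> ^ r:] \<circ>\<^sub>p R)" "0 < degree (R \<circ>\<^sub>p [:0, \<epsilon>:])"
      using RP(2) by (simp_all add: degree_pcompose)
    show "lead_coeff (R \<circ>\<^sub>p [:0, \<epsilon>:]) = lead_coeff ([:0, \<epsilon> ^ r:] \<circ>\<^sub>p R)"
      using \<open>\<epsilon> \<noteq> 0\<close> by (simp add: lead_coeff_comp rotation_pcompose r_def mult.commute)
  qed (use P in simp)
  show thesis
  proof (rule that[OF RP(2,1)])
    fix \<sigma> assume "\<sigma> \<in> linear_centralizer P"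
    then obtain \<epsilon> where \<epsilon>: "\<sigma> = [:0, \<epsilon>:]" "symmetry P \<epsilon>" "\<epsilon> ^ (degree P - 1) = 1"
      using linear_centralizer_rotation[OF P(1,2)] by blast
    have "(\<epsilon> ^ r) ^ (degree P - 1) = 1" using \<epsilon>(3) by (metis mult.commute power_mult power_one)
    then have "[:0, \<epsilon> ^ r:] \<in> linear_centralizer P"
      using P(2) by (intro rotation_in_linear_centralizer symmetry_power \<epsilon>(2)) auto
    then show "\<exists>\<nu>\<in>linear_centralizer P. R \<circ>\<^sub>p \<sigma> = \<nu> \<circ>\<^sub>p R" using twist[OF \<epsilon>(2,3)] \<epsilon>(1) by blast
  next
    fix \<nu> assume "\<nu> \<in> linear_centralizer P"
    then obtain \<delta> where \<delta>: "\<nu> = [:0, \<delta>:]" "symmetry P \<delta>" "\<delta> ^ (degree P - 1) = 1"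
      using linear_centralizer_rotation[OF P(1,2)] by blast
    \<comment> \<open>An \<open>r\<close>-th root of \<delta>:
      \<open>\<epsilon> ^ r = \<delta> ^ (n ^ j) = \<delta>\<close>, the last because the order of
      \<delta> divides \<open>n - 1\<close>.\<close>
    define \<epsilon> where "\<epsilon> = \<delta> ^ (r ^ (i - 1))"
    have \<epsilon>: "symmetry P \<epsilon>" "\<epsilon> ^ (degree P - 1) = 1"
      using symmetry_power[OF \<delta>(2)] \<delta>(3) unfolding \<epsilon>_def
      by (blast, metis mult.commute power_mult power_one)
    have "\<epsilon> ^ r = \<delta> ^ (r ^ i)" using ij(1) unfolding \<epsilon>_def power_mult[symmetric] by (simp flip: power_Suc2)
    also have "\<dots> = \<delta>" unfolding ij(2) n_def using \<delta>(3) P(2) by (intro power_degree_fixed) auto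
    finally have "R \<circ>\<^sub>p [:0, \<epsilon>:] = \<nu> \<circ>\<^sub>p R" using twist[OF \<epsilon>] \<delta>(1) by simp
    moreover have "[:0, \<epsilon>:] \<in> linear_centralizer P" using \<epsilon> P(2) by (intro rotation_in_linear_centralizer) auto
    ultimately show "\<exists>\<sigma>\<in>linear_centralizer P. R \<circ>\<^sub>p \<sigma> = \<nu> \<circ>\<^sub>p R" by blast
  next
    fix A assume "A \<circ>\<^sub>p P = P \<circ>\<^sub>p A" "0 < degree A"
    then show "A \<in> semigroup_gen pcompose (insert R (linear_centralizer P))"
    proof (induction "degree A" arbitrary: A rule: less_induct)
      case less
      show ?case
      proof (cases "degree A = 1")
        case True
        then show ?thesis using less.prems by (intro semigroup_gen.base) (simp add: linear_centralizer_def)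
      next
        case False
        then have "2 \<le> degree A" using less.prems by linarith
        then have rA: "r \<le> degree A" using R(2)[of A] less.prems by (simp add: C_def r_def)
        obtain a b where ab: "1 \<le> a" "degree A ^ a = n ^ b"
          using degree_dependent[OF less.prems(1) P(2,3) less.prems(2)] unfolding n_def by metis
        have "1 < r ^ i" using RP(2) ij(1) by (intro one_less_power) (auto simp: r_def)
        then have j0: "j \<noteq> 0" unfolding ij(2) by (cases j) auto
        have "degree A ^ (a * j) = r ^ (i * b)"
          by (metis ab(2) ij(2) mult.commute power_mult)
        \<comment> \<open>\<open>degree A ^ (a * j)\<close> is a power of \<open>r\<close>; as
          \<open>degree A \<ge> r\<close>, its exponent is at least \<open>a * j\<close>, and
          divisibility of the powers passes to the bases.\<close>
        moreover have "a * j \<le> i * b"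
        proof (rule ccontr)
          assume "\<not> a * j \<le> i * b"
          then have "r ^ (i * b) < r ^ (a * j)" using RP(2) by (intro power_strict_increasing) (auto simp: r_def)
          also have "\<dots> \<le> degree A ^ (a * j)" using rA by (rule power_mono) simp
          finally show False using \<open>degree A ^ (a * j) = r ^ (i * b)\<close> by simp
        qed
        ultimately have "r ^ (a * j) dvd degree A ^ (a * j)" by (simp add: le_imp_power_dvd)
        then have "r dvd degree A" using ab(1) j0 by simp
        then obtain W where W: "W \<circ>\<^sub>p P = P \<circ>\<^sub>p W" "0 < degree W" "A = R \<circ>\<^sub>p W"
          using centralizer_left_division_centered[OF P RP less.prems] unfolding r_def by blast
        have "degree W < degree A" using W RP(2) by (simp add: degree_pcompose)
        from less.hyps[OF this W(1,2)] show ?thesis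
          unfolding W(3) by (intro semigroup_gen.mult) (auto intro: semigroup_gen.base)
      qed
    qed
  qed
qed

lemma semigroup_gen_shift_conj:
  assumes "A \<in> semigroup_gen pcompose G"
  shows "shift_conj s A \<in> semigroup_gen pcompose (shift_conj s ` G)"
  using assms by induction (auto intro: semigroup_gen.intros simp: shift_conj_pcompose)

lemma linear_centralizer_shift_conj:
  "shift_conj s ` linear_centralizer P = linear_centralizer (shift_conj s P)"
proof -
  have sub: "shift_conj s ` linear_centralizer P \<subseteq> linear_centralizer (shift_conj s P)" for s P
    by (auto simp: linear_centralizer_def simp flip: shift_conj_pcompose)
  show ?thesis
  proof
    show "linear_centralizer (shift_conj s P) \<subseteq> shift_conj s ` linear_centralizer P"
    proof
      fix \<sigma> assume "\<sigma> \<in> linear_centralizer (shift_conj s P)"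
      then have "shift_conj (- s) \<sigma> \<in> linear_centralizer P" using sub[of "- s" "shift_conj s P"] by auto
      then show "\<sigma> \<in> shift_conj s ` linear_centralizer P" by (metis image_eqI shift_conj_inverse(2))
    qed
  qed (rule sub)
qed

proposition centralizer_structure:
  assumes P: "2 \<le> degree P" "\<not> quadratic_ode P"
  obtains R where "2 \<le> degree R" "\<not> quadratic_ode R"
    "\<And>\<sigma>. \<sigma> \<in> linear_centralizer P \<Longrightarrow> \<exists>\<nu>\<in>linear_centralizer P. R \<circ>\<^sub>p \<sigma> = \<nu> \<circ>\<^sub>p R"
    "\<And>\<nu>. \<nu> \<in> linear_centralizer P \<Longrightarrow> \<exists>\<sigma>\<in>linear_centralizer P. R \<circ>\<^sub>p \<sigma> = \<nu> \<circ>\<^sub>p R"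
    "\<And>A. A \<circ>\<^sub>p P = P \<circ>\<^sub>p A \<Longrightarrow> 0 < degree A \<Longrightarrow> A \<in> semigroup_gen pcompose (insert R (linear_centralizer P))"
proof -
  obtain s where s: "centered (shift_conj s P)" using ex_centered_conj[OF P(1)] .
  define c where "c = shift_conj (- s)"
  have L: "c ` linear_centralizer (shift_conj s P) = linear_centralizer P"
    unfolding c_def linear_centralizer_shift_conj by simp
  have cc: "c (X \<circ>\<^sub>p Y) = c X \<circ>\<^sub>p c Y" for X Y by (simp add: c_def shift_conj_pcompose)
  have "2 \<le> degree (shift_conj s P)" "\<not> quadratic_ode (shift_conj s P)"
    using P by (simp_all add: shift_conj_quadratic_ode)
  then obtain R where R: "2 \<le> degree R" "R \<circ>\<^sub>p shift_conj s P = shift_conj s P \<circ>\<^sub>p R"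
    "\<And>\<sigma>. \<sigma> \<in> linear_centralizer (shift_conj s P) \<Longrightarrow> \<exists>\<nu>\<in>linear_centralizer (shift_conj s P). R \<circ>\<^sub>p \<sigma> = \<nu> \<circ>\<^sub>p R"
    "\<And>\<nu>. \<nu> \<in> linear_centralizer (shift_conj s P) \<Longrightarrow> \<exists>\<sigma>\<in>linear_centralizer (shift_conj s P). R \<circ>\<^sub>p \<sigma> = \<nu> \<circ>\<^sub>p R"
    "\<And>A. A \<circ>\<^sub>p shift_conj s P = shift_conj s P \<circ>\<^sub>p A \<Longrightarrow> 0 < degree A \<Longrightarrow>
       A \<in> semigroup_gen pcompose (insert R (linear_centralizer (shift_conj s P)))"
    using centralizer_structure_centered[OF s] by blast
  have dc: "2 \<le> degree (c R)" using R(1) by (simp add: c_def)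
  have cP: "c (shift_conj s P) = P" by (simp add: c_def)
  have comm: "c R \<circ>\<^sub>p P = P \<circ>\<^sub>p c R" using arg_cong[OF R(2), of c] by (simp only: cc cP)
  show thesis
  proof (rule that[OF dc])
    show "\<not> quadratic_ode (c R)"
    proof
      assume "quadratic_ode (c R)"
      moreover obtain i j where ij: "1 \<le> j" "poly_iter (c R) i = poly_iter P j"
        using commuting_common_iterate[OF comm P(1) dc P(2)] by blast
      ultimately have "quadratic_ode (poly_iter P j)" using quadratic_ode_imp_poly_iter by metis
      then show False using quadratic_ode_of_poly_iter[OF _ ij(1) P(1)] P(2) by blast
    qed
    show "\<exists>\<nu>\<in>linear_centralizer P. c R \<circ>\<^sub>p \<sigma> = \<nu> \<circ>\<^sub>p c R" if \<sigma>: "\<sigma> \<in> linear_centralizer P" for \<sigma>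
    proof -
      obtain \<tau> where \<tau>: "\<tau> \<in> linear_centralizer (shift_conj s P)" "\<sigma> = c \<tau>" using \<sigma> unfolding L[symmetric] by blast
      obtain \<nu> where \<nu>: "\<nu> \<in> linear_centralizer (shift_conj s P)" "R \<circ>\<^sub>p \<tau> = \<nu> \<circ>\<^sub>p R" using R(3)[OF \<tau>(1)] by blast
      have "c \<nu> \<in> linear_centralizer P" using \<nu>(1) unfolding L[symmetric] by (rule imageI)
      moreover have "c R \<circ>\<^sub>p \<sigma> = c \<nu> \<circ>\<^sub>p c R" unfolding \<tau>(2) cc[symmetric] \<nu>(2) ..
      ultimately show ?thesis by blast
    qed
    show "\<exists>\<sigma>\<in>linear_centralizer P. c R \<circ>\<^sub>p \<sigma> = \<nu> \<circ>\<^sub>p c R" if \<nu>: "\<nu> \<in> linear_centralizer P" for \<nu>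
    proof -
      obtain \<tau> where \<tau>: "\<tau> \<in> linear_centralizer (shift_conj s P)" "\<nu> = c \<tau>" using \<nu> unfolding L[symmetric] by blast
      obtain \<sigma> where \<sigma>: "\<sigma> \<in> linear_centralizer (shift_conj s P)" "R \<circ>\<^sub>p \<sigma> = \<tau> \<circ>\<^sub>p R" using R(4)[OF \<tau>(1)] by blast
      have "c \<sigma> \<in> linear_centralizer P" using \<sigma>(1) unfolding L[symmetric] by (rule imageI)
      moreover have "c R \<circ>\<^sub>p c \<sigma> = \<nu> \<circ>\<^sub>p c R" unfolding \<tau>(2) cc[symmetric] \<sigma>(2) ..
      ultimately show ?thesis by blast
    qed
    fix A assume A: "A \<circ>\<^sub>p P = P \<circ>\<^sub>p A" "0 < degree A"
    have "shift_conj s A \<in> semigroup_gen pcompose (insert R (linear_centralizer (shift_conj s P)))"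
      by (rule R(5)) (use A in \<open>simp_all flip: shift_conj_pcompose\<close>)
    from semigroup_gen_shift_conj[OF this, of "- s"]
    show "A \<in> semigroup_gen pcompose (insert (c R) (linear_centralizer P))"
      unfolding image_insert using L by (simp add: c_def)
  qed
qed

text \<open>Centering makes \<open>G\<close> consist of rotations by symmetries of \<open>R\<close>,
  on which \<open>R\<close> acts as the \<open>n\<close>-th power map, surjective by the third
  condition. So every such rotation lies in the image of the idempotent map with exponent
  \<open>n ^ k\<close> and is fixed by it, which means that it commutes with the \<open>k\<close>-th
  iterate.\<close>

lemma linear_group_centralized_centered:
  assumes R: "centered R" "2 \<le> degree R" "\<not> quadratic_ode R"
    and G: "\<And>\<sigma>. \<sigma> \<in> G \<Longrightarrow> degree \<sigma> = 1" "\<And>\<sigma>. \<sigma> \<in> G \<Longrightarrow> \<exists>\<nu>\<in>G. R \<circ>\<^sub>p \<sigma> = \<nu> \<circ>\<^sub>p R"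
      "\<And>\<nu>. \<nu> \<in> G \<Longrightarrow> \<exists>\<sigma>\<in>G. R \<circ>\<^sub>p \<sigma> = \<nu> \<circ>\<^sub>p R"
  obtains K where "1 \<le> K" "\<And>\<sigma>. \<sigma> \<in> G \<Longrightarrow> \<sigma> \<circ>\<^sub>p poly_iter R K = poly_iter R K \<circ>\<^sub>p \<sigma>"
proof -
  define n where "n = degree R"
  obtain m where m: "1 \<le> m" "\<And>\<epsilon>. symmetry R \<epsilon> \<Longrightarrow> \<epsilon> ^ m = 1" using symmetry_finite_order[OF R(3)] by blast
  obtain k where k: "2 \<le> k" "n ^ k * n ^ k mod m = n ^ k mod m" using ex_idempotent_power[OF m(1)] by blast
  have R0: "R \<noteq> 0" "0 < degree R" using R(2) by auto
  have rot: "\<exists>\<epsilon>. \<sigma> = [:0, \<epsilon>:] \<and> \<epsilon> \<noteq> 0" if \<sigma>: "\<sigma> \<in> G" for \<sigma>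
  proof -
    obtain \<epsilon> t where \<epsilon>: "\<sigma> = [:t, \<epsilon>:]" "\<epsilon> \<noteq> 0" using G(1)[OF \<sigma>] by (rule degree_1_E)
    obtain \<nu> where \<nu>: "\<nu> \<in> G" "R \<circ>\<^sub>p \<sigma> = \<nu> \<circ>\<^sub>p R" using G(2)[OF \<sigma>] by blast
    have "centered (\<nu> \<circ>\<^sub>p R)" using R G(1)[OF \<nu>(1)] by (subst centered_pcompose) auto
    then have "t = 0" using centered_pcompose_linear[OF R(2,1) \<epsilon>(2)] \<nu>(2) \<epsilon>(1) by metis
    then show ?thesis using \<epsilon> by blast
  qed
  have sym: "symmetry R \<epsilon>" if \<epsilon>: "[:0, \<epsilon>:] \<in> G" for \<epsilon>
  proof -
    obtain \<nu> where \<nu>: "\<nu> \<in> G" "R \<circ>\<^sub>p [:0, \<epsilon>:] = \<nu> \<circ>\<^sub>p R" using G(2)[OF \<epsilon>] by blast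
    obtain w where "\<nu> = [:0, w:]" using rot[OF \<nu>(1)] by blast
    moreover have "\<epsilon> \<noteq> 0" using G(1)[OF \<epsilon>] by auto
    ultimately show ?thesis using \<nu>(2) R0 by (intro symmetryI) auto
  qed
  have root: "\<exists>\<epsilon>. [:0, \<epsilon>:] \<in> G \<and> \<epsilon> ^ n = \<delta>" if \<delta>: "[:0, \<delta>:] \<in> G" for \<delta>
  proof -
    obtain \<sigma> where \<sigma>: "\<sigma> \<in> G" "R \<circ>\<^sub>p \<sigma> = [:0, \<delta>:] \<circ>\<^sub>p R" using G(3)[OF \<delta>] by blast
    obtain \<epsilon> where \<epsilon>: "\<sigma> = [:0, \<epsilon>:]" using rot[OF \<sigma>(1)] by blast
    have "[:0, \<epsilon> ^ n:] \<circ>\<^sub>p R = [:0, \<delta>:] \<circ>\<^sub>p R"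
      using symmetry_pcompose[OF sym] \<sigma> by (simp add: \<epsilon> n_def)
    then have "[:0, \<epsilon> ^ n:] = [:0, \<delta>:]" using R0(2) by (rule pcompose_right_cancel)
    then show ?thesis using \<sigma>(1) \<epsilon> by auto
  qed
  have iter_root: "\<exists>\<epsilon>. [:0, \<epsilon>:] \<in> G \<and> \<epsilon> ^ (n ^ l) = \<delta>" if "[:0, \<delta>:] \<in> G" for \<delta> l
    using that
  proof (induction l arbitrary: \<delta>)
    case 0
    then show ?case by (intro exI[of _ \<delta>]) simp
  next
    case (Suc l)
    obtain \<epsilon> where \<epsilon>: "[:0, \<epsilon>:] \<in> G" "\<epsilon> ^ n = \<delta>" using root[OF Suc.prems] by blast
    obtain \<epsilon>' where \<epsilon>': "[:0, \<epsilon>':] \<in> G" "\<epsilon>' ^ (n ^ l) = \<epsilon>" using Suc.IH[OF \<epsilon>(1)] by blast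
    have "\<epsilon>' ^ (n ^ Suc l) = (\<epsilon>' ^ (n ^ l)) ^ n" by (simp only: power_Suc2 power_mult)
    then show ?case using \<epsilon>' \<epsilon>(2) by blast
  qed
  show thesis
  proof (rule that[of k])
    show "1 \<le> k" using k by simp
    fix \<sigma> assume \<sigma>: "\<sigma> \<in> G"
    obtain \<delta> where \<delta>: "\<sigma> = [:0, \<delta>:]" using rot[OF \<sigma>] by blast
    obtain \<epsilon> where \<epsilon>: "[:0, \<epsilon>:] \<in> G" "\<epsilon> ^ (n ^ k) = \<delta>" using iter_root[of \<delta> k] \<sigma> \<delta> by blast
    have "\<delta> ^ (n ^ k) = \<epsilon> ^ (n ^ k * n ^ k)" using \<epsilon>(2) by (simp add: power_mult)
    also have "\<dots> = \<delta>" using power_mod_order[OF m(2)[OF sym[OF \<epsilon>(1)]] k(2)] \<epsilon>(2) by simp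
    finally have "\<delta> ^ (n ^ k) = \<delta>" .
    then show "\<sigma> \<circ>\<^sub>p poly_iter R k = poly_iter R k \<circ>\<^sub>p \<sigma>"
      using symmetry_poly_iter[OF sym, of \<delta> k] \<sigma> \<delta> by (simp add: n_def)
  qed
qed

lemma linear_group_centralized:
  assumes R: "2 \<le> degree R" "\<not> quadratic_ode R"
    and G: "\<And>\<sigma>. \<sigma> \<in> G \<Longrightarrow> degree \<sigma> = 1" "\<And>\<sigma>. \<sigma> \<in> G \<Longrightarrow> \<exists>\<nu>\<in>G. R \<circ>\<^sub>p \<sigma> = \<nu> \<circ>\<^sub>p R"
      "\<And>\<nu>. \<nu> \<in> G \<Longrightarrow> \<exists>\<sigma>\<in>G. R \<circ>\<^sub>p \<sigma> = \<nu> \<circ>\<^sub>p R"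
  obtains K where "1 \<le> K" "\<And>\<sigma>. \<sigma> \<in> G \<Longrightarrow> \<sigma> \<circ>\<^sub>p poly_iter R K = poly_iter R K \<circ>\<^sub>p \<sigma>"
proof -
  obtain s where s: "centered (shift_conj s R)" using ex_centered_conj[OF R(1)] .
  have R': "2 \<le> degree (shift_conj s R)" "\<not> quadratic_ode (shift_conj s R)"
    using R by (simp_all add: shift_conj_quadratic_ode)
  have "degree \<sigma> = 1" if "\<sigma> \<in> shift_conj s ` G" for \<sigma> using G(1) that by auto
  moreover have "\<exists>\<nu>\<in>shift_conj s ` G. shift_conj s R \<circ>\<^sub>p \<sigma> = \<nu> \<circ>\<^sub>p shift_conj s R" if "\<sigma> \<in> shift_conj s ` G" for \<sigma>
    using G(2) that by (auto simp flip: shift_conj_pcompose simp: shift_conj_inject)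
  moreover have "\<exists>\<sigma>\<in>shift_conj s ` G. shift_conj s R \<circ>\<^sub>p \<sigma> = \<nu> \<circ>\<^sub>p shift_conj s R" if "\<nu> \<in> shift_conj s ` G" for \<nu>
    using G(3) that by (auto simp flip: shift_conj_pcompose simp: shift_conj_inject)
  ultimately obtain K where K: "1 \<le> K" "\<And>\<sigma>. \<sigma> \<in> shift_conj s ` G \<Longrightarrow>
      \<sigma> \<circ>\<^sub>p poly_iter (shift_conj s R) K = poly_iter (shift_conj s R) K \<circ>\<^sub>p \<sigma>"
    by (rule linear_group_centralized_centered[OF s R', of "shift_conj s ` G"]) blast+
  show thesis
  proof (rule that[OF K(1)])
    fix \<sigma> assume "\<sigma> \<in> G"
    then have "shift_conj s (\<sigma> \<circ>\<^sub>p poly_iter R K) = shift_conj s (poly_iter R K \<circ>\<^sub>p \<sigma>)"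
      using K(2)[of "shift_conj s \<sigma>"] by (simp add: shift_conj_pcompose shift_conj_poly_iter)
    then show "\<sigma> \<circ>\<^sub>p poly_iter R K = poly_iter R K \<circ>\<^sub>p \<sigma>" by (simp only: shift_conj_inject)
  qed
qed

section \<open>Moebius transformations\<close>

lemma rat_nonconst_to_fract: "0 < degree A \<Longrightarrow> rat_nonconst (to_fract A)"
  by (auto simp: rat_nonconst_def rat_const_def)

lemma to_fract_in_rat_centralizer:
  assumes "0 < degree A" "0 < degree P"
  shows "to_fract A \<in> rat_centralizer (to_fract P) \<longleftrightarrow> A \<circ>\<^sub>p P = P \<circ>\<^sub>p A"
  using assms by (simp add: rat_centralizer_def rat_nonconst_to_fract rat_comp_to_fract)

lemma moebius_to_fract:
  assumes "degree \<sigma> = 1"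
  shows "Defs.moebius (to_fract \<sigma>)"
proof -
  obtain a b where \<sigma>: "\<sigma> = [:b, a:]" "a \<noteq> 0" using assms by (rule degree_1_E)
  show ?thesis unfolding Defs.moebius_def
    by (rule exI[of _ a], rule exI[of _ b], rule exI[of _ 0], rule exI[of _ 1]) (use \<sigma> in \<open>simp flip: one_pCons\<close>)
qed

lemma moebius_nonconst:
  assumes "Defs.moebius \<sigma>"
  shows "rat_nonconst \<sigma>"
proof -
  obtain a b c d where abcd: "a * d - b * c \<noteq> 0" "\<sigma> = to_fract [:b, a:] / to_fract [:d, c:]"
    using assms by (auto simp: Defs.moebius_def)
  have nz: "[:d, c:] \<noteq> 0" using abcd(1) by auto
  have False if "\<sigma> = rat_const k" for k
  proof -
    have "to_fract [:b, a:] = to_fract ([:k:] * [:d, c:])"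
      using that nz unfolding abcd(2) to_fract_mult rat_const_def by (simp only: divide_eq_eq to_fract_eq_0_iff) simp
    then have "b = k * d" "a = k * c" unfolding to_fract_eq_iff by simp_all
    then show False using abcd(1) by simp
  qed
  then show ?thesis by (auto simp: rat_nonconst_def)
qed

lemma to_fract_power: "to_fract (x ^ n) = to_fract x ^ n"
  by (induction n) simp_all

text \<open>Homogenization of \<open>p\<close>: the numerator of \<open>p\<close> evaluated at \<open>u / w\<close>.\<close>

lemma subst_fraction:
  fixes p u w :: "complex poly"
  assumes "w \<noteq> 0" "degree p \<le> N"
  shows "\<exists>h. subst p (to_fract u / to_fract w) * to_fract w ^ N = to_fract h \<and> w dvd h - smult (coeff p N) (u ^ N)"
  using assms(2)
proof (induction p arbitrary: N)
  case 0
  then show ?case by (intro exI[of _ 0]) simp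
next
  case (pCons a p)
  show ?case
  proof (cases N)
    case 0
    with pCons.prems have "p = 0" by (metis degree_pCons_eq_if le_0_eq nat.distinct(1))
    then show ?thesis using 0 by (intro exI[of _ "[:a:]"]) (simp add: subst_pCons rat_const_def[of a])
  next
    case (Suc M)
    have "degree p \<le> M" using pCons.prems Suc by (cases "p = 0") auto
    then obtain h where h: "subst p (to_fract u / to_fract w) * to_fract w ^ M = to_fract h"
      "w dvd h - smult (coeff p M) (u ^ M)" using pCons.IH by blast
    have w: "to_fract w \<noteq> 0" using assms(1) by simp
    have "subst (pCons a p) (to_fract u / to_fract w) * to_fract w ^ Suc M
       = to_fract [:a:] * to_fract w ^ Suc M + to_fract u * (subst p (to_fract u / to_fract w) * to_fract w ^ M)"
      using w by (simp add: subst_pCons rat_const_def field_simps)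
    also have "\<dots> = to_fract (smult a (w ^ Suc M) + u * h)"
      unfolding h(1) by (simp only: to_fract_power[symmetric] to_fract_mult[symmetric] to_fract_add[symmetric]) simp
    finally have eq: "subst (pCons a p) (to_fract u / to_fract w) * to_fract w ^ Suc M = to_fract (smult a (w ^ Suc M) + u * h)" .
    have "smult a (w ^ Suc M) + u * h - smult (coeff (pCons a p) (Suc M)) (u ^ Suc M)
       = w * smult a (w ^ M) + u * (h - smult (coeff p M) (u ^ M))"
      by (simp add: algebra_simps)
    also have "w dvd \<dots>" using h(2) by (intro dvd_add dvd_mult dvd_triv_left)
    finally show ?thesis using eq unfolding Suc by blast
  qed
qed

lemma rat_comp_moebius_left:
  assumes "0 < degree R" "[:d, c:] \<noteq> 0"
  shows "(to_fract [:b, a:] / to_fract [:d, c:]) \<circ>\<^sub>r to_fract R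
    = to_fract ([:b:] + smult a R) / to_fract ([:d:] + smult c R)" "[:d:] + smult c R \<noteq> 0"
proof -
  have comp: "[:x, y:] \<circ>\<^sub>p R = [:x:] + smult y R" for x y by (simp add: pcompose_pCons)
  show "(to_fract [:b, a:] / to_fract [:d, c:]) \<circ>\<^sub>r to_fract R
    = to_fract ([:b:] + smult a R) / to_fract ([:d:] + smult c R)"
    using rat_comp_quot[OF rat_nonconst_to_fract[OF assms(1)] assms(2)] by (simp only: subst_to_fract comp)
  show "[:d:] + smult c R \<noteq> 0" using assms pcompose_eq_0[of "[:d, c:]" R] unfolding comp by blast
qed

text \<open>\<open>R \<circ> \<sigma>\<close> has a single pole, at the pole of \<open>\<sigma>\<close>, so \<open>R\<close> takes the value at the pole of \<open>\<nu>\<close> only there.\<close>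

lemma totally_ramified_of_finite_pole:
  assumes R: "0 < degree R" and \<sigma>: "\<sigma> = to_fract [:b, a:] / to_fract [:d, c:]" "a * d - b * c \<noteq> 0" "c \<noteq> 0"
    and \<nu>: "\<nu> = to_fract [:b', a':] / to_fract [:d', c':]" "a' * d' - b' * c' \<noteq> 0"
    and eq: "to_fract R \<circ>\<^sub>r \<sigma> = \<nu> \<circ>\<^sub>r to_fract R"
  shows "c' \<noteq> 0 \<and> (\<exists>\<kappa>. [:d':] + smult c' R = smult \<kappa> ([:d / c, 1:] ^ degree R))"
proof -
  define n where "n = degree R"
  define w where "w = [:d, c:]"
  define u where "u = [:b, a:]"
  define l where "l = [:d / c, 1:]"
  define \<alpha> \<beta> where "\<alpha> = [:b':] + smult a' R" and "\<beta> = [:d':] + smult c' R"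
  have w0: "w \<noteq> 0" using \<sigma>(3) by (simp add: w_def)
  have wl: "w = smult c l" using \<sigma>(3) by (simp add: w_def l_def)
  have "[:d', c':] \<noteq> 0" using \<nu>(2) by auto
  note \<nu>R = rat_comp_moebius_left(1)[OF R this, of b' a', folded \<nu>(1) \<alpha>_def \<beta>_def]
    rat_comp_moebius_left(2)[OF R this, folded \<beta>_def]
  have "Defs.moebius \<sigma>" unfolding Defs.moebius_def using \<sigma> by blast
  then have "rat_nonconst \<sigma>" by (rule moebius_nonconst)
  from rat_comp_quot[OF this, of 1 R] have R\<sigma>: "to_fract R \<circ>\<^sub>r \<sigma> = subst R \<sigma>" by simp
  obtain h where h: "subst R \<sigma> * to_fract w ^ n = to_fract h" "w dvd h - smult (lead_coeff R) (u ^ n)"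
    using subst_fraction[OF w0 order_refl, of R u] unfolding \<sigma>(1) u_def w_def n_def by blast
  have "subst R \<sigma> = to_fract \<alpha> / to_fract \<beta>" using eq \<nu>R(1) R\<sigma> by simp
  then have "subst R \<sigma> * to_fract \<beta> = to_fract \<alpha>" using \<nu>R(2) by simp
  then have "to_fract h * to_fract \<beta> = to_fract \<alpha> * to_fract w ^ n"
    unfolding h(1)[symmetric] by (metis mult.assoc mult.commute)
  then have "to_fract (h * \<beta>) = to_fract (\<alpha> * w ^ n)" by (simp add: to_fract_power)
  then have hb: "h * \<beta> = \<alpha> * w ^ n" by (simp only: to_fract_eq_iff)
  define z where "z = - d / c"
  have wz: "poly w z = 0" using \<sigma>(3) by (simp add: w_def z_def)
  have uz: "poly u z \<noteq> 0" using \<sigma>(2,3) by (simp add: u_def z_def field_simps)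
  obtain q where q: "h - smult (lead_coeff R) (u ^ n) = w * q" using h(2) by (auto simp: dvd_def)
  have "h = smult (lead_coeff R) (u ^ n) + w * q" using q by (simp add: algebra_simps)
  then have "poly h z = lead_coeff R * poly u z ^ n" using wz by simp
  moreover have "R \<noteq> 0" using R by auto
  ultimately have hz: "poly h z \<noteq> 0" using uz by simp
  then have h0: "h \<noteq> 0" by auto
  have lz: "l = [:- z, 1:]" by (simp add: l_def z_def)
  \<comment> \<open>\<open>h\<close> does not vanish at the pole \<open>z\<close> of \<sigma>, so
    the zero of order \<open>n\<close> comes entirely from \<beta>, whose degree is at most
    \<open>n\<close>.\<close>
  have "l ^ n dvd h * \<beta>" unfolding hb wl smult_power by (intro dvd_mult dvd_smult dvd_refl)
  then have "n \<le> order z (h * \<beta>)" using h0 \<nu>R(2) unfolding lz by (simp add: order_divides)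
  also have "\<dots> = order z \<beta>" using h0 \<nu>R(2) hz by (simp add: order_mult order_0I)
  finally have "l ^ n dvd \<beta>" unfolding lz using \<nu>R(2) by (simp add: order_divides)
  then obtain q where q: "\<beta> = l ^ n * q" by (auto simp: dvd_def)
  have q0: "q \<noteq> 0" using q \<nu>R(2) by auto
  have "degree (l ^ n) = n" by (simp add: l_def degree_linear_power)
  moreover have "l ^ n \<noteq> 0" by (simp add: l_def)
  ultimately have dq: "degree \<beta> = n + degree q" using q0 by (simp add: q degree_mult_eq)
  have "degree \<beta> \<le> n" unfolding \<beta>_def n_def by (intro degree_add_le) auto
  then have "degree q = 0" "degree \<beta> = n" using dq by auto
  then obtain \<kappa> where "q = [:\<kappa>:]" by (auto elim: degree_eq_zeroE)
  then have "\<beta> = smult \<kappa> (l ^ n)" using q by simp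
  moreover have "c' \<noteq> 0" using \<open>degree \<beta> = n\<close> R by (auto simp: \<beta>_def n_def)
  ultimately show ?thesis by (auto simp: \<beta>_def l_def n_def)
qed

text \<open>Suppose \<sigma> has a finite pole \<open>z\<close>. Its image \<nu> shows that
  \<open>R\<close> is totally ramified at \<open>z\<close>; a preimage \<tau>, whose pole is also
  finite, shows that \<open>R\<close> takes the value \<open>z\<close> only at the pole of \<tau>,
  with full multiplicity. As \<open>pderiv R\<close> has just one zero, the two points agree, and
  \<open>R\<close> is conjugate to a power.\<close>

lemma moebius_group_linear:
  assumes R: "2 \<le> degree R" "\<not> special R"
    and \<Gamma>: "\<And>\<sigma>. \<sigma> \<in> \<Gamma> \<Longrightarrow> Defs.moebius \<sigma>" "\<And>\<sigma>. \<sigma> \<in> \<Gamma> \<Longrightarrow> \<exists>\<nu>\<in>\<Gamma>. to_fract R \<circ>\<^sub>r \<sigma> = \<nu> \<circ>\<^sub>r to_fract R"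
      "\<And>\<nu>. \<nu> \<in> \<Gamma> \<Longrightarrow> \<exists>\<sigma>\<in>\<Gamma>. to_fract R \<circ>\<^sub>r \<sigma> = \<nu> \<circ>\<^sub>r to_fract R"
    and \<sigma>: "\<sigma> \<in> \<Gamma>"
  obtains s where "degree s = 1" "\<sigma> = to_fract s"
proof -
  have R0: "0 < degree R" using R by simp
  obtain a b c d where abcd: "a * d - b * c \<noteq> 0" "\<sigma> = to_fract [:b, a:] / to_fract [:d, c:]"
    using \<Gamma>(1)[OF \<sigma>] by (auto simp: Defs.moebius_def)
  have "c = 0"
  proof (rule ccontr)
    assume c: "c \<noteq> 0"
    obtain \<nu> where \<nu>: "\<nu> \<in> \<Gamma>" "to_fract R \<circ>\<^sub>r \<sigma> = \<nu> \<circ>\<^sub>r to_fract R" using \<Gamma>(2)[OF \<sigma>] by blast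
    obtain a' b' c' d' where \<nu>': "a' * d' - b' * c' \<noteq> 0" "\<nu> = to_fract [:b', a':] / to_fract [:d', c':]"
      using \<Gamma>(1)[OF \<nu>(1)] by (auto simp: Defs.moebius_def)
    obtain \<kappa> where 1: "c' \<noteq> 0" "[:d':] + smult c' R = smult \<kappa> ([:d / c, 1:] ^ degree R)"
      using totally_ramified_of_finite_pole[OF R0 abcd(2,1) c \<nu>'(2,1) \<nu>(2)] by blast
    obtain \<tau> where \<tau>: "\<tau> \<in> \<Gamma>" "to_fract R \<circ>\<^sub>r \<tau> = \<sigma> \<circ>\<^sub>r to_fract R" using \<Gamma>(3)[OF \<sigma>] by blast
    obtain a2 b2 c2 d2 where \<tau>': "a2 * d2 - b2 * c2 \<noteq> 0" "\<tau> = to_fract [:b2, a2:] / to_fract [:d2, c2:]"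
      using \<Gamma>(1)[OF \<tau>(1)] by (auto simp: Defs.moebius_def)
    \<comment> \<open>If \<tau> were affine, \<open>to_fract R \<circ>\<^sub>r \<tau>\<close> would
      be a polynomial, but \<sigma> after \<open>R\<close> has a nonconstant denominator prime to
      its numerator.\<close>
    have c2: "c2 \<noteq> 0"
    proof
      assume "c2 = 0"
      with \<tau>' have "d2 \<noteq> 0" "a2 \<noteq> 0" by auto
      define t where "t = smult (1 / d2) [:b2, a2:]"
      have "to_fract [:b2, a2:] = to_fract (t * [:d2:])" using \<open>d2 \<noteq> 0\<close> by (simp add: t_def)
      then have \<tau>t: "\<tau> = to_fract t" using \<tau>'(2) \<open>c2 = 0\<close> \<open>d2 \<noteq> 0\<close>
        by (simp only: to_fract_mult) simp
      have "0 < degree t" using \<open>a2 \<noteq> 0\<close> \<open>d2 \<noteq> 0\<close> by (simp add: t_def)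
      then have "to_fract R \<circ>\<^sub>r \<tau> = to_fract (R \<circ>\<^sub>p t)" unfolding \<tau>t by (rule rat_comp_to_fract)
      moreover have "[:d, c:] \<noteq> 0" using c by simp
      note \<sigma>R = rat_comp_moebius_left(1)[OF R0 this, of b a, folded abcd(2)] rat_comp_moebius_left(2)[OF R0 this]
      ultimately have "to_fract (R \<circ>\<^sub>p t) = to_fract ([:b:] + smult a R) / to_fract ([:d:] + smult c R)"
        using \<tau>(2) \<sigma>R(1) by simp
      then have "to_fract (R \<circ>\<^sub>p t) * to_fract ([:d:] + smult c R) = to_fract ([:b:] + smult a R)"
        using \<sigma>R(2) by (simp only: nonzero_eq_divide_eq to_fract_eq_0_iff not_False_eq_True)
      then have "(R \<circ>\<^sub>p t) * ([:d:] + smult c R) = [:b:] + smult a R" by (simp only: to_fract_mult[symmetric] to_fract_eq_iff)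
      then have "[:d:] + smult c R dvd [:b:] + smult a R" by (metis dvd_triv_right)
      then have "[:d:] + smult c R dvd smult a ([:d:] + smult c R) - smult c ([:b:] + smult a R)"
        by (intro dvd_diff dvd_smult) auto
      moreover have "smult a ([:d:] + smult c R) - smult c ([:b:] + smult a R) = [:a * d - b * c:]"
        by (simp add: smult_add_right mult.commute)
      ultimately have "[:d:] + smult c R dvd [:a * d - b * c:]" by simp
      then have "degree ([:d:] + smult c R) \<le> degree [:a * d - b * c:]" using abcd(1) by (intro dvd_imp_degree_le) auto
      moreover have "degree ([:d:] + smult c R) = degree R" using c R0 by (subst degree_add_eq_right) auto
      ultimately show False using R0 by simp
    qed
    obtain \<kappa>2 where 2: "[:d:] + smult c R = smult \<kappa>2 ([:d2 / c2, 1:] ^ degree R)"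
      using totally_ramified_of_finite_pole[OF R0 \<tau>'(2,1) c2 abcd(2,1) \<tau>(2)] by blast
    define n where "n = degree R"
    obtain n' where n': "n = Suc n'" "0 < n'" using R(1) unfolding n_def by (cases "degree R") auto
    define z where "z = - d / c"
    have dl: "pderiv ([:x, 1:] ^ n) = smult (of_nat n) ([:x, 1:] ^ n')" for x :: complex
      unfolding n' pderiv_power_Suc by (simp add: pderiv_pCons)
    have "smult c' (pderiv R) = smult (\<kappa> * of_nat n) ([:d / c, 1:] ^ n')"
      using arg_cong[OF 1(2), of pderiv] unfolding n_def[symmetric] by (simp add: pderiv_add pderiv_smult dl pderiv_pCons)
    from arg_cong[OF this, of "\<lambda>p. poly p z"] have "poly (pderiv R) z = 0"
      using 1(1) n' c by (simp add: z_def zero_power)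
    have R': "smult c (pderiv R) = smult (\<kappa>2 * of_nat n) ([:d2 / c2, 1:] ^ n')"
      using arg_cong[OF 2, of pderiv] unfolding n_def[symmetric] by (simp add: pderiv_add pderiv_smult dl pderiv_pCons)
    have "pderiv R \<noteq> 0" using R0 by (auto simp: pderiv_eq_0_iff)
    then have "\<kappa>2 * of_nat n \<noteq> 0" using R' c by (metis smult_eq_0_iff smult_0_left)
    then have "poly ([:d2 / c2, 1:] ^ n') z = 0"
      using arg_cong[OF R', of "\<lambda>p. poly p z"] \<open>poly (pderiv R) z = 0\<close> by simp
    then have "d2 / c2 = - z" using n' by (simp add: add_eq_0_iff)
    then have zl: "[:d2 / c2, 1:] = [:- z, 1:]" by simp
    have "smult c (pderiv R * [:- z, 1:]) = smult (\<kappa>2 * of_nat n) ([:- z, 1:] ^ n)"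
      unfolding n' power_Suc2 using R' unfolding zl n'(1)
      by (metis mult_smult_left)
    also have "\<dots> = smult (of_nat n) (smult \<kappa>2 ([:- z, 1:] ^ n))" by (simp add: mult.commute)
    also have "\<dots> = smult (of_nat n) ([:d:] + smult c R)" using 2 unfolding zl n_def[symmetric] by simp
    also have "[:d:] + smult c R = smult c (R - [:z:])" using c by (simp add: z_def smult_diff_right)
    finally have "smult c (pderiv R * [:- z, 1:]) = smult c (smult (of_nat (degree R)) (R - [:z:]))"
      by (simp only: n_def smult_smult mult.commute)
    then have "pderiv R * [:- z, 1:] = smult (of_nat (degree R)) (R - [:z:])" unfolding smult_left_cancel[OF c] .
    then show False using special_of_power[OF R(1)] R(2) by blast
  qed
  with abcd(1) have ad: "a \<noteq> 0" "d \<noteq> 0" by auto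
  show thesis
  proof (rule that[of "smult (1 / d) [:b, a:]"])
    show "degree (smult (1 / d) [:b, a:]) = 1" using ad by simp
    have "to_fract [:b, a:] = to_fract (smult (1 / d) [:b, a:] * [:d:])" using ad by simp
    then show "\<sigma> = to_fract (smult (1 / d) [:b, a:])"
      using abcd(2) \<open>c = 0\<close> ad by (simp only: to_fract_mult) simp
  qed
qed

lemma quadratic_ode_iff_special: "2 \<le> degree P \<Longrightarrow> quadratic_ode P \<longleftrightarrow> special P"
  using special_imp_quadratic_ode quadratic_ode_imp_special by blast

section \<open>Semigroups generated by a group and one polynomial\<close>

lemma to_fract_semigroup_gen:
  assumes "A \<in> semigroup_gen pcompose G" "\<And>g. g \<in> G \<Longrightarrow> 0 < degree g"
  shows "0 < degree A \<and> to_fract A \<in> semigroup_gen (\<circ>\<^sub>r) (to_fract ` G)"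
  using assms(1)
proof induction
  case (mult A B)
  then show ?case by (auto simp: degree_pcompose rat_comp_to_fract[symmetric] intro: semigroup_gen.mult)
qed (use assms(2) in \<open>auto intro: semigroup_gen.base\<close>)

text \<open>\<Gamma> is the affine centralizer of \<open>P\<close>; \<open>gamma\<close> maps it
  into and onto itself by the two exchange properties in
  \<open>centralizer_structure\<close>.\<close>

proposition centralized_imp_in_S_semigroup:
  assumes P: "2 \<le> degree P" "\<not> special P"
    and S: "\<And>A. A \<in> S \<Longrightarrow> 0 < degree A" "\<And>A. A \<in> S \<Longrightarrow> A \<circ>\<^sub>p P = P \<circ>\<^sub>p A"
  shows "\<exists>R \<Gamma>. 2 \<le> degree R \<and> \<not> special R \<and> subgroup \<Gamma> (G_group (to_fract R)) \<and>
    gamma (to_fract R) ` \<Gamma> = \<Gamma> \<and> to_fract ` S \<subseteq> S_semigroup \<Gamma> (to_fract R)"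
proof -
  define G where "G = linear_centralizer P"
  obtain R where R: "2 \<le> degree R" "\<not> quadratic_ode R"
    "\<And>\<sigma>. \<sigma> \<in> G \<Longrightarrow> \<exists>\<nu>\<in>G. R \<circ>\<^sub>p \<sigma> = \<nu> \<circ>\<^sub>p R" "\<And>\<nu>. \<nu> \<in> G \<Longrightarrow> \<exists>\<sigma>\<in>G. R \<circ>\<^sub>p \<sigma> = \<nu> \<circ>\<^sub>p R"
    "\<And>A. A \<circ>\<^sub>p P = P \<circ>\<^sub>p A \<Longrightarrow> 0 < degree A \<Longrightarrow> A \<in> semigroup_gen pcompose (insert R G)"
    unfolding G_def using centralizer_structure[of P] P quadratic_ode_iff_special[OF P(1)] by metis
  have R0: "0 < degree R" using R by simp
  have G1: "degree \<sigma> = 1" "0 < degree \<sigma>" if "\<sigma> \<in> G" for \<sigma> using that by (auto simp: G_def linear_centralizer_def)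
  define \<Gamma> where "\<Gamma> = to_fract ` G"
  have comp: "to_fract R \<circ>\<^sub>r to_fract \<sigma> = to_fract \<nu> \<circ>\<^sub>r to_fract R \<longleftrightarrow> R \<circ>\<^sub>p \<sigma> = \<nu> \<circ>\<^sub>p R" if "\<sigma> \<in> G" for \<sigma> \<nu>
    using G1[OF that] R0 by (simp add: rat_comp_to_fract)
  have gammaG: "gamma (to_fract R) (to_fract \<sigma>) = to_fract \<nu>" if "\<sigma> \<in> G" "\<nu> \<in> G" "R \<circ>\<^sub>p \<sigma> = \<nu> \<circ>\<^sub>p R" for \<sigma> \<nu>
    by (intro gamma_eqI rat_nonconst_to_fract R0 moebius_to_fract G1 that(2)) (simp add: comp that)
  have carrier: "to_fract \<sigma> \<in> carrier (G_group (to_fract R))" if \<sigma>: "\<sigma> \<in> G" for \<sigma>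
  proof -
    obtain \<nu> where \<nu>: "\<nu> \<in> G" "R \<circ>\<^sub>p \<sigma> = \<nu> \<circ>\<^sub>p R" using R(3)[OF \<sigma>] by blast
    have "Defs.moebius (to_fract \<nu>)" "to_fract R \<circ>\<^sub>r to_fract \<sigma> = to_fract \<nu> \<circ>\<^sub>r to_fract R"
      using \<nu> comp[OF \<sigma>] G1 by (auto intro: moebius_to_fract)
    then show ?thesis using moebius_to_fract[OF G1(1)[OF \<sigma>]] by (auto simp: G_group_def)
  qed
  have mult: "x \<otimes>\<^bsub>G_group (to_fract R)\<^esub> y = x \<circ>\<^sub>r y" and one: "\<one>\<^bsub>G_group (to_fract R)\<^esub> = to_fract [:0, 1:]" for x y
    by (simp_all add: G_group_def)
  have inv: "\<exists>\<tau>\<in>G. \<sigma> \<circ>\<^sub>p \<tau> = [:0, 1:] \<and> \<tau> \<circ>\<^sub>p \<sigma> = [:0, 1:]" if \<sigma>: "\<sigma> \<in> G" for \<sigma>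
  proof -
    obtain a b where ab: "\<sigma> = [:b, a:]" "a \<noteq> 0" using G1(1)[OF \<sigma>] by (rule degree_1_E)
    define \<tau> where "\<tau> = [:-b/a, 1/a:]"
    have \<tau>: "\<sigma> \<circ>\<^sub>p \<tau> = [:0, 1:]" "\<tau> \<circ>\<^sub>p \<sigma> = [:0, 1:]" unfolding \<tau>_def ab(1) by (fact pcompose_linear_inverse[OF ab(2)])+
    have c: "\<sigma> \<circ>\<^sub>p P = P \<circ>\<^sub>p \<sigma>" using \<sigma> by (simp add: G_def linear_centralizer_def)
    have "\<tau> \<circ>\<^sub>p P = \<tau> \<circ>\<^sub>p (P \<circ>\<^sub>p \<sigma>) \<circ>\<^sub>p \<tau>" by (simp add: \<tau> flip: pcompose_assoc)
    also have "\<dots> = (\<tau> \<circ>\<^sub>p \<sigma>) \<circ>\<^sub>p P \<circ>\<^sub>p \<tau>" by (simp only: c[symmetric] pcompose_assoc)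
    finally have "\<tau> \<circ>\<^sub>p P = P \<circ>\<^sub>p \<tau>" by (simp add: \<tau>)
    then have "\<tau> \<in> G" using ab(2) by (simp add: G_def linear_centralizer_def \<tau>_def)
    with \<tau> show ?thesis by blast
  qed
  have "subgroup \<Gamma> (G_group (to_fract R))"
  proof
    show "\<Gamma> \<subseteq> carrier (G_group (to_fract R))" using carrier by (auto simp: \<Gamma>_def)
    show "\<one>\<^bsub>G_group (to_fract R)\<^esub> \<in> \<Gamma>" by (auto simp: one \<Gamma>_def G_def linear_centralizer_def)
    show "x \<otimes>\<^bsub>G_group (to_fract R)\<^esub> y \<in> \<Gamma>" if xy: "x \<in> \<Gamma>" "y \<in> \<Gamma>" for x y
    proof -
      obtain \<sigma> \<tau> where st: "\<sigma> \<in> G" "\<tau> \<in> G" "x = to_fract \<sigma>" "y = to_fract \<tau>" using xy by (auto simp: \<Gamma>_def)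
      have c: "\<sigma> \<circ>\<^sub>p P = P \<circ>\<^sub>p \<sigma>" "\<tau> \<circ>\<^sub>p P = P \<circ>\<^sub>p \<tau>" using st by (auto simp: G_def linear_centralizer_def)
      have "\<sigma> \<circ>\<^sub>p \<tau> \<circ>\<^sub>p P = P \<circ>\<^sub>p (\<sigma> \<circ>\<^sub>p \<tau>)" by (metis c pcompose_assoc)
      then have "\<sigma> \<circ>\<^sub>p \<tau> \<in> G" using G1(1)[OF st(1)] G1(1)[OF st(2)]
        by (simp add: G_def linear_centralizer_def degree_pcompose)
      then show ?thesis using G1(2)[OF st(2)] by (simp add: mult st rat_comp_to_fract \<Gamma>_def)
    qed
    show "inv\<^bsub>G_group (to_fract R)\<^esub> x \<in> \<Gamma>" if x: "x \<in> \<Gamma>" for x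
    proof -
      obtain \<sigma> where \<sigma>: "\<sigma> \<in> G" "x = to_fract \<sigma>" using x by (auto simp: \<Gamma>_def)
      obtain \<tau> where \<tau>: "\<tau> \<in> G" "\<sigma> \<circ>\<^sub>p \<tau> = [:0, 1:]" "\<tau> \<circ>\<^sub>p \<sigma> = [:0, 1:]" using inv[OF \<sigma>(1)] by blast
      have e: "x \<circ>\<^sub>r to_fract \<tau> = to_fract [:0, 1:]" "to_fract \<tau> \<circ>\<^sub>r x = to_fract [:0, 1:]"
        using \<tau> G1(2)[OF \<sigma>(1)] G1(2)[OF \<tau>(1)] by (simp_all add: \<sigma>(2) rat_comp_to_fract)
      have "inv\<^bsub>G_group (to_fract R)\<^esub> x = to_fract \<tau>"
        unfolding m_inv_def mult one
      proof (rule the_equality)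
        show "to_fract \<tau> \<in> carrier (G_group (to_fract R)) \<and> x \<circ>\<^sub>r to_fract \<tau> = to_fract [:0, 1:] \<and> to_fract \<tau> \<circ>\<^sub>r x = to_fract [:0, 1:]"
          using carrier[OF \<tau>(1)] e by blast
        fix y assume "y \<in> carrier (G_group (to_fract R)) \<and> x \<circ>\<^sub>r y = to_fract [:0, 1:] \<and> y \<circ>\<^sub>r x = to_fract [:0, 1:]"
        then have "y \<circ>\<^sub>r x = to_fract \<tau> \<circ>\<^sub>r x" using e by simp
        then show "y = to_fract \<tau>"
          using rat_comp_inject[of x y "to_fract \<tau>"] rat_nonconst_to_fract[OF G1(2)[OF \<sigma>(1)]] \<sigma>(2) by simp
      qed
      then show ?thesis using \<tau>(1) by (simp add: \<Gamma>_def)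
    qed
  qed
  moreover have "gamma (to_fract R) ` \<Gamma> = \<Gamma>"
  proof
    show "gamma (to_fract R) ` \<Gamma> \<subseteq> \<Gamma>"
    proof
      fix x assume "x \<in> gamma (to_fract R) ` \<Gamma>"
      then obtain \<sigma> where \<sigma>: "\<sigma> \<in> G" "x = gamma (to_fract R) (to_fract \<sigma>)" by (auto simp: \<Gamma>_def)
      obtain \<nu> where \<nu>: "\<nu> \<in> G" "R \<circ>\<^sub>p \<sigma> = \<nu> \<circ>\<^sub>p R" using R(3)[OF \<sigma>(1)] by blast
      then show "x \<in> \<Gamma>" using gammaG[OF \<sigma>(1) \<nu>] \<sigma>(2) by (simp add: \<Gamma>_def)
    qed
    show "\<Gamma> \<subseteq> gamma (to_fract R) ` \<Gamma>"
    proof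
      fix x assume "x \<in> \<Gamma>"
      then obtain \<nu> where \<nu>: "\<nu> \<in> G" "x = to_fract \<nu>" by (auto simp: \<Gamma>_def)
      obtain \<sigma> where \<sigma>: "\<sigma> \<in> G" "R \<circ>\<^sub>p \<sigma> = \<nu> \<circ>\<^sub>p R" using R(4)[OF \<nu>(1)] by blast
      have "x = gamma (to_fract R) (to_fract \<sigma>)" using gammaG[OF \<sigma>(1) \<nu>(1) \<sigma>(2)] \<nu>(2) by simp
      then show "x \<in> gamma (to_fract R) ` \<Gamma>" using \<sigma>(1) by (auto simp: \<Gamma>_def)
    qed
  qed
  moreover have "to_fract ` S \<subseteq> S_semigroup \<Gamma> (to_fract R)"
  proof
    fix x assume "x \<in> to_fract ` S"
    then obtain A where A: "A \<in> S" "x = to_fract A" by blast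
    have "A \<in> semigroup_gen pcompose (insert R G)" using R(5) S A(1) by blast
    then have "to_fract A \<in> semigroup_gen (\<circ>\<^sub>r) (to_fract ` insert R G)"
      using to_fract_semigroup_gen G1(2) R0 by blast
    then show "x \<in> S_semigroup \<Gamma> (to_fract R)" by (simp add: S_semigroup_def \<Gamma>_def A(2))
  qed
  moreover have "\<not> special R" using R(2) quadratic_ode_iff_special[OF R(1)] by blast
  ultimately show ?thesis using R(1) by blast
qed

text \<open>\<Gamma> turns out to be affine; some iterate of \<open>R\<close> then commutes with all
  of it, and trivially with \<open>R\<close>, hence with everything they generate.\<close>

proposition in_S_semigroup_imp_centralized:
  assumes R: "2 \<le> degree R" "\<not> special R" and sub: "subgroup \<Gamma> (G_group (to_fract R))"
    and gam: "gamma (to_fract R) ` \<Gamma> = \<Gamma>" and S: "to_fract ` S \<subseteq> S_semigroup \<Gamma> (to_fract R)"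
  obtains P where "2 \<le> degree P" "\<not> special P" "\<And>A. A \<in> S \<Longrightarrow> A \<circ>\<^sub>p P = P \<circ>\<^sub>p A"
proof -
  have R0: "0 < degree R" using R by simp
  have nR: "\<not> quadratic_ode R" using R quadratic_ode_iff_special by blast
  have carrier: "Defs.moebius \<sigma> \<and> (\<exists>\<nu>. Defs.moebius \<nu> \<and> to_fract R \<circ>\<^sub>r \<sigma> = \<nu> \<circ>\<^sub>r to_fract R)" if "\<sigma> \<in> \<Gamma>" for \<sigma>
    using subgroup.mem_carrier[OF sub that] by (simp add: G_group_def)
  have gam_eq: "to_fract R \<circ>\<^sub>r \<sigma> = gamma (to_fract R) \<sigma> \<circ>\<^sub>r to_fract R" if "\<sigma> \<in> \<Gamma>" for \<sigma>
    using carrier[OF that] gamma_eqI[OF rat_nonconst_to_fract[OF R0]] by metis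
  have 1: "Defs.moebius \<sigma>" if "\<sigma> \<in> \<Gamma>" for \<sigma> using carrier[OF that] by blast
  have 2: "\<exists>\<nu>\<in>\<Gamma>. to_fract R \<circ>\<^sub>r \<sigma> = \<nu> \<circ>\<^sub>r to_fract R" if "\<sigma> \<in> \<Gamma>" for \<sigma>
    using gam_eq[OF that] gam that by blast
  have 3: "\<exists>\<sigma>\<in>\<Gamma>. to_fract R \<circ>\<^sub>r \<sigma> = \<nu> \<circ>\<^sub>r to_fract R" if "\<nu> \<in> \<Gamma>" for \<nu>
    using gam_eq gam that by (metis imageE)
  have lin: "\<exists>s. degree s = 1 \<and> \<sigma> = to_fract s" if "\<sigma> \<in> \<Gamma>" for \<sigma>
    using moebius_group_linear[OF R 1 2 3 that] by metis
  define G where "G = {s. degree s = 1 \<and> to_fract s \<in> \<Gamma>}"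
  have comp: "to_fract R \<circ>\<^sub>r to_fract \<sigma> = to_fract \<nu> \<circ>\<^sub>r to_fract R \<longleftrightarrow> R \<circ>\<^sub>p \<sigma> = \<nu> \<circ>\<^sub>p R" if "degree \<sigma> = 1" for \<sigma> \<nu>
    using that R0 by (simp add: rat_comp_to_fract)
  have g1: "degree \<sigma> = 1" if "\<sigma> \<in> G" for \<sigma> using that by (simp add: G_def)
  have g2: "\<exists>\<nu>\<in>G. R \<circ>\<^sub>p \<sigma> = \<nu> \<circ>\<^sub>p R" if \<sigma>: "\<sigma> \<in> G" for \<sigma>
  proof -
    obtain \<nu> where \<nu>: "\<nu> \<in> \<Gamma>" "to_fract R \<circ>\<^sub>r to_fract \<sigma> = \<nu> \<circ>\<^sub>r to_fract R" using 2 \<sigma> by (auto simp: G_def)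
    obtain s where s: "degree s = 1" "\<nu> = to_fract s" using lin[OF \<nu>(1)] by blast
    then have "s \<in> G" using \<nu>(1) by (simp add: G_def)
    moreover have "R \<circ>\<^sub>p \<sigma> = s \<circ>\<^sub>p R" using \<nu>(2) comp[OF g1[OF \<sigma>]] s(2) by simp
    ultimately show ?thesis by blast
  qed
  have g3: "\<exists>\<sigma>\<in>G. R \<circ>\<^sub>p \<sigma> = \<nu> \<circ>\<^sub>p R" if \<nu>: "\<nu> \<in> G" for \<nu>
  proof -
    obtain \<sigma> where \<sigma>: "\<sigma> \<in> \<Gamma>" "to_fract R \<circ>\<^sub>r \<sigma> = to_fract \<nu> \<circ>\<^sub>r to_fract R" using 3 \<nu> by (auto simp: G_def)
    obtain s where s: "degree s = 1" "\<sigma> = to_fract s" using lin[OF \<sigma>(1)] by blast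
    then have "s \<in> G" using \<sigma>(1) by (simp add: G_def)
    moreover have "R \<circ>\<^sub>p s = \<nu> \<circ>\<^sub>p R" using \<sigma>(2) comp[OF s(1)] s(2) by simp
    ultimately show ?thesis by blast
  qed
  obtain K where K: "1 \<le> K" "\<And>\<sigma>. \<sigma> \<in> G \<Longrightarrow> \<sigma> \<circ>\<^sub>p poly_iter R K = poly_iter R K \<circ>\<^sub>p \<sigma>"
    using linear_group_centralized[OF R(1) nR g1 g2 g3] by blast
  define P where "P = poly_iter R K"
  have P2: "2 \<le> degree P" using R K self_le_power[of "degree R" K] by (simp add: P_def degree_poly_iter)
  have nP: "\<not> special P"
    using quadratic_ode_of_poly_iter[OF _ K(1) R(1)] nR quadratic_ode_iff_special[OF P2] by (auto simp: P_def)
  have gen: "\<exists>p. f = to_fract p \<and> 0 < degree p \<and> p \<circ>\<^sub>p P = P \<circ>\<^sub>p p" if "f \<in> S_semigroup \<Gamma> (to_fract R)" for f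
    using that unfolding S_semigroup_def
  proof induction
    case (base f)
    then show ?case
    proof
      assume "f = to_fract R"
      then show ?thesis using R0 poly_iter_commute[of R K] by (auto simp: P_def)
    next
      assume f: "f \<in> \<Gamma>"
      then obtain s where s: "degree s = 1" "f = to_fract s" using lin by blast
      then have "s \<in> G" using f by (simp add: G_def)
      then show ?thesis using K(2) s by (auto simp: P_def)
    qed
  next
    case (mult f g)
    then obtain p q where pq: "f = to_fract p" "0 < degree p" "p \<circ>\<^sub>p P = P \<circ>\<^sub>p p"
      "g = to_fract q" "0 < degree q" "q \<circ>\<^sub>p P = P \<circ>\<^sub>p q" by blast
    have "p \<circ>\<^sub>p q \<circ>\<^sub>p P = P \<circ>\<^sub>p (p \<circ>\<^sub>p q)" by (metis pq(3,6) pcompose_assoc)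
    then show ?case using pq by (intro exI[of _ "p \<circ>\<^sub>p q"]) (simp add: rat_comp_to_fract degree_pcompose)
  qed
  show thesis
  proof (rule that[OF P2 nP])
    fix A assume "A \<in> S"
    then have "to_fract A \<in> S_semigroup \<Gamma> (to_fract R)" using S by blast
    then show "A \<circ>\<^sub>p P = P \<circ>\<^sub>p A" using gen[of "to_fract A"] by auto
  qed
qed

theorem theorem1p1:
  fixes S :: "complex poly set"
  assumes "poly_semigroup S"
    and "\<exists>P\<in>S. 1 < degree P \<and> \<not> special P"
  shows
    "let c1 = left_reversible pcompose S;
         c2 = left_amenable pcompose S;
         c3 = amenable pcompose S;
         c4 = (\<exists>R \<Gamma>. 2 \<le> degree R \<and> \<not> special R \<and> subgroup \<Gamma> (G_group (to_fract R)) \<and>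
                 gamma (to_fract R) ` \<Gamma> = \<Gamma> \<and> to_fract ` S \<subseteq> S_semigroup \<Gamma> (to_fract R));
         c5 = (\<exists>P. 2 \<le> degree P \<and> \<not> special P \<and> to_fract ` S \<subseteq> rat_centralizer (to_fract P));
         c6 = (\<forall>A\<in>S. \<forall>B\<in>S. \<exists>k\<ge>1. \<exists>l\<ge>1. poly_iter A k = poly_iter B l)
     in (c1 \<longleftrightarrow> c2) \<and> (c2 \<longleftrightarrow> c3) \<and> (c3 \<longleftrightarrow> c4) \<and> (c4 \<longleftrightarrow> c5) \<and>
        ((\<forall>A\<in>S. 2 \<le> degree A) \<longrightarrow>
           (c1 \<longleftrightarrow> c6) \<and> (c2 \<longleftrightarrow> c6) \<and> (c3 \<longleftrightarrow> c6) \<and> (c4 \<longleftrightarrow> c6) \<and> (c5 \<longleftrightarrow> c6))"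
proof -
  obtain P0 where P0: "P0 \<in> S" "2 \<le> degree P0" "\<not> special P0" using assms(2) by auto
  have pos: "0 < degree A" if "A \<in> S" for A using assms(1) that by (simp add: poly_semigroup_def)
  have closed: "A \<circ>\<^sub>p B \<in> S" if "A \<in> S" "B \<in> S" for A B using assms(1) that by (simp add: poly_semigroup_def)
  define c1 where "c1 = left_reversible pcompose S"
  define c2 where "c2 = left_amenable pcompose S"
  define c3 where "c3 = amenable pcompose S"
  define c4 where "c4 = (\<exists>R \<Gamma>. 2 \<le> degree R \<and> \<not> special R \<and> subgroup \<Gamma> (G_group (to_fract R)) \<and>
                 gamma (to_fract R) ` \<Gamma> = \<Gamma> \<and> to_fract ` S \<subseteq> S_semigroup \<Gamma> (to_fract R))"
  define c5 where "c5 = (\<exists>P. 2 \<le> degree P \<and> \<not> special P \<and> to_fract ` S \<subseteq> rat_centralizer (to_fract P))"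
  define c6 where "c6 = (\<forall>A\<in>S. \<forall>B\<in>S. \<exists>k\<ge>1. \<exists>l\<ge>1. poly_iter A k = poly_iter B l)"
  have c5_iff: "c5 \<longleftrightarrow> (\<exists>P. 2 \<le> degree P \<and> \<not> special P \<and> (\<forall>A\<in>S. A \<circ>\<^sub>p P = P \<circ>\<^sub>p A))"
    unfolding c5_def image_subset_iff using to_fract_in_rat_centralizer pos
    by (metis (no_types, lifting) less_le_trans zero_less_numeral)
  have "c3 \<Longrightarrow> c2" by (simp add: c2_def c3_def amenable_def)
  moreover have "c2 \<Longrightarrow> c1"
    unfolding c1_def c2_def using closed by (rule left_amenable_imp_left_reversible)
  moreover have "c1 \<Longrightarrow> c5"
  proof -
    assume "c1"
    then obtain Q where Q: "2 \<le> degree Q" "\<not> quadratic_ode Q" "\<And>A. A \<in> S \<Longrightarrow> A \<circ>\<^sub>p Q = Q \<circ>\<^sub>p A"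
      using left_reversible_imp_centralized[OF assms(1) P0(1,2)] P0(3) quadratic_ode_iff_special[OF P0(2)]
      unfolding c1_def by blast
    then show c5 unfolding c5_iff using quadratic_ode_iff_special[OF Q(1)] by blast
  qed
  moreover have "c5 \<Longrightarrow> c3"
    unfolding c5_iff c3_def
    using centralized_imp_amenable[OF assms(1) P0(1,2)] quadratic_ode_iff_special by blast
  moreover have "c5 \<Longrightarrow> c4"
    unfolding c5_iff c4_def using centralized_imp_in_S_semigroup[of _ S] pos by blast
  moreover have "c4 \<Longrightarrow> c5"
    unfolding c5_iff c4_def using in_S_semigroup_imp_centralized[of _ _ S] by metis
  moreover have "c5 \<Longrightarrow> c6" if big: "\<forall>A\<in>S. 2 \<le> degree A"
  proof -
    assume c5
    then obtain P where P: "2 \<le> degree P" "\<not> quadratic_ode P" "\<And>A. A \<in> S \<Longrightarrow> A \<circ>\<^sub>p P = P \<circ>\<^sub>p A"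
      unfolding c5_iff using quadratic_ode_iff_special by blast
    show c6 unfolding c6_def
    proof (intro ballI)
      fix A B assume AB: "A \<in> S" "B \<in> S"
      obtain i j where ij: "1 \<le> i" "1 \<le> j" "poly_iter A i = poly_iter P j"
        using commuting_common_iterate[OF P(3)[OF AB(1)] P(1) _ P(2)] big AB by blast
      obtain i' j' where ij': "1 \<le> i'" "1 \<le> j'" "poly_iter B i' = poly_iter P j'"
        using commuting_common_iterate[OF P(3)[OF AB(2)] P(1) _ P(2)] big AB by blast
      \<comment> \<open>Both sides equal \<open>poly_iter P (j * j')\<close>.\<close>
      have "poly_iter A (i * j') = poly_iter B (i' * j)"
        by (simp add: poly_iter_mult ij(3) ij'(3)) (simp add: mult.commute flip: poly_iter_mult)
      moreover have "1 \<le> i * j'" "1 \<le> i' * j" using ij ij' by simp_all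
      ultimately show "\<exists>k\<ge>1. \<exists>l\<ge>1. poly_iter A k = poly_iter B l" by blast
    qed
  qed
  moreover have "c6 \<Longrightarrow> c1"
    unfolding c6_def c1_def left_reversible_def
  proof (intro ballI)
    fix A B assume c6: "\<forall>A\<in>S. \<forall>B\<in>S. \<exists>k\<ge>1. \<exists>l\<ge>1. poly_iter A k = poly_iter B l" and AB: "A \<in> S" "B \<in> S"
    then obtain k l where kl: "1 \<le> k" "1 \<le> l" "poly_iter A k = poly_iter B l" by blast
    \<comment> \<open>Exponents are doubled so that an iterate in \<open>S\<close> remains after
      splitting off one factor; \<open>S\<close> need not contain the identity.\<close>
    have "poly_iter A (k * 2) = poly_iter B (l * 2)" by (simp add: poly_iter_mult kl(3))
    moreover have "k * 2 = Suc (k * 2 - 1)" "l * 2 = Suc (l * 2 - 1)" using kl by simp_all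
    ultimately have "A \<circ>\<^sub>p poly_iter A (k * 2 - 1) = B \<circ>\<^sub>p poly_iter B (l * 2 - 1)" by (metis poly_iter_Suc)
    moreover have "poly_iter A (k * 2 - 1) \<in> S" "poly_iter B (l * 2 - 1) \<in> S"
      using kl by (auto intro!: poly_iter_mem assms(1) AB)
    ultimately show "\<exists>x\<in>S. \<exists>y\<in>S. A \<circ>\<^sub>p x = B \<circ>\<^sub>p y" by blast
  qed
  ultimately show ?thesis
    unfolding Let_def c1_def[symmetric] c2_def[symmetric] c3_def[symmetric] c4_def[symmetric]
      c5_def[symmetric] c6_def[symmetric] by blast
qed

end
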